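(* Let $q$ be a power of the prime number $p$, let $K$ be a finite extension of the function field $\mathbb{F}_q(t)$, and let $\Phi$ be a Drinfeld module of generic characteristic defined over $K$. Let $\Gamma$ be a finitely generated $\Phi$-submodule of $\mathbb{G}_a(K)$, let $\alpha\in K$, and let $S$ be a finite set of places of $K$. Then there are only finitely many $\gamma\in\Gamma$ such that $\gamma$ is $S$-integral with respect to $\alpha$.
   Context: Let $A=\mathbb{F}_q[t]$ and let $\tau$ denote the $q$-power Frobenius $x\mapsto x^q$. Let $K\{\tau\}$ be the ring of polynomials in $\tau$ with coefficients in $K$, with usual addition and with multiplication given by composition ($\tau c=c^q\tau$). A Drinfeld module (of generic characteristic) over $K$ is a ring homomorphism $\Phi:A\to K\{\tau\}$, $a\mapsto\Phi_a$, such that the coefficient of $\tau^0$ in $\Phi_a$ equals $a$ for every $a\in A$, and $\Phi_a\neq a\tau^0$ for some $a\in A$. It makes $\mathbb{G}_a(K)=K$ into an $A$-module via $a*x=\Phi_a(x)$; a $\Phi$-submodule is an additive subgroup invariant under all $\Phi_a$, and it is finitely generated if it is finitely generated as an $A$-module under this action. Let $M_K$ be the set of places of $K$, with absolute values $|\cdot|_v$ normalized so that the product formula holds. For a finite set $S\subset M_K$ and $\alpha\in K$, an element $\beta\in K$ is $S$-integral with respect to $\alpha$ if for every place $v\notin S$: if $|\alpha|_v\le 1$ then $|\alpha-\beta|_v\ge 1$; and if $|\alpha|_v>1$ then $|\beta|_v\le 1$. *)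

theory Defs
  imports "HOL-Computational_Algebra.Computational_Algebra"
begin

section \<open>Finite extensions of the rational function field\<close>

text \<open>
  The field of constants is a type \<open>'k\<close> of class \<open>finite_field\<close>, with \<open>q\<close> elements; the ring
  \<open>\<bbbF>\<^sub>q[t]\<close> is \<open>'k poly\<close> and its fraction field \<open>\<bbbF>\<^sub>q(t)\<close> is \<open>'k poly fract\<close>. An extension \<open>K\<close> of
  \<open>\<bbbF>\<^sub>q(t)\<close> is a field type \<open>'a\<close> with a ring homomorphism \<open>\<iota> : \<bbbF>\<^sub>q(t) \<rightarrow> K\<close> (automatically injective).
\<close>

definition finite_field_extension :: "('f::field \<Rightarrow> 'a::field) \<Rightarrow> bool" where
  "finite_field_extension \<iota> \<longleftrightarrow>
     (\<forall>x y. \<iota> (x + y) = \<iota> x + \<iota> y) \<and> (\<forall>x y. \<iota> (x * y) = \<iota> x * \<iota> y) \<and> \<iota> 1 = 1 \<and>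
     (\<exists>B. finite_dimensional_vector_space (\<lambda>c x. \<iota> c * x) B)"

definition poly_embed :: "('k::finite_field poly fract \<Rightarrow> 'a::field) \<Rightarrow> 'k poly \<Rightarrow> 'a" where
  "poly_embed \<iota> a = \<iota> (Fraction_Field.Fract a 1)"


section \<open>Twisted polynomials and Drinfeld modules\<close>

text \<open>
  The twisted polynomial \<open>\<Sum>i. c\<^sub>i \<tau>\<^sup>i\<close> in \<open>K{\<tau>}\<close> is represented by the element of \<open>'a poly\<close> with the
  same coefficients. Addition and \<open>1\<close> are those of \<open>'a poly\<close>, but multiplication is the one
  determined by \<open>\<tau> c = c\<^sup>q \<tau>\<close>, that is, \<open>(c \<tau>\<^sup>i) (d \<tau>\<^sup>j) = c d\<^bsup>q^i\<^esup> \<tau>\<^bsup>i+j\<^esup>\<close>.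
\<close>

definition twisted_mult :: "nat \<Rightarrow> 'a::field poly \<Rightarrow> 'a poly \<Rightarrow> 'a poly" where
  "twisted_mult q f g =
     (\<Sum>i\<le>degree f. \<Sum>j\<le>degree g. monom (coeff f i * coeff g j ^ (q ^ i)) (i + j))"

definition twisted_eval :: "nat \<Rightarrow> 'a::field poly \<Rightarrow> 'a \<Rightarrow> 'a" where
  "twisted_eval q f x = (\<Sum>i\<le>degree f. coeff f i * x ^ (q ^ i))"

definition drinfeld_module ::
  "nat \<Rightarrow> ('k::finite_field poly fract \<Rightarrow> 'a::field) \<Rightarrow> ('k poly \<Rightarrow> 'a poly) \<Rightarrow> bool" where
  "drinfeld_module q \<iota> \<Phi> \<longleftrightarrow>
     (\<forall>a b. \<Phi> (a + b) = \<Phi> a + \<Phi> b) \<and>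
     (\<forall>a b. \<Phi> (a * b) = twisted_mult q (\<Phi> a) (\<Phi> b)) \<and>
     \<Phi> 1 = 1 \<and>
     (\<forall>a. coeff (\<Phi> a) 0 = poly_embed \<iota> a) \<and>
     (\<exists>a. \<Phi> a \<noteq> [:poly_embed \<iota> a:])"

definition drinfeld_action ::
  "nat \<Rightarrow> ('k::finite_field poly \<Rightarrow> 'a::field poly) \<Rightarrow> 'k poly \<Rightarrow> 'a \<Rightarrow> 'a" where
  "drinfeld_action q \<Phi> a x = twisted_eval q (\<Phi> a) x"

definition drinfeld_submodule ::
  "nat \<Rightarrow> ('k::finite_field poly \<Rightarrow> 'a::field poly) \<Rightarrow> 'a set \<Rightarrow> bool" where
  "drinfeld_submodule q \<Phi> \<Gamma> \<longleftrightarrow>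
     0 \<in> \<Gamma> \<and> (\<forall>x\<in>\<Gamma>. \<forall>y\<in>\<Gamma>. x + y \<in> \<Gamma>) \<and> (\<forall>x\<in>\<Gamma>. - x \<in> \<Gamma>) \<and>
     (\<forall>a. \<forall>x\<in>\<Gamma>. drinfeld_action q \<Phi> a x \<in> \<Gamma>)"

text \<open>
  \<open>module.span\<close> is taken with respect to the \<open>A\<close>-module structure given by \<open>\<Phi>\<close>; that this is a
  module is shown in \<open>module_drinfeld_action\<close> below.
\<close>

definition drinfeld_finitely_generated ::
  "nat \<Rightarrow> ('k::finite_field poly \<Rightarrow> 'a::field poly) \<Rightarrow> 'a set \<Rightarrow> bool" where
  "drinfeld_finitely_generated q \<Phi> \<Gamma> \<longleftrightarrow>
     (\<exists>G. finite G \<and> G \<subseteq> \<Gamma> \<and> module.span (drinfeld_action q \<Phi>) G = \<Gamma>)"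

lemma twisted_eval_bound:
  assumes "degree f \<le> n"
  shows "twisted_eval q f x = (\<Sum>i\<le>n. coeff f i * x ^ (q ^ i))"
  unfolding twisted_eval_def
  by (rule sum.mono_neutral_left) (use assms in \<open>auto simp: coeff_eq_0\<close>)

lemma twisted_eval_add: "twisted_eval q (f + g) x = twisted_eval q f x + twisted_eval q g x"
proof -
  define n where "n = max (degree f) (degree g)"
  have "degree f \<le> n" "degree g \<le> n" "degree (f + g) \<le> n"
    by (auto simp: n_def degree_add_le)
  then show ?thesis
    by (simp add: twisted_eval_bound[of _ n] sum.distrib ring_distribs)
qed

lemma twisted_eval_sum: "twisted_eval q (sum f I) x = (\<Sum>i\<in>I. twisted_eval q (f i) x)"
  by (induction I rule: infinite_finite_induct) (simp_all add: twisted_eval_add, simp_all add: twisted_eval_def)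

lemma twisted_eval_monom: "twisted_eval q (monom c n) x = c * x ^ (q ^ n)"
proof -
  have "twisted_eval q (monom c n) x = (\<Sum>i\<le>n. coeff (monom c n) i * x ^ (q ^ i))"
    by (rule twisted_eval_bound) (rule degree_monom_le)
  also have "\<dots> = (\<Sum>i\<le>n. if n = i then c * x ^ (q ^ i) else 0)"
    by (rule sum.cong) auto
  finally show ?thesis by simp
qed

lemma twisted_eval_mult:
  fixes f g :: "'a::field poly"
  assumes "q = CHAR('a) ^ n" "prime CHAR('a)"
  shows "twisted_eval q (twisted_mult q f g) x = twisted_eval q f (twisted_eval q g x)"
proof -
  have frob: "sum h I ^ (q ^ i) = (\<Sum>j\<in>I. h j ^ (q ^ i))" for h :: "nat \<Rightarrow> 'a" and I i
    using assms by (intro freshmans_dream_sum'[where n = "n * i"]) (auto simp: power_mult)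
  show ?thesis
    unfolding twisted_mult_def twisted_eval_sum twisted_eval_monom
    unfolding twisted_eval_def frob
    by (simp add: sum_distrib_left power_mult_distrib mult.assoc power_add
             flip: power_mult, simp add: mult.commute)
qed

lemma CHAR_finite_field_extension:
  fixes \<iota> :: "'k::finite_field poly fract \<Rightarrow> 'a::field"
  assumes "finite_field_extension \<iota>"
  shows "CHAR('a) = CHAR('k)"
proof -
  have \<iota>: "\<iota> (x + y) = \<iota> x + \<iota> y" "\<iota> 1 = 1" for x y
    using assms by (auto simp: finite_field_extension_def)
  have "\<iota> 0 = 0" by (metis \<iota>(1) add_0 add_right_cancel)
  then have nat: "\<iota> (of_nat n) = of_nat n" for n
    by (induction n) (simp_all add: \<iota>)
  have "(of_nat CHAR('k) :: 'k poly fract) = Fraction_Field.Fract (of_nat CHAR('k)) 1"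
    by (simp add: Fraction_Field.of_nat_fract)
  also have "(of_nat CHAR('k) :: 'k poly) = 0"
    by (metis of_nat_CHAR semiring_char_poly)
  finally have "(of_nat CHAR('k) :: 'k poly fract) = 0"
    by (simp add: Zero_fract_def)
  then have "(of_nat CHAR('k) :: 'a) = 0"
    using nat[of "CHAR('k)"] \<open>\<iota> 0 = 0\<close> by simp
  then have "CHAR('a) dvd CHAR('k)"
    by (simp add: of_nat_eq_0_iff_char_dvd)
  then show ?thesis
    using prime_nat_iff CHAR_prime[where 'a = 'k] CHAR_not_1'[where 'a = 'a] by auto
qed

lemma module_drinfeld_action:
  fixes \<iota> :: "'k::finite_field poly fract \<Rightarrow> 'a::field"
  assumes q: "prime p" "q = p ^ n" "card (UNIV :: 'k set) = q"
    and ext: "finite_field_extension \<iota>" and drin: "drinfeld_module q \<iota> \<Phi>"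
  shows "module (drinfeld_action q \<Phi>)"
proof -
  have "(\<Sum>x\<in>(UNIV :: 'k set). x + 1) = (\<Sum>x\<in>UNIV. x)"
    by (rule sum.reindex_bij_witness[of _ "\<lambda>x. x - 1" "\<lambda>x. x + 1"]) auto
  then have "(of_nat (card (UNIV :: 'k set)) :: 'k) = 0"
    by (simp add: sum.distrib)
  then have "CHAR('k) dvd p ^ n"
    using q by (metis of_nat_eq_0_iff_char_dvd)
  then have "CHAR('k) = p"
    using q(1) CHAR_prime[where 'a = 'k] prime_dvd_power primes_dvd_imp_eq by blast
  then have char: "CHAR('a) = p"
    using CHAR_finite_field_extension[OF ext] by simp
  have frob: "(x + y) ^ (q ^ i) = x ^ (q ^ i) + y ^ (q ^ i)" for x y :: 'a and i
    using q char by (intro freshmans_dream'[where n = "n * i"]) (auto simp: power_mult)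
  have hom: "\<Phi> (a + b) = \<Phi> a + \<Phi> b" "\<Phi> (a * b) = twisted_mult q (\<Phi> a) (\<Phi> b)" "\<Phi> 1 = 1" for a b
    using drin by (auto simp: drinfeld_module_def)
  show ?thesis
  proof
    fix a b :: "'k poly" and x y :: 'a
    show "drinfeld_action q \<Phi> a (x + y) = drinfeld_action q \<Phi> a x + drinfeld_action q \<Phi> a y"
      by (simp add: drinfeld_action_def twisted_eval_def frob ring_distribs sum.distrib)
    show "drinfeld_action q \<Phi> (a + b) x = drinfeld_action q \<Phi> a x + drinfeld_action q \<Phi> b x"
      by (simp add: drinfeld_action_def hom twisted_eval_add)
    show "drinfeld_action q \<Phi> a (drinfeld_action q \<Phi> b x) = drinfeld_action q \<Phi> (a * b) x"
      using twisted_eval_mult[where 'a = 'a, of q n "\<Phi> a" "\<Phi> b" x] q(1,2) char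
      by (simp add: drinfeld_action_def hom)
    show "drinfeld_action q \<Phi> 1 x = x"
      by (simp add: drinfeld_action_def hom twisted_eval_def)
  qed
qed


section \<open>Places and integrality\<close>

text \<open>As \<open>K\<close> has positive characteristic, the triangle inequality forces the ultrametric one.\<close>

definition absolute_value :: "('a::field \<Rightarrow> real) \<Rightarrow> bool" where
  "absolute_value v \<longleftrightarrow>
     (\<forall>x. v x \<ge> 0) \<and> (\<forall>x. v x = 0 \<longleftrightarrow> x = 0) \<and>
     (\<forall>x y. v (x * y) = v x * v y) \<and> (\<forall>x y. v (x + y) \<le> v x + v y)"

definition nontrivial_absolute_value :: "('a::field \<Rightarrow> real) \<Rightarrow> bool" where
  "nontrivial_absolute_value v \<longleftrightarrow> absolute_value v \<and> (\<exists>x. x \<noteq> 0 \<and> v x \<noteq> 1)"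

text \<open>
  The cardinality of the residue field: valuation ring \<open>{x. v x \<le> 1}\<close> modulo \<open>{x. v x < 1}\<close>.
\<close>

definition residue_card :: "('a::field \<Rightarrow> real) \<Rightarrow> nat" where
  "residue_card v = card ({x. v x \<le> 1} // {(x, y). v x \<le> 1 \<and> v y \<le> 1 \<and> v (x - y) < 1})"

text \<open>
  A place, i.e. an equivalence class of nontrivial absolute values on the global function field
  \<open>K\<close>, is represented by its normalized member, the one that takes the value \<open>1 / N\<close> on a
  uniformizer, where \<open>N\<close> is the cardinality of the residue field. Every class contains exactly one
  such absolute value, and the product formula \<open>\<Prod>v. |x|\<^sub>v = 1\<close> holds for this normalization.
\<close>

definition places :: "('a::field \<Rightarrow> real) set" where
  "places = {v. nontrivial_absolute_value v \<and>
     v ` (UNIV - {0}) = range (\<lambda>n::int. real (residue_card v) powi n)}"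

definition S_integral :: "('a::field \<Rightarrow> real) set \<Rightarrow> 'a \<Rightarrow> 'a \<Rightarrow> bool" where
  "S_integral S \<alpha> \<beta> \<longleftrightarrow>
     (\<forall>v \<in> places - S. (v \<alpha> \<le> 1 \<longrightarrow> v (\<alpha> - \<beta>) \<ge> 1) \<and> (v \<alpha> > 1 \<longrightarrow> v \<beta> \<le> 1))"

end

theory Submission
  imports Defs "HOL-Library.FuncSet" "HOL-Library.Cardinality"
begin

text \<open>
  Enlarging \<open>S\<close> to a finite set \<open>T\<close> of places outside of which \<open>\<alpha>\<close>, \<open>\<Phi>\<close> and \<open>\<Gamma>\<close> are integral, every
  \<open>S\<close>-integral \<open>\<gamma> \<noteq> \<alpha>\<close> makes \<open>\<gamma> - \<alpha>\<close> a \<open>T\<close>-unit. As \<open>T\<close>-units fall into finitely many classes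
  modulo \<open>q\<^sup>m\<close>-th powers and \<open>\<Gamma> / \<Phi>\<^sub>b(\<Gamma>)\<close> is finite, infinitely many such \<open>\<gamma>\<close> give, for each \<open>m\<close>,
  some \<open>e \<noteq> 0\<close> such that, for every \<open>b\<close> with \<open>\<Phi>\<^sub>b\<close> of degree at most \<open>m\<close> in \<open>\<tau>\<close> (out of any given
  finite set), infinitely many \<open>T\<close>-integral \<open>y\<close> satisfy \<open>\<delta> + \<Phi>\<^sub>b(y) = e w\<close> with \<open>w\<close> a \<open>q\<^sup>m\<close>-th power.
  If the coefficient \<open>c\<^sub>j\<close> of \<open>\<tau>\<^sup>j\<close> in \<open>\<Phi>\<^sub>b\<close>, \<open>j \<ge> 1\<close>, were not in \<open>e K\<^bsup>q^j\<^esup>\<close>, then for the largest such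
  \<open>j\<close> the element \<open>c\<^sub>j / e\<close> would have positive \<open>v\<close>-adic distance from \<open>K\<^bsup>q^j\<^esup>\<close> for every place \<open>v\<close>,
  because \<open>K\<^sup>p\<close> is closed in \<open>K\<close>; this bounds \<open>y\<close> at all \<open>v\<close>, leaving finitely many \<open>y\<close>. So all the
  coefficients of \<open>\<tau>\<^sup>j\<close> in \<open>\<Phi>\<^bsub>t^k\<^esub>\<close> lie in one class modulo \<open>K\<^bsup>q^j\<^esup>\<close>. Combining them linearly
  so as to isolate the \<open>j\<close>-th coefficient of the logarithm of \<open>\<Phi>\<close> gives \<open>t \<in> K\<^bsup>q^j\<^esup>\<close> for infinitely many
  \<open>j\<close>, which is absurd at a pole of \<open>t\<close>.
\<close>

section \<open>Absolute values of places\<close>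

text \<open>Frobenius turns the triangle inequality for x^Q and y^Q, where Q = p^n, into v(x + y)^Q
  <= 2 max(v x, v y)^Q; letting n grow removes the factor 2.\<close>

lemma absolute_value_ultrametric:
  fixes v :: "'a::field \<Rightarrow> real"
  assumes v: "absolute_value v" and p: "prime CHAR('a)"
  shows "v (x + y) \<le> max (v x) (v y)"
proof (rule ccontr)
  define m where "m = max (v x) (v y)"
  assume "\<not> v (x + y) \<le> max (v x) (v y)"
  then have gt: "v (x + y) > m" by (simp only: m_def not_le)
  have nn: "v z \<ge> 0" and tri: "v (z + w) \<le> v z + v w" and mult: "v (z * w) = v z * v w" for z w
    using v by (auto simp: absolute_value_def)
  have v1: "v 1 = 1"
    using v mult[of 1 1] by (auto simp: absolute_value_def)
  have pow: "v (z ^ n) = v z ^ n" for z n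
    by (induction n) (simp_all add: v1 mult)
  have "v x \<le> m" "v y \<le> m" by (simp_all only: m_def max.cobounded1 max.cobounded2)
  then have m: "m > 0" using gt tri[of x y] nn[of x] by linarith
  define r where "r = v (x + y) / m"
  have r: "r > 1" using gt m by (simp add: r_def)
  have bound: "r ^ (CHAR('a) ^ n) \<le> 2" for n
  proof -
    let ?Q = "CHAR('a) ^ n"
    have "v (x + y) ^ ?Q = v (x ^ ?Q + y ^ ?Q)"
      unfolding pow[symmetric] by (subst freshmans_dream'[where n = n]) (use p in auto)
    also have "\<dots> \<le> v x ^ ?Q + v y ^ ?Q" using tri[of "x ^ ?Q" "y ^ ?Q"] by (simp add: pow)
    also have "\<dots> \<le> m ^ ?Q + m ^ ?Q"
      by (intro add_mono power_mono) (auto simp: m_def nn)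
    finally show ?thesis using m by (simp add: r_def power_divide field_simps)
  qed
  obtain n where n: "r ^ n > 2" using real_arch_pow[OF r] by blast
  have "n \<le> CHAR('a) ^ n"
    by (rule self_le_ge2_pow[OF prime_ge_2_nat[OF p]])
  then have "r ^ n \<le> r ^ (CHAR('a) ^ n)" using r by (intro power_increasing) auto
  with bound[of n] n show False by simp
qed

locale place =
  fixes v :: "'a::field \<Rightarrow> real"
  assumes in_places: "v \<in> places" and prime_char: "prime CHAR('a)"
begin

lemma absval: "absolute_value v"
  using in_places by (auto simp: places_def nontrivial_absolute_value_def)

lemma v_nonneg [simp]: "v x \<ge> 0"
  and v_eq_0 [simp]: "v x = 0 \<longleftrightarrow> x = 0"
  and v_mult: "v (x * y) = v x * v y"
  using absval by (auto simp: absolute_value_def)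

lemma v_0 [simp]: "v 0 = 0" by simp

lemma v_1 [simp]: "v 1 = 1"
  using v_mult[of 1 1] by auto

lemma v_pos: "x \<noteq> 0 \<Longrightarrow> v x > 0"
  using v_nonneg[of x] v_eq_0[of x] by linarith

lemma v_power: "v (x ^ n) = v x ^ n"
  by (induction n) (simp_all add: v_mult)

lemma v_inverse: "v (inverse x) = inverse (v x)"
proof (cases "x = 0")
  case False
  then have "v x * v (inverse x) = 1" by (simp flip: v_mult)
  then show ?thesis by (metis inverse_unique)
qed auto

lemma v_divide: "v (x / y) = v x / v y"
  by (simp add: divide_inverse v_mult v_inverse)

lemma v_power_int: "v (x powi n) = v x powi n"
  by (auto simp: power_int_def v_power v_inverse)

lemma v_minus [simp]: "v (- x) = v x"
proof -
  have "v (-1) * v (-1) = 1" by (simp flip: v_mult)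
  then have "v (-1) = 1" using v_nonneg[of "-1"]
    by (metis abs_of_nonneg mult_cancel_left2 power2_eq_1_iff power2_eq_square v_eq_0 zero_neq_one one_neq_neg_one abs_minus_cancel abs_one)
  then show ?thesis using v_mult[of "-1" x] by simp
qed

lemma v_add: "v (x + y) \<le> max (v x) (v y)"
  by (rule absolute_value_ultrametric[OF absval prime_char])

lemma v_diff: "v (x - y) \<le> max (v x) (v y)"
  using v_add[of x "- y"] by simp

lemma v_add_eq: "v y < v x \<Longrightarrow> v (x + y) = v x"
  using v_add[of x y] v_add[of "x + y" "- y"] by (auto simp: max_def split: if_splits)

lemma v_sum_le:
  assumes "\<And>i. i \<in> A \<Longrightarrow> v (f i) \<le> C" "C \<ge> 0"
  shows "v (sum f A) \<le> C"
  using assms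
proof (induction A rule: infinite_finite_induct)
  case (insert a A)
  then show ?case using v_add[of "f a" "sum f A"] by fastforce
qed auto

lemma v_sum_less:
  assumes "\<And>i. i \<in> A \<Longrightarrow> v (f i) < C" "C > 0"
  shows "v (sum f A) < C"
  using assms
proof (induction A rule: infinite_finite_induct)
  case (insert a A)
  then show ?case using v_add[of "f a" "sum f A"] by fastforce
qed auto

abbreviation "N \<equiv> residue_card v"

lemma v_range: "v ` (UNIV - {0}) = range (\<lambda>n::int. real N powi n)"
  using in_places by (auto simp: places_def)

text \<open>Since \<open>card\<close> is 0 on infinite sets, the normalisation in
  \<open>places\<close> also encodes that the residue field is finite: \<open>N = 0\<close> would
  put 0 among the values of nonzero elements, and \<open>N = 1\<close> would make \<open>v\<close>
  trivial.\<close>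

lemma N_ge_2: "N \<ge> 2"
proof -
  obtain x where x: "x \<noteq> 0" "v x \<noteq> 1"
    using in_places by (auto simp: places_def nontrivial_absolute_value_def)
  have "N \<noteq> 0"
  proof
    assume "N = 0"
    then have "0 \<in> range (\<lambda>n::int. real N powi n)" by (intro range_eqI[of _ _ 1]) auto
    then show False unfolding v_range[symmetric] by auto
  qed
  moreover have "N \<noteq> 1"
  proof
    assume "N = 1"
    moreover have "v x \<in> range (\<lambda>n::int. real N powi n)" using x v_range by blast
    ultimately show False using x by auto
  qed
  ultimately show ?thesis by linarith
qed

lemma N_gt_1: "real N > 1" using N_ge_2 by simp

lemma obtain_exponent:
  assumes "x \<noteq> 0" obtains n :: int where "v x = real N powi n"
  using assms v_range by blast

lemma obtain_value:
  fixes n :: int obtains x where "x \<noteq> 0" "v x = real N powi n"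
proof -
  have "real N powi n \<in> v ` (UNIV - {0})" unfolding v_range by blast
  then obtain x where "x \<in> UNIV - {0}" "real N powi n = v x" by (rule imageE)
  then show ?thesis using that[of x] by simp
qed

lemma N_powi_le_iff: "real N powi m \<le> real N powi n \<longleftrightarrow> m \<le> n"
proof
  assume "real N powi m \<le> real N powi n"
  then show "m \<le> n" using power_int_strict_increasing[OF _ N_gt_1, of n m] by fastforce
next
  assume "m \<le> n"
  then show "real N powi m \<le> real N powi n" using N_gt_1 by (intro power_int_increasing) auto
qed

lemma N_powi_eq_iff: "real N powi m = real N powi n \<longleftrightarrow> m = n"
  using N_powi_le_iff[of m n] N_powi_le_iff[of n m] by auto

lemma finite_residues:
  "\<exists>R. finite R \<and> (\<forall>x. v x \<le> 1 \<longrightarrow> (\<exists>r\<in>R. v (x - r) < 1))"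
proof -
  let ?E = "{(x, y). v x \<le> 1 \<and> v y \<le> 1 \<and> v (x - y) < 1}"
  have fin: "finite ({x. v x \<le> 1} // ?E)"
    using N_ge_2 unfolding residue_card_def by (intro card_ge_0_finite) linarith
  define R where "R = (\<lambda>C. SOME x. x \<in> C) ` ({x. v x \<le> 1} // ?E)"
  have "\<exists>r\<in>R. v (x - r) < 1" if "v x \<le> 1" for x
  proof -
    have mem: "?E `` {x} \<in> {x. v x \<le> 1} // ?E" using that by (intro quotientI) auto
    have "x \<in> ?E `` {x}" using that by auto
    then have "(SOME z. z \<in> ?E `` {x}) \<in> ?E `` {x}" by (rule someI)
    then show ?thesis using mem by (force simp: R_def)
  qed
  moreover have "finite R" using fin by (simp add: R_def)
  ultimately show ?thesis by blast
qed

end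

section \<open>Counting arguments in a finite extension of the rational function field\<close>

definition is_subring :: "'a::field set \<Rightarrow> bool" where
  "is_subring R \<longleftrightarrow> 1 \<in> R \<and> (\<forall>x\<in>R. \<forall>y\<in>R. x - y \<in> R \<and> x * y \<in> R)"

lemma is_subringD:
  assumes "is_subring R"
  shows "1 \<in> R" "0 \<in> R" "x \<in> R \<Longrightarrow> y \<in> R \<Longrightarrow> x - y \<in> R" "x \<in> R \<Longrightarrow> y \<in> R \<Longrightarrow> x * y \<in> R"
    "x \<in> R \<Longrightarrow> - x \<in> R" "x \<in> R \<Longrightarrow> y \<in> R \<Longrightarrow> x + y \<in> R"
proof -
  show R: "1 \<in> R" "x \<in> R \<Longrightarrow> y \<in> R \<Longrightarrow> x - y \<in> R" "x \<in> R \<Longrightarrow> y \<in> R \<Longrightarrow> x * y \<in> R" for x y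
    using assms by (auto simp: is_subring_def)
  show 0: "0 \<in> R" using R(2)[OF R(1) R(1)] by simp
  show m: "x \<in> R \<Longrightarrow> - x \<in> R" for x using R(2)[OF 0] by simp
  show "x \<in> R \<Longrightarrow> y \<in> R \<Longrightarrow> x + y \<in> R" using R(2)[OF _ m, of x y] by simp
qed

lemma is_subring_sum:
  assumes "is_subring R" "\<And>i. i \<in> A \<Longrightarrow> f i \<in> R" shows "sum f A \<in> R"
  using assms(2) by (induction A rule: infinite_finite_induct) (auto intro: is_subringD[OF assms(1)])

lemma is_subring_power:
  assumes "is_subring R" "x \<in> R" shows "x ^ n \<in> R"
  using assms(2) by (induction n) (auto intro: is_subringD[OF assms(1)])

section \<open>Polynomials of bounded degree\<close>

definition polys_below :: "nat \<Rightarrow> 'k::comm_ring_1 poly set" where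
  "polys_below n = {f. \<forall>i\<ge>n. coeff f i = 0}"

lemma polys_below_0 [simp]: "0 \<in> polys_below n"
  by (simp add: polys_below_def)

lemma polys_below_add: "f \<in> polys_below n \<Longrightarrow> g \<in> polys_below n \<Longrightarrow> f + g \<in> polys_below n"
  by (simp add: polys_below_def)

lemma polys_below_mono: "f \<in> polys_below n \<Longrightarrow> n \<le> m \<Longrightarrow> f \<in> polys_below m"
  by (simp add: polys_below_def)

lemma polys_below_mult:
  assumes "f \<in> polys_below n" "g \<in> polys_below m" shows "f * g \<in> polys_below (n + m)"
  unfolding polys_below_def
proof (clarsimp simp: coeff_mult intro!: sum.neutral)
  fix i j assume "n + m \<le> i" "j \<le> i"
  then have "j \<ge> n \<or> i - j \<ge> m" by linarith
  then show "coeff f j * coeff g (i - j) = 0" using assms by (auto simp: polys_below_def)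
qed

lemma polys_below_power:
  assumes "f \<in> polys_below n" "k > 0" shows "f ^ k \<in> polys_below (k * n)"
  using assms(2)
proof (induction k rule: nat_induct_non_zero)
  case (Suc k)
  then show ?case using polys_below_mult[OF assms(1)] by simp
qed (use assms in simp)

lemma ex_polys_below: "\<exists>n. f \<in> polys_below n"
  by (rule exI[of _ "Suc (degree f)"]) (auto simp: polys_below_def coeff_eq_0)

lemma card_polys_below:
  "finite (polys_below n :: 'k::{comm_ring_1, finite} poly set)"
  "card (polys_below n :: 'k::{comm_ring_1, finite} poly set) = CARD('k) ^ n"
proof -
  have bij: "bij_betw (\<lambda>f. restrict (coeff f) {..<n}) (polys_below n) ({..<n} \<rightarrow>\<^sub>E (UNIV :: 'k set))"
  proof (rule bij_betwI[where g = "\<lambda>g. \<Sum>i<n. monom (g i) i"])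
    show "(\<lambda>f. restrict (coeff f) {..<n}) \<in> polys_below n \<rightarrow> ({..<n} \<rightarrow>\<^sub>E (UNIV :: 'k set))"
      by auto
    show "(\<lambda>g. \<Sum>i<n. monom (g i) i) \<in> ({..<n} \<rightarrow>\<^sub>E UNIV) \<rightarrow> (polys_below n :: 'k poly set)"
      by (auto simp: polys_below_def coeff_sum)
    show "(\<Sum>i<n. monom (restrict (coeff f) {..<n} i) i) = f" if "f \<in> polys_below n" for f :: "'k poly"
      using that by (intro poly_eqI) (auto simp: coeff_sum polys_below_def sum.delta)
    show "restrict (coeff (\<Sum>i<n. monom (g i) i)) {..<n} = g" if "g \<in> {..<n} \<rightarrow>\<^sub>E UNIV" for g :: "nat \<Rightarrow> 'k"
      using that by (intro ext) (auto simp: coeff_sum sum.delta PiE_def extensional_def)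
  qed
  show "finite (polys_below n :: 'k poly set)"
    using bij_betw_finite[OF bij] by (simp add: finite_PiE)
  show "card (polys_below n :: 'k poly set) = CARD('k) ^ n"
    using bij_betw_same_card[OF bij] by (simp add: card_PiE)
qed

section \<open>Embedding of F_q[t] into K and coordinates with respect to a basis of K\<close>

locale function_field =
  fixes \<iota> :: "'k::finite_field poly fract \<Rightarrow> 'a::field"
  assumes ext: "finite_field_extension \<iota>"
begin

abbreviation \<psi> :: "'k poly \<Rightarrow> 'a" where "\<psi> \<equiv> poly_embed \<iota>"

lemma prime_char: "prime CHAR('a)"
  using CHAR_finite_field_extension[OF ext] CHAR_prime[where 'a = 'k] by simp

lemma iota_hom:
  "\<iota> (x + y) = \<iota> x + \<iota> y" "\<iota> (x * y) = \<iota> x * \<iota> y" "\<iota> 1 = 1" "\<iota> 0 = 0" "\<iota> (- x) = - \<iota> x"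
proof -
  show add: "\<iota> (x + y) = \<iota> x + \<iota> y" "\<iota> (x * y) = \<iota> x * \<iota> y" "\<iota> 1 = 1" for x y
    using ext by (auto simp: finite_field_extension_def)
  show 0: "\<iota> 0 = 0" by (metis add(1) add_0 add_right_cancel)
  show "\<iota> (- x) = - \<iota> x" using add(1)[of x "- x"] 0 by (simp add: eq_neg_iff_add_eq_0 add.commute)
qed

lemma iota_eq_0_iff [simp]: "\<iota> x = 0 \<longleftrightarrow> x = 0"
proof
  assume 0: "\<iota> x = 0"
  show "x = 0"
  proof (rule ccontr)
    assume "x \<noteq> 0"
    then have "1 = \<iota> (x * inverse x)" by (simp add: iota_hom)
    then show False using 0 by (simp only: iota_hom mult_zero_left) simp
  qed
qed (simp add: iota_hom)

lemma psi_hom: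
  "\<psi> (f + g) = \<psi> f + \<psi> g" "\<psi> (f * g) = \<psi> f * \<psi> g" "\<psi> 1 = 1" "\<psi> 0 = 0" "\<psi> (- f) = - \<psi> f"
  "\<psi> (f - g) = \<psi> f - \<psi> g"
proof -
  show add: "\<psi> (f + g) = \<psi> f + \<psi> g" for f g
    unfolding poly_embed_def iota_hom(1)[symmetric] by simp
  show "\<psi> (f * g) = \<psi> f * \<psi> g"
    unfolding poly_embed_def iota_hom(2)[symmetric] by simp
  show "\<psi> 1 = 1" "\<psi> 0 = 0"
    unfolding poly_embed_def One_fract_def[symmetric] Zero_fract_def[symmetric] by (rule iota_hom)+
  show minus: "\<psi> (- f) = - \<psi> f" for f
    unfolding poly_embed_def iota_hom(5)[symmetric] by simp
  show "\<psi> (f - g) = \<psi> f - \<psi> g" using add[of f "- g"] minus[of g] by simp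
qed

lemma psi_eq_0_iff [simp]: "\<psi> f = 0 \<longleftrightarrow> f = 0"
  by (simp add: poly_embed_def Zero_fract_def eq_fract)

lemma psi_power: "\<psi> (f ^ n) = \<psi> f ^ n"
  by (induction n) (simp_all add: psi_hom)

definition Bs :: "'a set" where
  "Bs = (SOME B. finite_dimensional_vector_space (\<lambda>c x. \<iota> c * x) B)"

lemma Bs_basis: "finite_dimensional_vector_space (\<lambda>c x. \<iota> c * x) Bs"
  unfolding Bs_def by (rule someI_ex) (use ext in \<open>auto simp: finite_field_extension_def\<close>)

lemma finite_Bs: "finite Bs"
  by (rule finite_dimensional_vector_space.finite_Basis[OF Bs_basis])

lemma Bs_span: "\<exists>c. x = (\<Sum>e\<in>Bs. \<iota> (c e) * e)"
proof -
  interpret B: finite_dimensional_vector_space "\<lambda>c x. \<iota> c * x" Bs by (rule Bs_basis)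
  have "x \<in> B.span Bs" by (simp add: B.span_Basis)
  then show ?thesis unfolding B.span_finite[OF finite_Bs] by auto
qed

lemma Bs_independent:
  assumes "(\<Sum>e\<in>Bs. \<iota> (c e) * e) = 0" "e \<in> Bs" shows "c e = 0"
proof -
  interpret B: finite_dimensional_vector_space "\<lambda>c x. \<iota> c * x" Bs by (rule Bs_basis)
  show ?thesis using B.independentD[OF B.independent_Basis finite_Bs order.refl assms] .
qed

lemma Bs_nonempty: "card Bs > 0"
proof (rule ccontr)
  assume "\<not> card Bs > 0"
  then have "Bs = {}" using finite_Bs by simp
  then show False using Bs_span[of 1] by simp
qed

text \<open>Finite sets that exhaust K up to denominators; their sizes are controlled by
  \<open>card_Box\<close>, and they take the place of Riemann-Roch spaces in the pigeonhole
  arguments.\<close>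

definition Box :: "nat \<Rightarrow> 'a set" where
  "Box n = (\<lambda>f. \<Sum>e\<in>Bs. \<psi> (f e) * e) ` (Bs \<rightarrow>\<^sub>E polys_below n)"

lemma BoxI:
  assumes "\<And>e. e \<in> Bs \<Longrightarrow> f e \<in> polys_below n" shows "(\<Sum>e\<in>Bs. \<psi> (f e) * e) \<in> Box n"
  unfolding Box_def
  by (rule image_eqI[of _ _ "restrict f Bs"]) (use assms in \<open>auto intro: sum.cong\<close>)

lemma BoxD:
  assumes "x \<in> Box n"
  shows "\<exists>f. (\<forall>e\<in>Bs. f e \<in> polys_below n) \<and> x = (\<Sum>e\<in>Bs. \<psi> (f e) * e)"
  using assms unfolding Box_def by (auto simp: PiE_def Pi_def)

lemma finite_Box: "finite (Box n)"
  unfolding Box_def by (intro finite_imageI finite_PiE finite_Bs card_polys_below)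

lemma card_Box: "card (Box n) \<le> CARD('k) ^ (n * card Bs)"
proof -
  have "card (Box n) \<le> card (Bs \<rightarrow>\<^sub>E (polys_below n :: 'k poly set))"
    unfolding Box_def by (intro card_image_le finite_PiE finite_Bs card_polys_below)
  then show ?thesis by (simp add: card_PiE finite_Bs card_polys_below power_mult)
qed

lemma Box_0: "0 \<in> Box n"
  using BoxI[of "\<lambda>_. 0" n] by (simp add: psi_hom)

lemma Box_add:
  assumes "x \<in> Box n" "y \<in> Box n" shows "x + y \<in> Box n"
proof -
  obtain f where "\<forall>e\<in>Bs. f e \<in> polys_below n" "x = (\<Sum>e\<in>Bs. \<psi> (f e) * e)"
    using BoxD[OF assms(1)] by blast
  moreover obtain g where "\<forall>e\<in>Bs. g e \<in> polys_below n" "y = (\<Sum>e\<in>Bs. \<psi> (g e) * e)"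
    using BoxD[OF assms(2)] by blast
  ultimately show ?thesis
    using BoxI[of "\<lambda>e. f e + g e" n] by (simp add: psi_hom polys_below_add ring_distribs sum.distrib)
qed

lemma Box_sum: "(\<And>i. i \<in> A \<Longrightarrow> f i \<in> Box n) \<Longrightarrow> sum f A \<in> Box n"
  by (induction A rule: infinite_finite_induct) (auto simp: Box_0 Box_add)

lemma Box_mult:
  assumes "x \<in> Box n" "h \<in> polys_below m" shows "\<psi> h * x \<in> Box (m + n)"
proof -
  obtain f where "\<forall>e\<in>Bs. f e \<in> polys_below n" "x = (\<Sum>e\<in>Bs. \<psi> (f e) * e)"
    using BoxD[OF assms(1)] by blast
  then show ?thesis
    using BoxI[of "\<lambda>e. h * f e" "m + n"] assms
    by (simp add: psi_hom polys_below_mult sum_distrib_left mult.assoc)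
qed

lemma Box_mono: "x \<in> Box n \<Longrightarrow> n \<le> m \<Longrightarrow> x \<in> Box m"
  using BoxD[of x n] by (auto intro!: BoxI intro: polys_below_mono)

lemma clear_fract: "\<exists>h g. h \<noteq> 0 \<and> \<psi> h * \<iota> c = \<psi> g"
proof (cases c)
  case (Fract a b)
  then have "\<psi> b * \<iota> c = \<psi> a"
    unfolding poly_embed_def iota_hom(2)[symmetric] by (intro arg_cong[of _ _ \<iota>]) (simp add: eq_fract)
  then show ?thesis using Fract by blast
qed

lemma clear_one: "\<exists>h d. h \<noteq> 0 \<and> \<psi> h * x \<in> Box d"
proof -
  obtain c where c: "x = (\<Sum>e\<in>Bs. \<iota> (c e) * e)" using Bs_span by blast
  obtain h g where hg: "h e \<noteq> 0" "\<psi> (h e) * \<iota> (c e) = \<psi> (g e)" for e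
    using clear_fract[of "c _"] by metis
  define H where "H = prod h Bs"
  define G where "G e = prod h (Bs - {e}) * g e" for e
  have "\<psi> H * \<iota> (c e) = \<psi> (G e)" if "e \<in> Bs" for e
    unfolding H_def G_def prod.remove[OF finite_Bs that] psi_hom hg(2)[symmetric] by (simp add: mult_ac)
  then have eq: "\<psi> H * x = (\<Sum>e\<in>Bs. \<psi> (G e) * e)"
    unfolding c sum_distrib_left by (intro sum.cong) (auto simp flip: mult.assoc)
  obtain d where d: "G e \<in> polys_below (d e)" for e using ex_polys_below[of "G _"] by metis
  have "\<psi> H * x \<in> Box (sum d Bs)"
    unfolding eq by (intro BoxI polys_below_mono[OF d] member_le_sum finite_Bs) auto
  moreover have "H \<noteq> 0" using hg(1) finite_Bs by (simp add: H_def)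
  ultimately show ?thesis by blast
qed

lemma clear_denominators:
  assumes "finite X" shows "\<exists>h d. h \<noteq> 0 \<and> (\<forall>x\<in>X. \<psi> h * x \<in> Box d)"
  using assms
proof induction
  case (insert x X)
  then obtain h d where h: "h \<noteq> 0" "\<And>x. x \<in> X \<Longrightarrow> \<psi> h * x \<in> Box d" by blast
  obtain h' d' where h': "h' \<noteq> 0" "\<psi> h' * x \<in> Box d'" using clear_one by blast
  obtain m where m: "h \<in> polys_below m" "h' \<in> polys_below m"
    by (meson ex_polys_below polys_below_mono nat_le_linear)
  have "\<psi> (h * h') * z \<in> Box (m + max d d')" if "z \<in> insert x X" for z
  proof (cases "z \<in> X")
    case True
    then have "\<psi> h' * (\<psi> h * z) \<in> Box (m + d)" by (intro Box_mult h m)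
    then show ?thesis by (simp add: psi_hom mult_ac) (erule Box_mono, simp)
  next
    case False
    then have "\<psi> h * (\<psi> h' * z) \<in> Box (m + d')" using that by (intro Box_mult h' m) (use h' in auto)
    then show ?thesis by (simp add: psi_hom mult_ac) (erule Box_mono, simp)
  qed
  then show ?case using h(1) h'(1) by (intro exI[of _ "h * h'"] exI[of _ "m + max d d'"]) auto
qed (auto intro: exI[of _ 1])

text \<open>Multiplication by \<open>y\<close> is linear over F_q(t), so a common denominator
  \<open>h\<close> of its matrix entries serves all \<open>w\<close>, and the cost \<open>d\<close>
  in degrees is independent of \<open>n\<close>. The bound on \<open>h\<close> itself charges powers
  of \<open>h\<close> alone at the same rate.\<close>

lemma clear_mult:
  obtains h d where "h \<noteq> 0" "h \<in> polys_below d" "\<And>n w. w \<in> Box n \<Longrightarrow> \<psi> h * (y * w) \<in> Box (d + n)"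
proof -
  obtain h d where h: "h \<noteq> 0" "\<And>x. x \<in> (\<lambda>e. y * e) ` Bs \<Longrightarrow> \<psi> h * x \<in> Box d"
    using clear_denominators[OF finite_imageI[OF finite_Bs]] by blast
  obtain m where m: "h \<in> polys_below m" using ex_polys_below by blast
  have "\<psi> h * (y * w) \<in> Box (max d m + n)" if w: "w \<in> Box n" for n w
  proof -
    obtain f where f: "\<forall>e\<in>Bs. f e \<in> polys_below n" "w = (\<Sum>e\<in>Bs. \<psi> (f e) * e)"
      using BoxD[OF w] by blast
    have "(\<Sum>e\<in>Bs. \<psi> (f e) * (\<psi> h * (y * e))) \<in> Box (n + d)"
      by (intro Box_sum Box_mult h) (use f in auto)
    also have "(\<Sum>e\<in>Bs. \<psi> (f e) * (\<psi> h * (y * e))) = \<psi> h * (y * w)"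
      by (simp add: f(2) sum_distrib_left mult_ac)
    finally show ?thesis by (rule Box_mono) simp
  qed
  then show ?thesis using that[of h "max d m"] h(1) polys_below_mono[OF m, of "max d m"] by auto
qed

section \<open>Linear relations from the pigeonhole principle\<close>

lemma card_k_ge_2: "CARD('k) \<ge> 2"
proof -
  have "card {0, 1 :: 'k} \<le> CARD('k)" by (intro card_mono) auto
  then show ?thesis by simp
qed

text \<open>The crude bound \<open>CARD('k) \<le> 2 ^ CARD('k)\<close> puts the size of a box in
  base 2, to be compared with the number of vectors with entries 0 and 1.\<close>

lemma card_Box_less:
  assumes "n * card Bs * CARD('k) < m"
  shows "card (Box n) < 2 ^ m"
proof -
  have "card (Box n) \<le> CARD('k) ^ (n * card Bs)" by (rule card_Box)
  also have "\<dots> \<le> (2 ^ CARD('k)) ^ (n * card Bs)" by (intro power_mono) (auto intro: less_imp_le)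
  also have "\<dots> = 2 ^ (n * card Bs * CARD('k))" by (simp add: mult_ac flip: power_mult)
  also have "\<dots> < 2 ^ m" using assms by simp
  finally show ?thesis .
qed

text \<open>A counting version of the fact that \<open>K\<close> is finite over \<open>\<bbbF>\<^sub>p(y)\<close>, normalised so that not
  all coefficients of the relation are divisible by \<open>y\<close>.\<close>

lemma bounded_rank:
  assumes "y \<noteq> 0"
  shows "\<exists>m. \<forall>(z :: nat \<Rightarrow> 'a) R. is_subring R \<longrightarrow> y \<in> R \<longrightarrow>
    (\<exists>a b. (\<forall>j. a j \<in> {-1, 0, 1}) \<and> (\<forall>j. b j \<in> R) \<and> (\<exists>j<m. a j \<noteq> 0) \<and>
      (\<Sum>j<m. (a j + y * b j) * z j) = 0)"
proof -
  obtain h d where h: "h \<noteq> 0" "h \<in> polys_below d"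
    and hw: "\<And>n w. w \<in> Box n \<Longrightarrow> \<psi> h * (y * w) \<in> Box (d + n)"
    using clear_mult[of y] by metis
  \<comment> \<open>A box takes at most \<open>r\<close> bits per degree. Each further power of
    \<open>y\<close> costs \<open>d\<close> degrees, hence \<open>d * r\<close> bits, so
    \<open>m = d * r + 1\<close> free coefficients per power win in the long run. This
    \<open>m\<close> depends on \<open>y\<close> only.\<close>
  define r where "r = card Bs * CARD('k)"
  define m where "m = d * r + 1"
  have hk: "\<psi> h ^ k * (y ^ k * w) \<in> Box (k * d + n)" if "w \<in> Box n" for k n w
  proof (induction k)
    case (Suc k)
    then show ?case using hw[OF Suc] by (simp add: mult_ac add_ac)
  qed (use that in simp)
  have hl: "\<psi> h ^ l * w \<in> Box (l * d + n)" if "w \<in> Box n" for l n w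
  proof (induction l)
    case (Suc l)
    then show ?case using Box_mult[OF Suc h(2)] by (simp add: mult_ac add_ac)
  qed (use that in simp)
  show ?thesis
  proof (intro exI[of _ m] allI impI)
    fix z :: "nat \<Rightarrow> 'a" and R assume R: "is_subring R" "y \<in> R"
    obtain h' d' where h': "h' \<noteq> 0" "\<And>x. x \<in> z ` {..<m} \<Longrightarrow> \<psi> h' * x \<in> Box d'"
      using clear_denominators[of "z ` {..<m}"] by auto
    \<comment> \<open>\<open>M\<close> is the number of powers of \<open>y\<close> used. The surplus
      of one bit per power must exceed the \<open>d' * r\<close> bits taken by the cleared elements
      \<open>\<psi> h' * z j\<close>.\<close>
    define M where "M = d' * r + 1"
    define A where "A = ({..<m} \<times> {..<M}) \<rightarrow>\<^sub>E {0, 1 :: 'a}"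
    define F where "F f = (\<Sum>j<m. \<Sum>k<M. f (j, k) * y ^ k * z j)" for f :: "nat \<times> nat \<Rightarrow> 'a"
    define G where "G f = \<psi> h ^ M * \<psi> h' * F f" for f
    have "card A = 2 ^ (m * M)" by (simp add: A_def card_PiE numeral_2_eq_2)
    have "G f \<in> Box (M * d + d')" if f: "f \<in> A" for f
    proof -
      have "\<psi> h ^ M * \<psi> h' * (f (j, k) * y ^ k * z j) \<in> Box (M * d + d')" if "j < m" "k < M" for j k
      proof -
        have "\<psi> h ^ (M - k) * (\<psi> h ^ k * (y ^ k * (\<psi> h' * z j))) \<in> Box ((M - k) * d + (k * d + d'))"
          using that by (intro hl hk h') auto
        also have "(M - k) * d + (k * d + d') = M * d + d'"
          using that by (simp flip: add_mult_distrib add.assoc)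
        also have "\<psi> h ^ (M - k) * (\<psi> h ^ k * (y ^ k * (\<psi> h' * z j))) = \<psi> h ^ (M - k + k) * \<psi> h' * (y ^ k * z j)"
          by (simp only: power_add mult_ac)
        also have "M - k + k = M" using that by simp
        finally have *: "\<psi> h ^ M * \<psi> h' * (y ^ k * z j) \<in> Box (M * d + d')" .
        have "f (j, k) = 0 \<or> f (j, k) = 1" using f that by (auto simp: A_def PiE_def Pi_def)
        then show ?thesis using * by (auto simp: Box_0 mult.assoc)
      qed
      then show ?thesis unfolding G_def F_def sum_distrib_left by (intro Box_sum) auto
    qed
    then have "card (G ` A) \<le> card (Box (M * d + d'))"
      by (intro card_mono finite_Box) auto
    also have "\<dots> < 2 ^ (m * M)"
    proof (rule card_Box_less)
      have "(M * d + d') * card Bs * CARD('k) = M * (d * r) + d' * r"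
        by (simp add: r_def algebra_simps)
      also have "\<dots> < M * (d * r) + M" by (simp add: M_def)
      also have "\<dots> = m * M" by (simp add: m_def algebra_simps)
      finally show "(M * d + d') * card Bs * CARD('k) < m * M" .
    qed
    finally have "\<not> inj_on G A" using \<open>card A = _\<close> card_image by force
    then obtain f f' where ff: "f \<in> A" "f' \<in> A" "f \<noteq> f'" "G f = G f'" by (auto simp: inj_on_def)
    then have FF: "F f = F f'" using h(1) h'(1) by (simp add: G_def)
    \<comment> \<open>The difference of two colliding vectors has entries in {-1, 0, 1}; outside the
      index set both are \<open>undefined\<close>, so the difference is 0 there.\<close>
    define c where "c j k = f (j, k) - f' (j, k)" for j k
    have c_val: "c j k \<in> {-1, 0, 1}" for j k
    proof (cases "j < m \<and> k < M")
      case True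
      then have "f (j, k) \<in> {0, 1}" "f' (j, k) \<in> {0, 1}" using ff by (auto simp: A_def PiE_def Pi_def)
      then show ?thesis by (auto simp: c_def)
    next
      case False
      then have "f (j, k) = undefined" "f' (j, k) = undefined" using ff by (auto simp: A_def PiE_def extensional_def)
      then show ?thesis by (simp add: c_def)
    qed
    have "\<exists>k j. k < M \<and> j < m \<and> c j k \<noteq> 0"
    proof (rule ccontr)
      assume "\<not> ?thesis"
      then have "f = f'"
        by (intro PiE_ext[OF ff(1,2)[unfolded A_def]]) (auto simp: c_def)
      then show False using ff(3) by blast
    qed
    then obtain j1 k1 where jk1: "k1 < M" "j1 < m" "c j1 k1 \<noteq> 0" by blast
    \<comment> \<open>The lowest power of \<open>y\<close> that occurs is divided out: the
      coefficients \<open>c j k0\<close> are then not all 0, and everything else is a multiple of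
      \<open>y\<close>.\<close>
    define k0 where "k0 = (LEAST k. \<exists>j<m. c j k \<noteq> 0)"
    have k1: "\<exists>j<m. c j k1 \<noteq> 0" using jk1 by blast
    have k0: "\<exists>j<m. c j k0 \<noteq> 0" unfolding k0_def by (rule LeastI[of "\<lambda>k. \<exists>j<m. c j k \<noteq> 0", OF k1])
    have below: "c j k = 0" if "k < k0" "j < m" for j k
      using not_less_Least[OF that(1)[unfolded k0_def]] that by blast
    have k0M: "k0 < M"
      unfolding k0_def by (rule le_less_trans[OF Least_le[of "\<lambda>k. \<exists>j<m. c j k \<noteq> 0", OF k1] jk1(1)])
    define b where "b j = (\<Sum>k=Suc k0..<M. c j k * y ^ (k - Suc k0))" for j
    have "(\<Sum>k<M. c j k * y ^ k) = y ^ k0 * (c j k0 + y * b j)" if "j < m" for j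
    proof -
      have "(\<Sum>k<M. c j k * y ^ k) = (\<Sum>k=k0..<M. c j k * y ^ k)"
        by (rule sum.mono_neutral_right) (use below that in auto)
      also have "\<dots> = c j k0 * y ^ k0 + (\<Sum>k=Suc k0..<M. c j k * y ^ k)"
        using k0M by (simp add: sum.atLeast_Suc_lessThan)
      also have "(\<Sum>k=Suc k0..<M. c j k * y ^ k) = (\<Sum>k=Suc k0..<M. y ^ Suc k0 * (c j k * y ^ (k - Suc k0)))"
      proof (rule sum.cong[OF refl])
        fix k assume "k \<in> {Suc k0..<M}"
        then have "y ^ k = y ^ (Suc k0 + (k - Suc k0))" by simp
        then have "y ^ k = y ^ Suc k0 * y ^ (k - Suc k0)" by (simp only: power_add)
        then show "c j k * y ^ k = y ^ Suc k0 * (c j k * y ^ (k - Suc k0))" by (simp only: mult_ac)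
      qed
      also have "\<dots> = y ^ Suc k0 * b j" by (simp add: b_def sum_distrib_left)
      finally show ?thesis by (simp add: algebra_simps)
    qed
    then have "(\<Sum>j<m. y ^ k0 * ((c j k0 + y * b j) * z j)) = (\<Sum>j<m. (\<Sum>k<M. c j k * y ^ k) * z j)"
      by (intro sum.cong) (auto simp: mult.assoc)
    also have "\<dots> = F f - F f'"
      by (simp add: F_def c_def sum_distrib_right left_diff_distrib sum_subtractf)
    finally have "(\<Sum>j<m. (c j k0 + y * b j) * z j) = 0"
      using FF assms by (simp flip: sum_distrib_left)
    moreover have "b j \<in> R" for j
    proof -
      have "c j k \<in> R" for k
        using c_val[of j k] is_subringD(1,2)[OF R(1)] is_subringD(5)[OF R(1) is_subringD(1)[OF R(1)]] by auto
      then show ?thesis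
        unfolding b_def by (intro is_subring_sum[OF R(1)] is_subringD(4)[OF R(1)] is_subring_power[OF R])
    qed
    ultimately show "\<exists>a b. (\<forall>j. a j \<in> {-1, 0, 1}) \<and> (\<forall>j. b j \<in> R) \<and> (\<exists>j<m. a j \<noteq> 0) \<and>
      (\<Sum>j<m. (a j + y * b j) * z j) = 0" using k0 c_val
      by (intro exI[of _ "\<lambda>j. c j k0"] exI[of _ b]) auto
  qed
qed

lemma frob_diff: "(x - y :: 'a) ^ (CHAR('a) ^ n) = x ^ (CHAR('a) ^ n) - y ^ (CHAR('a) ^ n)"
proof -
  have "(x - y + y) ^ (CHAR('a) ^ n) = (x - y) ^ (CHAR('a) ^ n) + y ^ (CHAR('a) ^ n)"
    by (rule freshmans_dream'[OF prime_char refl])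
  then show ?thesis by simp
qed

text \<open>This is [K : K^p] <= p, by counting. With n the degree of K, p + 1 unknowns from
  \<open>Box N\<close> allow q^((p+1)Nn) choices, while raising to the p-th power multiplies degrees
  by p, so the values lie in a box of size at most q^((pN+d)n). Any N > d forces a
  collision.\<close>

lemma frobenius_rank:
  fixes y :: "nat \<Rightarrow> 'a"
  defines "p \<equiv> CHAR('a)"
  shows "\<exists>w. (\<exists>k\<le>p. w k \<noteq> 0) \<and> (\<Sum>k\<le>p. w k ^ p * y k) = 0"
proof -
  define n where "n = card Bs"
  let ?q = "CARD('k)"
  have p: "p > 0" using prime_char prime_gt_0_nat p_def by blast
  let ?X = "(\<lambda>(k, e). e ^ p * y k) ` ({..p} \<times> Bs)"
  obtain h d where h: "h \<noteq> 0" "\<And>x. x \<in> ?X \<Longrightarrow> \<psi> h * x \<in> Box d"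
    using clear_denominators[of ?X] finite_Bs by (meson finite_SigmaI finite_atMost finite_imageI)
  define N where "N = Suc d"
  define A where "A = ({..p} \<times> Bs) \<rightarrow>\<^sub>E (polys_below N :: 'k poly set)"
  define W where "W f k = (\<Sum>e\<in>Bs. \<psi> (f (k, e)) * e)" for f :: "nat \<times> 'a \<Rightarrow> 'k poly" and k :: nat
  define G where "G f = \<psi> h * (\<Sum>k\<le>p. W f k ^ p * y k)" for f
  have Wp: "W f k ^ p = (\<Sum>e\<in>Bs. \<psi> (f (k, e) ^ p) * e ^ p)" for f k
    unfolding W_def p_def by (subst freshmans_dream_sum) (simp_all add: prime_char power_mult_distrib psi_power)
  have "G f \<in> Box (p * N + d)" if f: "f \<in> A" for f
  proof -
    have "G f = (\<Sum>k\<le>p. \<Sum>e\<in>Bs. \<psi> (f (k, e) ^ p) * (\<psi> h * (e ^ p * y k)))"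
      by (simp add: G_def Wp sum_distrib_left sum_distrib_right mult_ac)
    also have "\<dots> \<in> Box (p * N + d)"
      by (intro Box_sum Box_mult h polys_below_power p) (use f in \<open>auto simp: A_def PiE_def Pi_def\<close>)
    finally show ?thesis .
  qed
  then have "card (G ` A) \<le> card (Box (p * N + d))"
    by (intro card_mono finite_Box) auto
  also have "\<dots> \<le> ?q ^ ((p * N + d) * n)" unfolding n_def by (rule card_Box)
  also have "\<dots> < ?q ^ (N * (Suc p * n))"
  proof (rule power_strict_increasing)
    have "(p * N + d) * n < (p * N + N) * n" using Bs_nonempty by (simp add: n_def N_def)
    then show "(p * N + d) * n < N * (Suc p * n)" by (simp add: algebra_simps)
  qed (use card_k_ge_2 in simp)
  also have "\<dots> = card A"
    by (simp add: A_def card_PiE finite_Bs card_polys_below n_def power_mult card_cartesian_product)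
  finally have "\<not> inj_on G A" using card_image by force
  then obtain f f' where ff: "f \<in> A" "f' \<in> A" "f \<noteq> f'" "G f = G f'" by (auto simp: inj_on_def)
  define w where "w k = W f k - W f' k" for k
  have w: "w k = (\<Sum>e\<in>Bs. \<iota> (Fraction_Field.Fract (f (k, e) - f' (k, e)) 1) * e)" for k
    unfolding w_def W_def poly_embed_def[symmetric] by (simp add: psi_hom left_diff_distrib sum_subtractf)
  have "w k ^ p = W f k ^ p - W f' k ^ p" for k
    using frob_diff[of _ _ 1] by (simp add: w_def p_def)
  then have "\<psi> h * (\<Sum>k\<le>p. w k ^ p * y k) = G f - G f'"
    by (simp add: G_def left_diff_distrib sum_subtractf right_diff_distrib)
  then have "(\<Sum>k\<le>p. w k ^ p * y k) = 0" using ff(4) h(1) by simp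
  moreover have "\<exists>k\<le>p. w k \<noteq> 0"
  proof (rule ccontr)
    assume *: "\<not> ?thesis"
    have "f (k, e) = f' (k, e)" if "k \<le> p" "e \<in> Bs" for k e
    proof -
      have "Fraction_Field.Fract (f (k, e) - f' (k, e)) 1 = (0 :: 'k poly fract)"
        using * that by (intro Bs_independent[where c = "\<lambda>e. Fraction_Field.Fract (f (k, e) - f' (k, e)) 1"])
          (auto simp flip: w)
      then show ?thesis by (simp add: Zero_fract_def eq_fract)
    qed
    then have "f = f'"
      by (intro PiE_ext[OF ff(1,2)[unfolded A_def]]) auto
    then show False using ff(3) by blast
  qed
  ultimately show ?thesis by blast
qed

end

section \<open>Extension of subrings to valuation rings\<close>

definition combinations :: "'a::field set \<Rightarrow> 'a \<Rightarrow> nat \<Rightarrow> 'a set" where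
  "combinations C z n = (\<lambda>a. \<Sum>i<n. a i * z ^ i) ` ({..<n} \<rightarrow>\<^sub>E C)"

lemma combinationsI:
  "(\<And>i. i < n \<Longrightarrow> a i \<in> C) \<Longrightarrow> (\<Sum>i<n. a i * z ^ i) \<in> combinations C z n"
  unfolding combinations_def
  by (rule image_eqI[of _ _ "restrict a {..<n}"]) (auto intro: sum.cong)

lemma combinationsD:
  "x \<in> combinations C z n \<Longrightarrow> \<exists>a. (\<forall>i<n. a i \<in> C) \<and> x = (\<Sum>i<n. a i * z ^ i)"
  unfolding combinations_def by (auto simp: PiE_def Pi_def)

lemma finite_combinations: "finite C \<Longrightarrow> finite (combinations C z n)"
  unfolding combinations_def by (intro finite_imageI finite_PiE) auto

lemma combinations_add:
  assumes "is_subring C" "x \<in> combinations C z n" "y \<in> combinations C z n"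
  shows "x + y \<in> combinations C z n"
proof -
  obtain a b where "\<forall>i<n. a i \<in> C" "x = (\<Sum>i<n. a i * z ^ i)" "\<forall>i<n. b i \<in> C" "y = (\<Sum>i<n. b i * z ^ i)"
    using combinationsD[OF assms(2)] combinationsD[OF assms(3)] by blast
  then show ?thesis
    using combinationsI[of n "\<lambda>i. a i + b i" C z] is_subringD[OF assms(1)]
    by (simp add: ring_distribs sum.distrib)
qed

lemma combinations_monom:
  assumes "is_subring C" "c \<in> C" "i < n" shows "c * z ^ i \<in> combinations C z n"
proof -
  have "(\<Sum>j<n. (if j = i then c else 0) * z ^ j) \<in> combinations C z n"
    using assms is_subringD(2)[OF assms(1)] by (intro combinationsI) auto
  also have "(\<Sum>j<n. (if j = i then c else 0) * z ^ j) = (\<Sum>j<n. if j = i then c * z ^ j else 0)"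
    by (intro sum.cong) auto
  finally show ?thesis using assms(3) by simp
qed

lemma combinations_sum:
  assumes "is_subring C" "\<And>i. i \<in> A \<Longrightarrow> f i \<in> combinations C z n" "n > 0"
  shows "sum f A \<in> combinations C z n"
  using assms(2)
proof (induction A rule: infinite_finite_induct)
  have 0: "0 \<in> combinations C z n"
    using combinations_monom[OF assms(1) is_subringD(2)[OF assms(1)] assms(3)] by simp
  case (infinite A) then show ?case using 0 by simp
next
  case empty
  then show ?case
    using combinations_monom[OF assms(1) is_subringD(2)[OF assms(1)] assms(3)] by simp
next
  case (insert a A)
  then show ?case by (simp add: combinations_add[OF assms(1)])
qed

definition adjoin :: "'a::field set \<Rightarrow> 'a \<Rightarrow> 'a set" where
  "adjoin C z = {poly f z | f. \<forall>i. coeff f i \<in> C}"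

lemma adjoin:
  assumes C: "is_subring C"
  shows "is_subring (adjoin C z)" "C \<subseteq> adjoin C z" "z \<in> adjoin C z"
proof -
  note R = is_subringD[OF C]
  show "is_subring (adjoin C z)"
    unfolding is_subring_def
  proof (intro conjI ballI)
    show "1 \<in> adjoin C z"
      unfolding adjoin_def using R(1,2) by (auto intro!: exI[of _ 1])
    fix x y assume "x \<in> adjoin C z" "y \<in> adjoin C z"
    then obtain f g where fg: "x = poly f z" "\<forall>i. coeff f i \<in> C" "y = poly g z" "\<forall>i. coeff g i \<in> C"
      by (auto simp: adjoin_def)
    show "x - y \<in> adjoin C z"
      unfolding adjoin_def using fg R(3) by (auto intro!: exI[of _ "f - g"])
    have "coeff (f * g) i \<in> C" for i
      unfolding coeff_mult using fg R(4) by (intro is_subring_sum[OF C]) auto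
    then show "x * y \<in> adjoin C z"
      unfolding adjoin_def using fg by (auto intro!: exI[of _ "f * g"])
  qed
  show "C \<subseteq> adjoin C z"
  proof
    fix c assume "c \<in> C"
    then show "c \<in> adjoin C z"
      unfolding adjoin_def using R(2) by (auto intro!: exI[of _ "[:c:]"] simp: coeff_pCons split: nat.splits)
  qed
  show "z \<in> adjoin C z"
    unfolding adjoin_def using R(1,2) by (auto intro!: exI[of _ "[:0, 1:]"] simp: coeff_pCons split: nat.splits)
qed

lemma adjoin_combinations:
  assumes "x \<in> adjoin C z" shows "\<exists>n. x \<in> combinations C z (Suc n)"
proof -
  obtain f where f: "x = poly f z" "\<forall>i. coeff f i \<in> C" using assms by (auto simp: adjoin_def)
  have "x = (\<Sum>i<Suc (degree f). coeff f i * z ^ i)"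
    unfolding f(1) by (simp add: poly_altdef lessThan_Suc_atMost)
  then show ?thesis using combinationsI[of "Suc (degree f)" "coeff f" C z] f(2) by auto
qed

text \<open>The image of the naturals is the prime field; differences stay in it because -1 is p -
  1.\<close>

lemma prime_subring:
  assumes p: "prime CHAR('a::field)"
  shows "is_subring (range of_nat :: 'a set)" "finite (range of_nat :: 'a set)"
proof -
  let ?p = "CHAR('a)"
  have p0: "?p > 0" using p prime_gt_0_nat by blast
  have "(of_nat m :: 'a) - of_nat n = of_nat (m + n * (?p - 1))" for m n
  proof -
    have "(of_nat (n * (?p - 1)) :: 'a) + of_nat n = of_nat (n * ?p)"
      using p0 by (cases ?p) (auto simp: algebra_simps)
    then have "(of_nat (n * (?p - 1)) :: 'a) + of_nat n = 0" by simp
    then show ?thesis by (simp add: eq_neg_iff_add_eq_0 algebra_simps)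
  qed
  note diff = this
  show "is_subring (range of_nat :: 'a set)"
    unfolding is_subring_def
  proof (intro conjI ballI)
    show "(1 :: 'a) \<in> range of_nat" by (rule range_eqI[of _ _ 1]) simp
    fix x y :: 'a assume "x \<in> range of_nat" "y \<in> range of_nat"
    then obtain m n where mn: "x = of_nat m" "y = of_nat n" by blast
    show "x - y \<in> range of_nat" unfolding mn diff by (rule rangeI)
    show "x * y \<in> range of_nat" unfolding mn of_nat_mult[symmetric] by (rule rangeI)
  qed
  have "range of_nat \<subseteq> (of_nat :: nat \<Rightarrow> 'a) ` {..<?p}"
  proof safe
    fix n
    have "(of_nat n :: 'a) = of_nat (n mod ?p + ?p * (n div ?p))" by simp
    also have "\<dots> = of_nat (n mod ?p)" unfolding of_nat_add of_nat_mult by simp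
    finally show "(of_nat n :: 'a) \<in> of_nat ` {..<?p}" using p0 by auto
  qed
  then show "finite (range of_nat :: 'a set)" by (rule finite_subset) auto
qed

text \<open>The hypothesis makes the span of 1, 1/x, ..., (1/x)^d over \<open>C\<close> stable under
  multiplication by \<open>x\<close>. This span is finite and contains all powers of
  \<open>x\<close>, so two of them agree.\<close>

lemma root_of_unity_if_adjoin_inverse:
  assumes C: "is_subring C" "finite C" and x: "x \<noteq> 0" "x \<in> adjoin C (inverse x)"
  shows "\<exists>n>0. x ^ n = 1"
proof -
  define y where "y = inverse x"
  obtain d where d: "x \<in> combinations C y (Suc d)" using adjoin_combinations x(2) y_def by blast
  let ?W = "combinations C y (Suc d)"
  have xW: "x * w \<in> ?W" if "w \<in> ?W" for w
  proof -
    obtain a where a: "\<forall>i<Suc d. a i \<in> C" "w = (\<Sum>i<Suc d. a i * y ^ i)" using combinationsD[OF \<open>w \<in> ?W\<close>] by blast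
    obtain b where b: "\<forall>i<Suc d. b i \<in> C" "x = (\<Sum>i<Suc d. b i * y ^ i)" using combinationsD[OF d] by blast
    \<comment> \<open>Only the constant term of \<open>w\<close> needs the relation for
      \<open>x\<close>; in the other terms \<open>x\<close> just lowers the exponent of
      \<open>y\<close>.\<close>
    have "a 0 * x = (\<Sum>i<Suc d. (a 0 * b i) * y ^ i)"
      by (subst b(2)) (simp only: sum_distrib_left mult.assoc)
    also have "\<dots> \<in> ?W" using a b is_subringD[OF C(1)] by (intro combinationsI) auto
    finally have 1: "a 0 * x \<in> ?W" .
    have 2: "x * (a i * y ^ i) \<in> ?W" if "i \<in> {..<Suc d}" for i
    proof (cases i)
      case (Suc k)
      have "x * (a i * y ^ i) = a i * y ^ k" using x(1) by (simp add: Suc y_def)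
      also have "\<dots> \<in> ?W" using a that Suc by (intro combinations_monom C) auto
      finally show ?thesis .
    qed (use 1 in \<open>simp add: mult.commute\<close>)
    show ?thesis unfolding a(2) sum_distrib_left by (intro combinations_sum[OF C(1)] 2) auto
  qed
  have "x ^ k \<in> ?W" for k
  proof (induction k)
    case 0
    then show ?case using combinations_monom[OF C(1), of 1 0 "Suc d" y] is_subringD[OF C(1)] by simp
  qed (simp add: xW)
  then have "range (\<lambda>k. x ^ k) \<subseteq> ?W" by blast
  then have "finite (range (\<lambda>k::nat. x ^ k))" using finite_combinations[OF C(2)] finite_subset by blast
  then have "\<not> inj (\<lambda>k::nat. x ^ k)" using finite_imageD infinite_UNIV_nat by blast
  then obtain i j where ij: "i \<noteq> j" "x ^ i = x ^ j" by (auto simp: inj_def)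
  have "\<exists>n>0. x ^ n = 1" if "i < j" "x ^ i = x ^ j" for i j
  proof (intro exI conjI)
    have "x ^ (j - i) * x ^ i = x ^ (j - i + i)" by (simp only: power_add)
    then show "x ^ (j - i) = 1" using that x(1) by simp
  qed (use that in simp)
  then show ?thesis using ij by (metis nat_neq_iff)
qed

lemma ex_maximal_subring:
  fixes x y :: "'a::field"
  assumes "is_subring R" "y \<in> R" "x \<notin> R"
  obtains V where "is_subring V" "y \<in> V" "x \<notin> V"
    "\<And>R. is_subring R \<Longrightarrow> V \<subseteq> R \<Longrightarrow> x \<notin> R \<Longrightarrow> R = V"
proof -
  let ?A = "{R. is_subring R \<and> y \<in> R \<and> x \<notin> R}"
  have "\<exists>M\<in>?A. \<forall>X\<in>?A. M \<subseteq> X \<longrightarrow> X = M"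
  proof (rule subset_Zorn_nonempty)
    fix \<C> assume ne: "\<C> \<noteq> {}" and ch: "subset.chain ?A \<C>"
    have sub: "is_subring R" "y \<in> R" "x \<notin> R" if "R \<in> \<C>" for R
      using ch that by (auto simp: subset.chain_def)
    have "is_subring (\<Union>\<C>)"
      unfolding is_subring_def
    proof (intro conjI ballI)
      show "1 \<in> \<Union>\<C>" using ne sub is_subringD(1) by blast
      fix u w assume "u \<in> \<Union>\<C>" "w \<in> \<Union>\<C>"
      then obtain R R' where "R \<in> \<C>" "R' \<in> \<C>" "u \<in> R" "w \<in> R'" by blast
      moreover have "R \<subseteq> R' \<or> R' \<subseteq> R"
        using ch \<open>R \<in> \<C>\<close> \<open>R' \<in> \<C>\<close> by (auto simp: subset.chain_def)
      ultimately obtain T where T: "T \<in> \<C>" "u \<in> T" "w \<in> T" by blast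
      show "u - w \<in> \<Union>\<C>" "u * w \<in> \<Union>\<C>"
        using T is_subringD(3,4)[OF sub(1)[OF T(1)]] by blast+
    qed
    then show "\<Union>\<C> \<in> ?A" using sub ne by auto
  qed (use assms in auto)
  then obtain V where V: "V \<in> ?A" "\<And>X. X \<in> ?A \<Longrightarrow> V \<subseteq> X \<Longrightarrow> X = V" by blast
  show ?thesis by (rule that[of V]) (use V in auto)
qed

text \<open>Chevalley's extension theorem: such maximal subrings are valuation rings.\<close>

locale maximal_subring =
  fixes V :: "'a::field set" and x y :: 'a
  assumes V: "is_subring V" and y_in: "y \<in> V" and x_notin: "x \<notin> V" and xy: "x * y = 1"
    and max: "\<And>R. is_subring R \<Longrightarrow> V \<subseteq> R \<Longrightarrow> x \<notin> R \<Longrightarrow> R = V"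
begin

lemmas VD = is_subringD[OF V]

text \<open>Let u = 1 + ya. The localisation \<open>R\<close> of \<open>V\<close> at the powers of u
  does not contain \<open>x\<close>: as xy = 1, x u^(k+1) = x u^k + a u^k, so the exponent in a
  membership of x u^k in \<open>V\<close> can be lowered to 0. Maximality then gives
  \<open>R = V\<close>.\<close>

lemma inverse_one_plus:
  assumes a: "a \<in> V" shows "inverse (1 + y * a) \<in> V" "1 + y * a \<noteq> 0"
proof -
  define u where "u = 1 + y * a"
  have "u \<in> V" using a y_in VD by (simp add: u_def)
  show u0: "1 + y * a \<noteq> 0"
  proof
    assume "1 + y * a = 0"
    then have "x * (1 + y * a) = 0" by simp
    then have "x + (x * y) * a = 0" by (simp add: ring_distribs mult.assoc)
    then have "x = - a" by (simp add: xy eq_neg_iff_add_eq_0)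
    then show False using VD(5)[OF a] x_notin by simp
  qed
  have upow: "u ^ k \<in> V" for k by (rule is_subring_power[OF V \<open>u \<in> V\<close>])
  define R where "R = {z. \<exists>k. z * u ^ k \<in> V}"
  have "is_subring R"
    unfolding is_subring_def
  proof (intro conjI ballI)
    show "1 \<in> R" unfolding R_def using VD(1) by (auto intro: exI[of _ 0])
    fix z w assume "z \<in> R" "w \<in> R"
    then obtain k l where kl: "z * u ^ k \<in> V" "w * u ^ l \<in> V" by (auto simp: R_def)
    have "(z - w) * u ^ (k + l) = (z * u ^ k) * u ^ l - (w * u ^ l) * u ^ k"
      by (simp add: power_add algebra_simps)
    also have "\<dots> \<in> V" using kl upow VD by simp
    finally show "z - w \<in> R" by (auto simp: R_def)
    have "(z * w) * u ^ (k + l) = (z * u ^ k) * (w * u ^ l)"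
      by (simp add: power_add algebra_simps)
    also have "\<dots> \<in> V" using kl upow VD by simp
    finally show "z * w \<in> R" by (auto simp: R_def)
  qed
  moreover have "V \<subseteq> R" by (auto simp: R_def intro: exI[of _ 0])
  moreover have "x \<notin> R"
  proof
    assume "x \<in> R"
    then obtain k where "x * u ^ k \<in> V" by (auto simp: R_def)
    then have "x \<in> V"
    proof (induction k)
      case (Suc k)
      have "x * u ^ Suc k = x * u ^ k + (x * y) * a * u ^ k" by (simp add: u_def algebra_simps)
      then have "x * u ^ k = x * u ^ Suc k - a * u ^ k" by (simp add: xy)
      then show ?case using Suc VD(3,4) a upow by simp
    qed simp
    then show False using x_notin by simp
  qed
  ultimately have "R = V" by (rule max)
  have "inverse u * u ^ 1 \<in> V" using u0 VD(1) by (simp add: u_def)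
  then have "inverse u \<in> R" unfolding R_def by blast
  then show "inverse (1 + y * a) \<in> V" using \<open>R = V\<close> by (simp add: u_def)
qed

text \<open>Multiplication by \<open>y\<close> turns \<open>x\<close> into 1. The constant term
  moves to the left and forms \<open>1 - y * a 0\<close>, a unit by \<open>inverse_one_plus\<close>,
  by which the relation is divided.\<close>

lemma drop_constant:
  assumes "x \<in> combinations V z (Suc n)"
  shows "\<exists>a. (\<forall>i. a i \<in> V) \<and> 1 = (\<Sum>i<n. y * a i * z ^ Suc i)"
proof -
  obtain a where a: "\<forall>i<Suc n. a i \<in> V" "x = (\<Sum>i<Suc n. a i * z ^ i)" using combinationsD[OF assms] by blast
  define u where "u = 1 + y * (- a 0)"
  have u: "inverse u \<in> V" "u \<noteq> 0" unfolding u_def using inverse_one_plus[of "- a 0"] a VD(5) by auto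
  have "1 = y * x" using xy by (simp add: mult.commute)
  also have "\<dots> = y * a 0 + (\<Sum>i<n. y * a (Suc i) * z ^ Suc i)"
    unfolding a(2) sum.lessThan_Suc_shift by (simp add: ring_distribs sum_distrib_left mult.assoc)
  finally have "1 - y * a 0 = (\<Sum>i<n. y * a (Suc i) * z ^ Suc i)" by (metis add_diff_cancel_left')
  then have uS: "u = (\<Sum>i<n. y * a (Suc i) * z ^ Suc i)" by (simp add: u_def)
  have "inverse u * (\<Sum>i<n. y * a (Suc i) * z ^ Suc i) = (\<Sum>i<n. y * (inverse u * a (Suc i)) * z ^ Suc i)"
    by (simp only: sum_distrib_left mult_ac)
  then have "inverse u * u = (\<Sum>i<n. y * (inverse u * a (Suc i)) * z ^ Suc i)"
    unfolding uS[symmetric] .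
  then have "1 = (\<Sum>i<n. y * (if i < n then inverse u * a (Suc i) else 0) * z ^ Suc i)" using u(2) by simp
  then show ?thesis using a(1) u VD
    by (intro exI[of _ "\<lambda>i. if i < n then inverse u * a (Suc i) else 0"]) auto
qed

text \<open>The relation in \<open>inverse z\<close>, multiplied by \<open>z ^ n\<close>, expresses
  \<open>z ^ n\<close> through nonnegative lower powers of \<open>z\<close>, because
  \<open>m \<le> n\<close>. This replaces the top term of the relation in \<open>z\<close>;
  multiplying that relation by \<open>x\<close> cancels its factor \<open>y\<close>.\<close>

lemma lower_degree:
  assumes z: "z \<noteq> 0" "x \<in> combinations V z (Suc n)" "x \<in> combinations V (inverse z) (Suc m)" "m \<le> n"
  shows "x \<in> combinations V z n"
proof -
  obtain a where a: "\<And>i. a i \<in> V" "1 = (\<Sum>i<n. y * a i * z ^ Suc i)" using drop_constant[OF z(2)] by blast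
  obtain b where b: "\<And>i. b i \<in> V" "1 = (\<Sum>i<m. y * b i * inverse z ^ Suc i)" using drop_constant[OF z(3)] by blast
  have n: "n > 0" using a(2) by (cases n) auto
  then obtain l where l: "n = Suc l" by (cases n) auto
  have "(\<Sum>i<m. a l * y * b i * z ^ (n - Suc i)) = a l * z ^ n * (\<Sum>i<m. y * b i * inverse z ^ Suc i)"
    unfolding sum_distrib_left
  proof (rule sum.cong[OF refl])
    fix i assume "i \<in> {..<m}"
    then have "n = (n - Suc i) + Suc i" using z(4) by simp
    then have "z ^ n = z ^ (n - Suc i) * z ^ Suc i" by (metis power_add)
    then have "a l * z ^ n * (y * b i * inverse z ^ Suc i) =
      a l * y * b i * z ^ (n - Suc i) * (inverse z * z) ^ Suc i"
      by (simp only: power_mult_distrib mult_ac)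
    moreover have "(inverse z * z) ^ Suc i = 1" using z(1) by simp
    ultimately show "a l * y * b i * z ^ (n - Suc i) = a l * z ^ n * (y * b i * inverse z ^ Suc i)"
      by (simp only: mult_1_right)
  qed
  then have top: "a l * z ^ n = (\<Sum>i<m. a l * y * b i * z ^ (n - Suc i))" using b(2) by simp
  have "x = x * (\<Sum>i<n. y * a i * z ^ Suc i)" using a(2) by simp
  also have "\<dots> = (\<Sum>i<n. (x * y) * a i * z ^ Suc i)" by (simp add: sum_distrib_left mult.assoc)
  also have "\<dots> = (\<Sum>i<l. a i * z ^ Suc i) + a l * z ^ n" by (simp add: xy l)
  also have "\<dots> \<in> combinations V z n"
    unfolding top using n l a(1) b(1) z(4) VD y_in
    by (intro combinations_add combinations_sum combinations_monom V) auto
  finally show ?thesis .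
qed

text \<open>If both failed, maximality would put \<open>x\<close> into the rings obtained by
  adjoining \<open>z\<close> or its inverse. Among the two expressions of \<open>x\<close> of least
  degree, the one of larger degree could be shortened.\<close>

lemma total: "z \<in> V \<or> inverse z \<in> V"
proof (rule ccontr)
  assume neg: "\<not> (z \<in> V \<or> inverse z \<in> V)"
  then have z0: "z \<noteq> 0" using VD(2) by auto
  have ex: "\<exists>n. x \<in> combinations V w (Suc n)" if "w \<notin> V" for w
  proof -
    have "x \<in> adjoin V w"
    proof (rule ccontr)
      assume "x \<notin> adjoin V w"
      then have "adjoin V w = V" using max adjoin[OF V] by blast
      then show False using adjoin(3)[OF V, of w] that by simp
    qed
    then show ?thesis by (rule adjoin_combinations)
  qed
  have 0: "x \<notin> combinations V w 0" for w
    using VD(2) x_notin by (auto simp: combinations_def)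
  define n where "n = (LEAST n. x \<in> combinations V z (Suc n))"
  define m where "m = (LEAST n. x \<in> combinations V (inverse z) (Suc n))"
  have n: "x \<in> combinations V z (Suc n)"
    unfolding n_def by (rule LeastI_ex[OF ex]) (use neg in simp)
  have m: "x \<in> combinations V (inverse z) (Suc m)"
    unfolding m_def by (rule LeastI_ex[OF ex]) (use neg in simp)
  show False
  proof (cases "m \<le> n")
    case True
    have "x \<in> combinations V z n" by (rule lower_degree[OF z0 n m True])
    then obtain k where "n = Suc k" "x \<in> combinations V z (Suc k)" using 0 by (cases n) auto
    then show False using not_less_Least[of k "\<lambda>n. x \<in> combinations V z (Suc n)"] by (simp add: n_def)
  next
    case False
    have "x \<in> combinations V (inverse z) m"
      by (rule lower_degree[of _ _ n]) (use z0 n m False in auto)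
    then obtain k where "m = Suc k" "x \<in> combinations V (inverse z) (Suc k)" using 0 by (cases m) auto
    then show False using not_less_Least[of k "\<lambda>n. x \<in> combinations V (inverse z) (Suc n)"] by (simp add: m_def)
  qed
qed

end

section \<open>From valuation rings to places\<close>

text \<open>\<open>rep\<close> says that V/yV is finite, and \<open>arch\<close> that every nonzero
  element of \<open>V\<close> divides a power of \<open>y\<close>. Together with
  \<open>total\<close> they force a discrete valuation with finite residue field.\<close>

locale valuation_ring =
  fixes V F :: "'a::field set" and y :: 'a
  assumes V: "is_subring V" and total: "\<And>z. z \<in> V \<or> inverse z \<in> V"
    and y_in: "y \<in> V" and y_nonzero: "y \<noteq> 0" and inverse_y: "inverse y \<notin> V"
    and finite_F: "finite F" and rep: "\<And>z. z \<in> V \<Longrightarrow> \<exists>f\<in>F. (z - f) / y \<in> V"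
    and arch: "\<And>z. z \<noteq> 0 \<Longrightarrow> z \<in> V \<Longrightarrow> \<exists>j. y ^ j / z \<in> V"
begin

lemmas VD = is_subringD[OF V]

lemma V_power: "x \<in> V \<Longrightarrow> x ^ n \<in> V"
  by (rule is_subring_power[OF V])

lemma div_trans: "a / b \<in> V \<Longrightarrow> b / c \<in> V \<Longrightarrow> b \<noteq> 0 \<Longrightarrow> a / c \<in> V"
  using VD(4)[of "a / b" "b / c"] by simp

lemma total_div: "a / b \<in> V \<or> b / a \<in> V"
  using total[of "a / b"] by simp

section \<open>The maximal ideal and a uniformizer\<close>

definition M where "M = {z. z = 0 \<or> inverse z \<notin> V}"

lemma M_subset: "z \<in> M \<Longrightarrow> z \<in> V"
  using total[of z] VD(2) by (auto simp: M_def)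

lemma M_mult: "z \<in> M \<Longrightarrow> a \<in> V \<Longrightarrow> a * z \<in> M"
proof (cases "a * z = 0")
  case False
  assume za: "z \<in> M" "a \<in> V"
  have "inverse (a * z) \<notin> V"
  proof
    assume "inverse (a * z) \<in> V"
    then have "a * inverse (a * z) \<in> V" by (rule VD(4)[OF za(2)])
    also have "a * inverse (a * z) = inverse z" using False by simp
    finally show False using za False by (simp add: M_def)
  qed
  then show ?thesis by (simp add: M_def)
qed (simp add: M_def)

lemma M_minus: "z \<in> M \<Longrightarrow> - z \<in> M"
  using M_mult[of z "- 1"] VD(1,5) by simp

lemma M_add:
  assumes "z \<in> M" "w \<in> M" shows "z + w \<in> M"
proof -
  have aux: "z + w \<in> M" if "z \<in> M" "w \<in> M" "z / w \<in> V" "w \<noteq> 0" for z w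
  proof -
    have "(1 + z / w) * w \<in> M" by (rule M_mult[OF that(2) VD(6)[OF VD(1) that(3)]])
    also have "(1 + z / w) * w = z + w" using that by (simp add: field_simps)
    finally show ?thesis .
  qed
  show ?thesis
    using aux[of z w] aux[of w z] total_div[of z w] assms
    by (cases "z = 0"; cases "w = 0") (auto simp: add.commute)
qed

lemma y_in_M: "y \<in> M"
  using inverse_y by (simp add: M_def)

lemma one_notin_M: "1 \<notin> M"
  using VD(1) by (simp add: M_def)

lemma one_minus_unit:
  assumes "z \<in> M" shows "1 - z \<noteq> 0" "inverse (1 - z) \<in> V"
proof -
  have "1 - z \<notin> M" using M_add[of "1 - z" z] assms one_notin_M by auto
  then show "1 - z \<noteq> 0" "inverse (1 - z) \<in> V" by (auto simp: M_def)
qed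

text \<open>The ideals zV, for nonunits z dividing \<open>y\<close>, are measured by the number of
  representatives in \<open>F\<close> that they contain. A maximal one is all of \<open>M\<close>:
  an element z of \<open>M\<close> not divisible by \<pi> would generate a larger one, which also
  contains the representative of z, and \<pi> does not divide that.\<close>

lemma ex_uniformizer: "\<exists>\<pi>. \<pi> \<noteq> 0 \<and> \<pi> \<in> M \<and> y / \<pi> \<in> V \<and> (\<forall>z\<in>M. z / \<pi> \<in> V)"
proof -
  define T where "T = {z. z \<noteq> 0 \<and> z \<in> M \<and> y / z \<in> V}"
  define \<mu> where "\<mu> z = card {f\<in>F. f / z \<in> V}" for z
  have "y \<in> T" using y_in_M y_nonzero VD(1) by (simp add: T_def)
  moreover have "\<forall>z. z \<in> T \<longrightarrow> \<mu> z < Suc (card F)"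
    unfolding \<mu>_def using finite_F by (auto intro!: le_imp_less_Suc card_mono)
  ultimately obtain \<pi> where \<pi>: "\<pi> \<in> T" "\<And>z. z \<in> T \<Longrightarrow> \<mu> z \<le> \<mu> \<pi>"
    using ex_has_greatest_nat[of "\<lambda>z. z \<in> T" y \<mu> "Suc (card F)"] by blast
  have "z / \<pi> \<in> V" if z: "z \<in> M" for z
  proof (rule ccontr)
    assume neg: "z / \<pi> \<notin> V"
    then have z0: "z \<noteq> 0" using VD(2) by auto
    have pz: "\<pi> / z \<in> V" using total_div[of z \<pi>] neg by blast
    have "z \<in> T" using z z0 \<pi>(1) div_trans[of y \<pi> z] pz by (auto simp: T_def)
    obtain f where f: "f \<in> F" "(z - f) / y \<in> V" using rep[OF M_subset[OF z]] by blast
    have y\<pi>: "y / \<pi> \<in> V" using \<pi>(1) by (simp add: T_def)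
    have f\<pi>: "(z - f) / \<pi> \<in> V" by (rule div_trans[OF f(2) y\<pi> y_nonzero])
    have fz: "(z - f) / z \<in> V"
      by (rule div_trans[OF f\<pi> pz]) (use \<pi>(1) in \<open>simp add: T_def\<close>)
    have "f / z = 1 - (z - f) / z" using z0 by (simp add: diff_divide_distrib)
    then have "f / z \<in> V" using VD(1,3) fz by simp
    moreover have "f / \<pi> \<notin> V"
    proof
      assume "f / \<pi> \<in> V"
      then have "f / \<pi> + (z - f) / \<pi> \<in> V" by (rule VD(6)[OF _ f\<pi>])
      then show False using neg by (simp add: add_divide_distrib[symmetric])
    qed
    moreover have "g / z \<in> V" if "g / \<pi> \<in> V" for g
      by (rule div_trans[OF that pz]) (use \<pi>(1) in \<open>simp add: T_def\<close>)
    ultimately have "{g\<in>F. g / \<pi> \<in> V} \<subset> {g\<in>F. g / z \<in> V}" using f(1) by blast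
    then have "\<mu> \<pi> < \<mu> z" unfolding \<mu>_def using finite_F by (intro psubset_card_mono) auto
    then show False using \<pi>(2)[OF \<open>z \<in> T\<close>] by simp
  qed
  then show ?thesis using \<pi>(1) by (auto simp: T_def)
qed

definition \<pi> where "\<pi> = (SOME \<pi>. \<pi> \<noteq> 0 \<and> \<pi> \<in> M \<and> y / \<pi> \<in> V \<and> (\<forall>z\<in>M. z / \<pi> \<in> V))"

lemma \<pi>: "\<pi> \<noteq> 0" "\<pi> \<in> M" "y / \<pi> \<in> V" "\<And>z. z \<in> M \<Longrightarrow> z / \<pi> \<in> V"
  using someI_ex[OF ex_uniformizer] unfolding \<pi>_def[symmetric] by blast+

lemma \<pi>_in: "\<pi> \<in> V" using M_subset \<pi>(2) by blast

text \<open>Pigeonhole in V/yV: \<open>y\<close> divides some \<open>\<pi> ^ i - \<pi> ^ j\<close>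
  with \<open>i < j\<close>, which is \<open>\<pi> ^ i\<close> times the unit
  \<open>1 - \<pi> ^ (j - i)\<close>.\<close>

lemma ex_power_divisible: "\<exists>a. \<pi> ^ a / y \<in> V"
proof -
  obtain f where f: "\<And>k. f k \<in> F" "\<And>k. (\<pi> ^ k - f k) / y \<in> V"
    using rep[OF V_power[OF \<pi>_in]] by metis
  have "finite (range f)" using f(1) finite_F by (meson finite_subset image_subsetI)
  then have "\<not> inj f" using finite_imageD infinite_UNIV_nat by blast
  then obtain i j where ij: "i \<noteq> j" "f i = f j" by (auto simp: inj_def)
  have "\<exists>a. \<pi> ^ a / y \<in> V" if "i < j" "f i = f j" for i j
  proof -
    have "(\<pi> ^ i - f i) / y - (\<pi> ^ j - f j) / y \<in> V" by (rule VD(3)[OF f(2) f(2)])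
    then have "(\<pi> ^ i - \<pi> ^ j) / y \<in> V" using that by (simp add: diff_divide_distrib[symmetric])
    moreover have "\<pi> ^ (j - i) \<in> M"
    proof -
      have "j - i = Suc (j - i - 1)" using that by simp
      then have "\<pi> ^ (j - i) = \<pi> ^ (j - i - 1) * \<pi>" by (metis power_Suc2)
      then show ?thesis using M_mult[OF \<pi>(2) V_power[OF \<pi>_in]] by simp
    qed
    note u = one_minus_unit[OF this]
    have "\<pi> ^ i - \<pi> ^ j = \<pi> ^ i * (1 - \<pi> ^ (j - i))"
      using that by (simp add: algebra_simps power_add[symmetric])
    then have "\<pi> ^ i / y = (\<pi> ^ i - \<pi> ^ j) / y * inverse (1 - \<pi> ^ (j - i))"
      using u by simp
    then show ?thesis using VD(4) u calculation by metis
  qed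
  then show ?thesis using ij by (metis nat_neq_iff)
qed

lemma ex_order_nat:
  assumes z: "z \<in> V" "z \<noteq> 0"
  shows "\<exists>k. z / \<pi> ^ k \<in> V \<and> \<pi> ^ k / z \<in> V"
proof -
  obtain j where j: "y ^ j / z \<in> V" using arch z by blast
  obtain a where a: "\<pi> ^ a / y \<in> V" using ex_power_divisible by blast
  \<comment> \<open>Here \<open>z\<close> divides \<open>y ^ j\<close>, while this power of \<pi> is
    a multiple of \<open>y ^ Suc j\<close>; if it divided \<open>z\<close>, then
    \<open>y ^ Suc j\<close> would divide \<open>y ^ j\<close>. So the powers of \<pi> dividing
    \<open>z\<close> are bounded, and the last one leaves a unit.\<close>
  have "z / \<pi> ^ (a * Suc j) \<notin> V"
  proof
    assume *: "z / \<pi> ^ (a * Suc j) \<in> V"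
    have "(\<pi> ^ a / y) ^ Suc j \<in> V" by (rule V_power[OF a])
    then have "\<pi> ^ (a * Suc j) / y ^ Suc j \<in> V" by (simp only: power_divide power_mult)
    then have "z / y ^ Suc j \<in> V" by (rule div_trans[OF *]) (use \<pi>(1) in simp)
    then have "y ^ j / y ^ Suc j \<in> V" by (rule div_trans[OF j]) (use z in simp)
    also have "y ^ j / y ^ Suc j = inverse y" using y_nonzero by (simp add: field_simps)
    finally show False using inverse_y by simp
  qed
  then have ex: "\<exists>k. z / \<pi> ^ k \<notin> V" by blast
  define n where "n = (LEAST k. z / \<pi> ^ k \<notin> V)"
  have n: "z / \<pi> ^ n \<notin> V" unfolding n_def by (rule LeastI_ex[OF ex])
  then obtain k where k: "n = Suc k" using z by (cases n) auto
  have zk: "z / \<pi> ^ k \<in> V" using not_less_Least[of k "\<lambda>k. z / \<pi> ^ k \<notin> V"] k by (auto simp: n_def)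
  have "z / \<pi> ^ k \<notin> M"
  proof
    assume "z / \<pi> ^ k \<in> M"
    then have "z / \<pi> ^ k / \<pi> \<in> V" by (rule \<pi>(4))
    then show False using n by (simp add: k mult.commute)
  qed
  then have "inverse (z / \<pi> ^ k) \<in> V" by (simp add: M_def)
  then show ?thesis using zk by auto
qed

lemma ex_order:
  assumes "z \<noteq> 0" shows "\<exists>k::int. z / \<pi> powi k \<in> V \<and> \<pi> powi k / z \<in> V"
proof (cases "z \<in> V")
  case True
  then obtain k where "z / \<pi> ^ k \<in> V \<and> \<pi> ^ k / z \<in> V" using ex_order_nat assms by blast
  then show ?thesis by (intro exI[of _ "int k"]) simp
next
  case False
  then have "inverse z \<in> V" using total by blast
  then obtain k where "inverse z / \<pi> ^ k \<in> V \<and> \<pi> ^ k / inverse z \<in> V" using ex_order_nat assms by force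
  then show ?thesis
    by (intro exI[of _ "- int k"]) (simp add: power_int_minus divide_inverse mult.commute)
qed

section \<open>Order function, residue field and normalised absolute value\<close>

definition ord where "ord z = (SOME k::int. z / \<pi> powi k \<in> V \<and> \<pi> powi k / z \<in> V)"

lemma ord: "z \<noteq> 0 \<Longrightarrow> z / \<pi> powi ord z \<in> V" "z \<noteq> 0 \<Longrightarrow> \<pi> powi ord z / z \<in> V"
  using someI_ex[OF ex_order] unfolding ord_def[symmetric] by blast+

lemma powi_in_V_iff: "\<pi> powi k \<in> V \<longleftrightarrow> k \<ge> 0"
proof
  assume "k \<ge> 0"
  then show "\<pi> powi k \<in> V" using V_power[OF \<pi>_in] by (simp add: power_int_def)
next
  assume *: "\<pi> powi k \<in> V"
  show "k \<ge> 0"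
  proof (rule ccontr)
    assume k: "\<not> k \<ge> 0"
    have "\<pi> powi k * \<pi> ^ nat (- k - 1) \<in> V" by (rule VD(4)[OF * V_power[OF \<pi>_in]])
    also have "\<pi> powi k * \<pi> ^ nat (- k - 1) = \<pi> powi (k + (- k - 1))"
      using k \<pi>(1) by (subst power_int_add) (auto simp: power_int_def)
    also have "\<dots> = inverse \<pi>" by simp
    finally show False using \<pi>(1,2) by (simp add: M_def)
  qed
qed

lemma ord_nonneg_iff: "z \<noteq> 0 \<Longrightarrow> ord z \<ge> 0 \<longleftrightarrow> z \<in> V"
proof
  assume z: "z \<noteq> 0" "ord z \<ge> 0"
  have "z / \<pi> powi ord z * \<pi> powi ord z \<in> V"
    by (rule VD(4)[OF ord(1)[OF z(1)]]) (use z(2) powi_in_V_iff in simp)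
  then show "z \<in> V" using \<pi>(1) by simp
next
  assume z: "z \<noteq> 0" "z \<in> V"
  have "\<pi> powi ord z / z * z \<in> V" by (rule VD(4)[OF ord(2)[OF z(1)] z(2)])
  then show "ord z \<ge> 0" using z powi_in_V_iff by simp
qed

lemma ord_eqI:
  assumes z: "z \<noteq> 0" "z / \<pi> powi k \<in> V" "\<pi> powi k / z \<in> V"
  shows "ord z = k"
proof -
  have pn: "\<pi> powi l \<noteq> 0" for l using \<pi>(1) by simp
  have "\<pi> powi k / \<pi> powi ord z \<in> V" by (rule div_trans[OF z(3) ord(1)[OF z(1)] z(1)])
  then have "k - ord z \<ge> 0" using \<pi>(1) by (simp add: power_int_diff flip: powi_in_V_iff)
  moreover have "\<pi> powi ord z / \<pi> powi k \<in> V" by (rule div_trans[OF ord(2)[OF z(1)] z(2) z(1)])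
  then have "ord z - k \<ge> 0" using \<pi>(1) by (simp add: power_int_diff flip: powi_in_V_iff)
  ultimately show ?thesis by simp
qed

lemma ord_mult:
  assumes "z \<noteq> 0" "w \<noteq> 0" shows "ord (z * w) = ord z + ord w"
proof (rule ord_eqI)
  have e: "\<pi> powi (ord z + ord w) = \<pi> powi ord z * \<pi> powi ord w" using \<pi>(1) by (simp add: power_int_add)
  show "z * w \<noteq> 0" using assms by simp
  show "z * w / \<pi> powi (ord z + ord w) \<in> V"
    using VD(4)[OF ord(1)[OF assms(1)] ord(1)[OF assms(2)]] by (simp add: e)
  show "\<pi> powi (ord z + ord w) / (z * w) \<in> V"
    using VD(4)[OF ord(2)[OF assms(1)] ord(2)[OF assms(2)]] by (simp add: e)
qed

lemma ord_powi: "ord (\<pi> powi k) = k"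
  by (rule ord_eqI) (use \<pi>(1) VD(1) in auto)

definition resrel where "resrel = {(z, w). z \<in> V \<and> w \<in> V \<and> z - w \<in> M}"

lemma equiv_resrel: "equiv V resrel"
proof (rule equivI)
  show "resrel \<subseteq> V \<times> V" by (auto simp: resrel_def)
  show "refl_on V resrel" by (auto simp: refl_on_def resrel_def M_def)
  show "sym resrel"
  proof (rule symI)
    fix z w assume "(z, w) \<in> resrel"
    then show "(w, z) \<in> resrel" using M_minus[of "z - w"] by (simp add: resrel_def)
  qed
  show "trans resrel"
  proof (rule transI)
    fix z w u assume "(z, w) \<in> resrel" "(w, u) \<in> resrel"
    then show "(z, u) \<in> resrel" using M_add[of "z - w" "w - u"] by (simp add: resrel_def)
  qed
qed

definition N where "N = card (V // resrel)"

lemma finite_residue: "finite (V // resrel)"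
proof (rule finite_subset)
  show "V // resrel \<subseteq> (\<lambda>f. resrel `` {f}) ` F"
  proof
    fix C assume "C \<in> V // resrel"
    then obtain z where z: "z \<in> V" "C = resrel `` {z}" by (rule quotientE)
    obtain f where f: "f \<in> F" "(z - f) / y \<in> V" using rep[OF z(1)] by blast
    have "(z - f) / y * y \<in> M" by (rule M_mult[OF y_in_M f(2)])
    then have m: "z - f \<in> M" using y_nonzero by simp
    have "z - (z - f) \<in> V" by (rule VD(3)[OF z(1) M_subset[OF m]])
    then have "(z, f) \<in> resrel" using z(1) m by (simp add: resrel_def)
    then show "C \<in> (\<lambda>f. resrel `` {f}) ` F" using equiv_class_eq[OF equiv_resrel] f(1) z(2) by blast
  qed
qed (use finite_F in simp)

lemma N_ge_2: "N \<ge> 2"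
proof -
  have "resrel `` {0} \<noteq> resrel `` {1}"
  proof
    assume "resrel `` {0} = resrel `` {1}"
    then have "(0, 1) \<in> resrel" using eq_equiv_class[OF _ equiv_resrel] VD(1) by blast
    then show False using M_minus[of "- 1"] one_notin_M by (simp add: resrel_def)
  qed
  then have "card {resrel `` {0}, resrel `` {1}} = 2" by simp
  moreover have "card {resrel `` {0}, resrel `` {1}} \<le> N"
    unfolding N_def using VD(1,2) by (intro card_mono finite_residue) (auto intro: quotientI)
  ultimately show ?thesis by simp
qed

definition v where "v z = (if z = 0 then 0 else real N powi (- ord z))"

lemma N_gt_1: "real N > 1" using N_ge_2 by simp

lemma v_le_1_iff: "v z \<le> 1 \<longleftrightarrow> z \<in> V"
proof (cases "z = 0")
  case False
  have "real N powi (- ord z) \<le> 1 \<longleftrightarrow> - ord z \<le> 0"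
  proof
    assume *: "real N powi (- ord z) \<le> 1"
    show "- ord z \<le> 0"
    proof (rule ccontr)
      assume "\<not> - ord z \<le> 0"
      then have "real N powi 0 < real N powi (- ord z)"
        by (intro power_int_strict_increasing N_gt_1) simp
      then show False using * by simp
    qed
  next
    assume "- ord z \<le> 0"
    then show "real N powi (- ord z) \<le> 1"
      using power_int_increasing[of "- ord z" 0 "real N"] N_gt_1 by simp
  qed
  then show ?thesis using ord_nonneg_iff[OF False] False by (simp add: v_def)
qed (use VD(2) in \<open>simp add: v_def\<close>)

lemma v_mult: "v (z * w) = v z * v w"
  using N_ge_2 by (auto simp: v_def ord_mult power_int_add[symmetric])

lemma v_nonneg: "v z \<ge> 0"
  by (simp add: v_def)

lemma v_eq_0: "v z = 0 \<longleftrightarrow> z = 0"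
  using N_ge_2 by (auto simp: v_def)

lemma v_inverse: "v (inverse z) = inverse (v z)"
proof (cases "z = 0")
  case False
  have "v 1 * v 1 = v 1" using v_mult[of 1 1] by simp
  then have "v 1 = 1" using v_eq_0[of 1] by simp
  then have "v z * v (inverse z) = 1" using False by (simp flip: v_mult)
  then show ?thesis by (metis inverse_unique)
qed (simp add: v_def)

lemma v_less_1_iff: "v z < 1 \<longleftrightarrow> z \<in> M"
proof (cases "z = 0")
  case False
  then have "v z > 0" using v_eq_0[of z] v_nonneg[of z] by linarith
  then have "v z < 1 \<longleftrightarrow> \<not> v (inverse z) \<le> 1" unfolding v_inverse by (simp add: inverse_le_1_iff not_le)
  then show ?thesis using False by (simp add: v_le_1_iff M_def)
qed (simp add: v_def M_def)

lemma v_add: "v (z + w) \<le> v z + v w"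
proof -
  have aux: "v (z + w) \<le> v w" if "z / w \<in> V" "w \<noteq> 0" for z w
  proof -
    have "1 + z / w \<in> V" by (rule VD(6)[OF VD(1) that(1)])
    then have "v (1 + z / w) * v w \<le> 1 * v w" using v_nonneg by (intro mult_right_mono) (auto simp: v_le_1_iff)
    then have "v ((1 + z / w) * w) \<le> v w" by (simp add: v_mult)
    moreover have "(1 + z / w) * w = z + w" using that by (simp add: ring_distribs)
    ultimately show ?thesis by simp
  qed
  show ?thesis
  proof (cases "z = 0 \<or> w = 0")
    case True then show ?thesis using v_nonneg[of z] v_nonneg[of w] by auto
  next
    case False
    then show ?thesis using aux[of z w] aux[of w z] total_div[of z w] v_nonneg[of z] v_nonneg[of w]
      by (auto simp: add.commute)
  qed
qed

lemma v_in_places: "v \<in> places"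
proof -
  have abs: "absolute_value v"
    unfolding absolute_value_def using v_nonneg v_eq_0 v_mult v_add by blast
  have "v y \<noteq> 1" using v_less_1_iff[of y] y_in_M by simp
  then have nontriv: "nontrivial_absolute_value v"
    unfolding nontrivial_absolute_value_def using abs y_nonzero by blast
  have "residue_card v = N"
  proof -
    have "{x. v x \<le> 1} = V" by (auto simp: v_le_1_iff)
    moreover have "{(z, w). v z \<le> 1 \<and> v w \<le> 1 \<and> v (z - w) < 1} = resrel"
      by (auto simp: resrel_def v_le_1_iff v_less_1_iff)
    ultimately show ?thesis by (simp add: residue_card_def N_def)
  qed
  moreover have "v ` (UNIV - {0}) = range (\<lambda>n::int. real N powi n)"
  proof
    show "v ` (UNIV - {0}) \<subseteq> range (\<lambda>n::int. real N powi n)"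
      by (auto simp: v_def)
    show "range (\<lambda>n::int. real N powi n) \<subseteq> v ` (UNIV - {0})"
    proof safe
      fix n :: int
      have "real N powi n = v (\<pi> powi (- n))" using \<pi>(1) by (simp add: v_def ord_powi)
      moreover have "\<pi> powi (- n) \<in> UNIV - {0}" using \<pi>(1) by simp
      ultimately show "real N powi n \<in> v ` (UNIV - {0})" by blast
    qed
  qed
  ultimately show ?thesis using nontriv by (simp add: places_def)
qed

end

section \<open>Existence of a pole\<close>

context function_field
begin

text \<open>If no positive power of \<open>x\<close> is 1, then \<open>x\<close> is not in F_p[1/x].
  A ring maximal among those that contain y = 1/x but not \<open>x\<close> is a valuation ring, and
  \<open>bounded_rank\<close> supplies both the finiteness of V/yV and the archimedean property, so
  the ring comes from a place.\<close>

lemma ex_place_gt_1: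
  assumes x: "x \<noteq> 0" "\<And>n. n > 0 \<Longrightarrow> x ^ n \<noteq> (1 :: 'a)"
  shows "\<exists>v\<in>places. v x > 1"
proof -
  define y where "y = inverse x"
  have y0: "y \<noteq> 0" and xy: "x * y = 1" using x by (auto simp: y_def)
  note P = prime_subring[OF prime_char]
  note R = adjoin[OF P(1), of y]
  have "x \<notin> adjoin (range of_nat) y"
    using root_of_unity_if_adjoin_inverse[OF P x(1)] x(2) by (auto simp: y_def)
  then obtain V where VR: "is_subring V" "y \<in> V" "x \<notin> V"
    and max: "\<And>R. is_subring R \<Longrightarrow> V \<subseteq> R \<Longrightarrow> x \<notin> R \<Longrightarrow> R = V"
    using ex_maximal_subring[OF R(1,3)] by metis
  interpret maximal_subring V x y
    by unfold_locales (use VR xy max in auto)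
  have coeff_sub: "a \<in> V" if "a \<in> {-1, 0, 1}" for a using that VD(1,2) VD(5)[OF VD(1)] by auto
  obtain m where m: "\<forall>(z :: nat \<Rightarrow> 'a) R. is_subring R \<longrightarrow> y \<in> R \<longrightarrow>
    (\<exists>a b. (\<forall>j. a j \<in> {-1, 0, 1}) \<and> (\<forall>j. b j \<in> R) \<and> (\<exists>j<m. a j \<noteq> 0) \<and>
      (\<Sum>j<m. (a j + y * b j) * z j) = 0)"
    using bounded_rank[OF y0] by (rule exE)
  have relation: "\<exists>a. (\<forall>j. a j \<in> {-1, 0, 1}) \<and> (\<exists>j<m. a j \<noteq> 0) \<and> (\<Sum>j<m. a j * z j) / y \<in> V"
    if z: "\<And>j. j < m \<Longrightarrow> z j \<in> V" for z
  proof -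
    obtain a b where ab: "\<forall>j. a j \<in> {-1, 0, 1}" "\<exists>j<m. a j \<noteq> 0" "\<forall>j. b j \<in> V"
      "(\<Sum>j<m. (a j + y * b j) * z j) = 0"
      using m[rule_format, OF VR(1,2), of z] by blast
    have "(\<Sum>j<m. a j * z j) + y * (\<Sum>j<m. b j * z j) = 0"
      using ab(4) by (simp add: ring_distribs sum.distrib sum_distrib_left mult.assoc)
    then have "(\<Sum>j<m. a j * z j) = y * (- (\<Sum>j<m. b j * z j))" by (simp add: eq_neg_iff_add_eq_0)
    then have "(\<Sum>j<m. a j * z j) / y = - (\<Sum>j<m. b j * z j)" using y0 by simp
    also have "\<dots> \<in> V"
      by (rule VD(5), rule is_subring_sum[OF VR(1)], rule VD(4)) (use ab(3) z in auto)
    finally show ?thesis using ab by blast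
  qed
  \<comment> \<open>Independence modulo yV with respect to the coefficients -1, 0, 1. By
    \<open>relation\<close> such a family has fewer than \<open>m\<close> members, so a longest one
    exists; its finitely many combinations will represent V/yV.\<close>
  define indep where "indep n z \<longleftrightarrow> (\<forall>j<n. z j \<in> V) \<and>
    (\<forall>a. (\<forall>j. a j \<in> {-1, 0, 1}) \<and> (\<Sum>j<n. a j * z j) / y \<in> V \<longrightarrow> (\<forall>j<n. a j = 0))"
    for n :: nat and z :: "nat \<Rightarrow> 'a"
  have indepD: "z j \<in> V" if "indep n z" "j < n" for n z j
    using that by (simp add: indep_def)
  have indep_zero: "a j = 0" if "indep n z" "\<forall>j. a j \<in> {-1, 0, 1}" "(\<Sum>j<n. a j * z j) / y \<in> V" "j < n"
    for n z a j
    using that(1)[unfolded indep_def, THEN conjunct2, rule_format, of a j] that(2-4) by simp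
  have "\<forall>n. (\<exists>z. indep n z) \<longrightarrow> n < m"
  proof (intro allI impI, rule ccontr)
    fix n assume "\<exists>z. indep n z" "\<not> n < m"
    then obtain z where z: "indep n z" and mn: "m \<le> n" by auto
    have zV: "z j \<in> V" if "j < m" for j using indepD[OF z, of j] that mn by simp
    obtain a where a: "\<forall>j. a j \<in> {-1, 0, 1}" "\<exists>j<m. a j \<noteq> 0" "(\<Sum>j<m. a j * z j) / y \<in> V"
      using relation[of z, OF zV] by blast
    have "(\<Sum>j<n. (if j < m then a j else 0) * z j) = (\<Sum>j<m. a j * z j)"
      by (rule sum.mono_neutral_cong_right) (use mn in auto)
    then have "(if j < m then a j else 0) = 0" if "j < n" for j
      by (intro indep_zero[OF z _ _ that]) (use a in auto)
    then show False using a(2) mn by (metis less_le_trans)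
  qed
  moreover have "\<exists>z. indep 0 z" by (simp add: indep_def)
  ultimately obtain n where "\<exists>z. indep n z" and nmax: "\<And>k. \<exists>z. indep k z \<Longrightarrow> k \<le> n"
    using ex_has_greatest_nat[of "\<lambda>n. \<exists>z. indep n z" 0 id m] by auto
  then obtain z where z: "indep n z" by blast
  define F where "F = (\<lambda>a. \<Sum>j<n. a j * z j) ` ({..<n} \<rightarrow>\<^sub>E {-1, 0, 1})"
  have "finite F" unfolding F_def by (intro finite_imageI finite_PiE) auto
  have rep: "\<exists>f\<in>F. (w - f) / y \<in> V" if w: "w \<in> V" for w
  proof -
    \<comment> \<open>A relation of the extended family must involve \<open>w\<close>, and its
      coefficient \<open>a n\<close> is 1 or -1, hence its own inverse; solving for \<open>w\<close>
      modulo y gives the representative \<open>f\<close>.\<close>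
    let ?z = "z(n := w)"
    have "\<not> indep (Suc n) ?z" using nmax[of "Suc n"] by auto
    then obtain a where a: "\<forall>j. a j \<in> {-1, 0, 1}" "(\<Sum>j<Suc n. a j * ?z j) / y \<in> V" "\<exists>j<Suc n. a j \<noteq> 0"
      unfolding indep_def using indepD[OF z] w by (auto simp: less_Suc_eq)
    have sum: "(\<Sum>j<Suc n. a j * ?z j) = (\<Sum>j<n. a j * z j) + a n * w" by simp
    have an: "a n \<noteq> 0"
    proof
      assume "a n = 0"
      then have "\<forall>j<n. a j = 0" using indep_zero[OF z a(1)] a(2) sum by simp
      then show False using a(3) \<open>a n = 0\<close> less_Suc_eq by auto
    qed
    then have an2: "a n * a n = 1" and anV: "a n \<in> V" using a(1)[rule_format, of n] coeff_sub by auto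
    define f where "f = (\<Sum>j<n. (if j < n then - (a n * a j) else undefined) * z j)"
    have "f \<in> F"
      unfolding F_def
    proof (rule image_eqI[of _ _ "\<lambda>j. if j < n then - (a n * a j) else undefined"])
      have "- (a n * a j) \<in> {-1, 0, 1}" for j
        using a(1)[rule_format, of n] a(1)[rule_format, of j] by auto
      then show "(\<lambda>j. if j < n then - (a n * a j) else undefined) \<in> {..<n} \<rightarrow>\<^sub>E {-1, 0, 1}"
        by (intro PiE_I) auto
    qed (simp add: f_def)
    have "f = - a n * (\<Sum>j<n. a j * z j)" by (simp add: f_def sum_distrib_left sum_negf mult.assoc)
    then have "w - f = (a n * a n) * w + a n * (\<Sum>j<n. a j * z j)" by (simp add: an2)
    also have "\<dots> = a n * ((\<Sum>j<n. a j * z j) + a n * w)" by (simp only: ring_distribs mult_ac add_ac)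
    finally have "(w - f) / y = a n * ((\<Sum>j<Suc n. a j * ?z j) / y)" by (simp add: sum)
    also have "\<dots> \<in> V" by (rule VD(4)[OF anV a(2)])
    finally show ?thesis using \<open>f \<in> F\<close> by blast
  qed
  have arch: "\<exists>j. y ^ j / w \<in> V" if w: "w \<noteq> 0" "w \<in> V" for w
  proof -
    \<comment> \<open>\<open>bounded_rank\<close> is now applied to \<open>w\<close> in the role of
      \<open>y\<close>, with the powers of \<open>y\<close> as the family: the sum of the terms
      \<open>a j * y ^ j\<close> is a multiple of \<open>w\<close>, and up to a unit it equals its
      lowest nonzero term.\<close>
    obtain m where m: "\<forall>(z :: nat \<Rightarrow> 'a) R. is_subring R \<longrightarrow> w \<in> R \<longrightarrow>
      (\<exists>a b. (\<forall>j. a j \<in> {-1, 0, 1}) \<and> (\<forall>j. b j \<in> R) \<and> (\<exists>j<m. a j \<noteq> 0) \<and>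
        (\<Sum>j<m. (a j + w * b j) * z j) = 0)"
      using bounded_rank[OF w(1)] by (rule exE)
    obtain a b where ab: "\<forall>j. a j \<in> {-1, 0, 1}" "\<exists>j<m. a j \<noteq> 0" "\<forall>j. b j \<in> V"
      "(\<Sum>j<m. (a j + w * b j) * y ^ j) = 0"
      using m[rule_format, OF VR(1) w(2), of "\<lambda>j. y ^ j"] by metis
    define i where "i = (LEAST j. j < m \<and> a j \<noteq> 0)"
    have i: "i < m \<and> a i \<noteq> 0" unfolding i_def by (rule LeastI_ex[OF ab(2)])
    have below: "a j = 0" if "j < i" for j
      using not_less_Least[OF that[unfolded i_def]] that i by auto
    have ai: "a i * a i = 1" "a i \<in> V" using ab(1)[rule_format, of i] i coeff_sub by auto
    define s where "s = a i * (\<Sum>j=Suc i..<m. a j * y ^ (j - Suc i))"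
    have sV: "s \<in> V" unfolding s_def
      by (intro VD(4) ai is_subring_sum[OF VR(1)] coeff_sub ab(1)[rule_format] is_subring_power[OF VR(1,2)])
    have "(\<Sum>j<m. a j * y ^ j) = (\<Sum>j=i..<m. a j * y ^ j)"
      by (rule sum.mono_neutral_right) (use below i in auto)
    also have "\<dots> = a i * y ^ i + (\<Sum>j=Suc i..<m. a j * y ^ j)"
      using i by (simp add: sum.atLeast_Suc_lessThan)
    also have "(\<Sum>j=Suc i..<m. a j * y ^ j) = (\<Sum>j=Suc i..<m. y ^ Suc i * (a j * y ^ (j - Suc i)))"
    proof (rule sum.cong[OF refl])
      fix j assume "j \<in> {Suc i..<m}"
      then have "y ^ j = y ^ (Suc i + (j - Suc i))" by simp
      then have "y ^ j = y ^ Suc i * y ^ (j - Suc i)" by (simp only: power_add)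
      then show "a j * y ^ j = y ^ Suc i * (a j * y ^ (j - Suc i))" by (simp only: mult_ac)
    qed
    also have "a i * y ^ i + \<dots> = y ^ i * (a i + y * (\<Sum>j=Suc i..<m. a j * y ^ (j - Suc i)))"
      by (simp add: sum_distrib_left ring_distribs mult_ac)
    finally have eq1: "a i * (\<Sum>j<m. a j * y ^ j) = y ^ i * (1 + y * s)"
      using ai(1) by (simp add: s_def ring_distribs mult_ac)
    have u: "inverse (1 + y * s) \<in> V" "1 + y * s \<noteq> 0" by (rule inverse_one_plus[OF sV])+
    define t where "t = (\<Sum>j<m. b j * y ^ j)"
    have tV: "t \<in> V" unfolding t_def
      by (intro is_subring_sum[OF VR(1)] VD(4) ab(3)[rule_format] is_subring_power[OF VR(1,2)])
    have "(\<Sum>j<m. a j * y ^ j) + w * t = 0"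
      using ab(4) by (simp add: t_def ring_distribs sum.distrib sum_distrib_left mult.assoc)
    then have "(\<Sum>j<m. a j * y ^ j) = - (w * t)" by (simp add: eq_neg_iff_add_eq_0)
    then have "y ^ i * (1 + y * s) = w * (- (a i * t))" unfolding eq1[symmetric] by simp
    then have "y ^ i / w = (- (a i * t)) * inverse (1 + y * s)"
      using u(2) w(1) by (simp add: field_simps)
    also have "\<dots> \<in> V" by (rule VD(4)[OF VD(5)[OF VD(4)[OF ai(2) tV]] u(1)])
    finally show ?thesis by blast
  qed
  interpret W: valuation_ring V F y
    by unfold_locales
      (use VR total rep arch \<open>finite F\<close> y0 x in \<open>auto simp: y_def\<close>)
  have "\<not> W.v x \<le> 1" using VR(3) by (simp add: W.v_le_1_iff)
  then show ?thesis using W.v_in_places by (intro bexI[of _ W.v]) auto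
qed

end

section \<open>Finiteness of the set of poles\<close>

context place
begin

lemma v_bounded_subring: "is_subring {x. v x \<le> 1}"
  unfolding is_subring_def
proof (intro conjI ballI)
  show "1 \<in> {x. v x \<le> 1}" by simp
  fix x y assume "x \<in> {x. v x \<le> 1}" "y \<in> {x. v x \<le> 1}"
  then show "x - y \<in> {x. v x \<le> 1}" "x * y \<in> {x. v x \<le> 1}"
    using v_diff[of x y] by (simp_all add: v_mult mult_le_one)
qed

lemma obtain_uniformizer:
  obtains \<pi> where "\<pi> \<noteq> 0" "v \<pi> = inverse (real N)"
proof -
  obtain x where "x \<noteq> 0" "v x = real N powi (-1)" by (rule obtain_value)
  then show ?thesis using that[of x] by simp
qed

lemma v_le_1_inverse_iff: "x \<noteq> 0 \<Longrightarrow> v (inverse x) \<le> 1 \<longleftrightarrow> v x \<ge> 1"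
  using v_pos[of x] by (simp add: v_inverse inverse_le_1_iff)

end

section \<open>Separation of places and weak approximation\<close>

context function_field
begin

lemma placeI: "v \<in> places \<Longrightarrow> place (v :: 'a \<Rightarrow> real)"
  by unfold_locales (use prime_char in auto)

text \<open>If w z = 1 < v z, then any element divided by a high power of z is integral at
  \<open>v\<close>, hence at \<open>w\<close>, with unchanged value at \<open>w\<close>; this would
  bound \<open>w\<close>. So the valuation rings agree, and with them the residue fields. Comparing
  uniformizers gives negative exponents with product 1, so the normalised values coincide.\<close>

lemma valuation_ring_determines_place:
  fixes v w :: "'a \<Rightarrow> real"
  assumes "v \<in> places" "w \<in> places" and le: "\<And>z. v z \<le> 1 \<Longrightarrow> w z \<le> 1"
  shows "v = w"
proof -
  interpret v: place v by (rule placeI) fact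
  interpret w: place w by (rule placeI) fact
  have ge: "v z \<le> 1" if "w z \<le> 1" for z
  proof (rule ccontr)
    assume gt: "\<not> v z \<le> 1"
    then have z0: "z \<noteq> 0" by auto
    have "v (inverse z) \<le> 1" using gt z0 v.v_le_1_inverse_iff by simp
    then have "w z \<ge> 1" using le w.v_le_1_inverse_iff[OF z0] by blast
    then have wz: "w z = 1" using that by simp
    obtain u where u: "u \<noteq> 0" "w u = real w.N powi 1" by (rule w.obtain_value)
    obtain n where n: "v z ^ n > v u" using real_arch_pow[of "v z" "v u"] gt by auto
    have "v z ^ n > 0" using gt by simp
    then have "v (u / z ^ n) \<le> 1" using n by (simp add: v.v_divide v.v_power divide_le_eq)
    then have "w (u / z ^ n) \<le> 1" by (rule le)
    then show False using wz u w.N_gt_1 by (simp add: w.v_divide w.v_power)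
  qed
  have le_iff: "v z \<le> 1 \<longleftrightarrow> w z \<le> 1" for z using le ge by blast
  have ge_iff: "v z \<ge> 1 \<longleftrightarrow> w z \<ge> 1" for z
    using le_iff[of "inverse z"] v.v_le_1_inverse_iff[of z] w.v_le_1_inverse_iff[of z]
    by (cases "z = 0") auto
  have eq_iff: "v z = 1 \<longleftrightarrow> w z = 1" for z using le_iff[of z] ge_iff[of z] by linarith
  have less_iff: "v z < 1 \<longleftrightarrow> w z < 1" for z using ge_iff[of z] by linarith
  have N: "v.N = w.N" unfolding residue_card_def le_iff less_iff ..
  obtain \<pi> where \<pi>: "\<pi> \<noteq> 0" "v \<pi> = real v.N powi (-1)" by (rule v.obtain_value)
  obtain \<rho> where \<rho>: "\<rho> \<noteq> 0" "w \<rho> = real w.N powi (-1)" by (rule w.obtain_value)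
  have less_1: "real v.N powi (-1) < 1" using v.N_gt_1 by (simp add: inverse_less_1_iff)
  obtain a where a: "w \<pi> = real v.N powi a" using w.obtain_exponent[OF \<pi>(1)] N by metis
  obtain b where b: "v \<rho> = real v.N powi b" using v.obtain_exponent[OF \<rho>(1)] by metis
  have neg: "k < 0" if "real v.N powi k < 1" for k
    using v.N_powi_le_iff[of 0 k] that by (simp add: not_le[symmetric])
  have "a < 0" using neg a less_iff[of \<pi>] less_1 \<pi>(2) by simp
  have "b < 0" using neg b less_iff[of \<rho>] less_1 \<rho>(2) N by simp
  have "v (\<pi> powi b * \<rho>) = 1"
    using v.N_gt_1 by (simp add: v.v_mult v.v_power_int \<pi>(2) b power_int_inverse)
  then have "w (\<pi> powi b * \<rho>) = 1" by (simp add: eq_iff)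
  then have "(real v.N powi a) powi b * real v.N powi (-1) = 1"
    by (simp add: w.v_mult w.v_power_int \<rho>(2) a N)
  moreover have "real v.N powi (a * b + -1) = (real v.N powi a) powi b * real v.N powi (-1)"
    using v.N_gt_1 by (subst power_int_add) (auto simp: power_int_mult)
  ultimately have "real v.N powi (a * b + -1) = real v.N powi 0" by simp
  then have "a * b = 1" unfolding v.N_powi_eq_iff by simp
  then have "a = -1" using \<open>a < 0\<close> by (auto simp: zmult_eq_1_iff)
  show ?thesis
  proof
    fix z
    show "v z = w z"
    proof (cases "z = 0")
      case False
      then obtain k where k: "v z = real v.N powi k" using v.obtain_exponent by blast
      have "v (z * \<pi> powi k) = 1"
        using v.N_gt_1 by (simp add: v.v_mult v.v_power_int \<pi>(2) k power_int_inverse)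
      then have "w (z * \<pi> powi k) = 1" by (simp add: eq_iff)
      then have "w z * real v.N powi (- k) = 1"
        by (simp add: w.v_mult w.v_power_int a \<open>a = -1\<close> power_int_inverse power_int_minus)
      then show ?thesis using v.N_gt_1 by (simp add: k power_int_minus field_simps)
    qed simp
  qed
qed

text \<open>The induction of Artin and Whaples: from \<open>z\<close> for \<open>T\<close> and
  \<open>y\<close> with v y > 1 > w y one passes to z^n y or, if w z > 1, to z^n / (1 + z^n) y, with
  n large.\<close>

lemma weak_approximation:
  fixes v :: "'a \<Rightarrow> real"
  assumes "finite T" "T \<subseteq> places" "v \<in> places" "v \<notin> T"
  shows "\<exists>z. v z > 1 \<and> (\<forall>w\<in>T. w z < 1)"
  using assms
proof (induction T)
  case empty
  interpret v: place v by (rule placeI) fact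
  obtain u where u: "u \<noteq> 0" "v u = real v.N powi 1" by (rule v.obtain_value)
  then show ?case using v.N_gt_1 by (intro exI[of _ u]) simp
next
  case (insert w T)
  then obtain z where z: "v z > 1" "\<forall>w\<in>T. w z < 1" by auto
  have w: "w \<in> places" "v \<noteq> w" using insert by auto
  interpret v: place v by (rule placeI) fact
  interpret w: place w by (rule placeI) fact
  obtain a where a: "w a \<le> 1" "v a > 1"
    using valuation_ring_determines_place[OF w(1) \<open>v \<in> places\<close>] w(2) by force
  obtain b where b: "v b \<le> 1" "w b > 1"
    using valuation_ring_determines_place[OF \<open>v \<in> places\<close> w(1)] w(2) by force
  have b0: "b \<noteq> 0" using b by auto
  define y where "y = a / b"
  have "v y * v b > 1" using a b0 by (simp add: y_def v.v_divide)
  moreover have "v y * v b \<le> v y * 1" by (intro mult_left_mono b) simp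
  ultimately have vy: "v y > 1" by simp
  have wy: "w y < 1" using a b by (simp add: y_def w.v_divide)
  have "eventually (\<lambda>n. u z ^ n * u y < 1) sequentially" if "u \<in> T" for u
  proof -
    interpret u: place u by (rule placeI) (use that insert in auto)
    have "(\<lambda>n. u z ^ n * u y) \<longlonglongrightarrow> 0"
      using z(2) that by (intro tendsto_mult_left_zero LIMSEQ_power_zero) auto
    then show ?thesis by (rule order_tendstoD) simp
  qed
  then have "eventually (\<lambda>n. \<forall>u\<in>T. u z ^ n * u y < 1) sequentially"
    using insert.hyps by (simp add: eventually_ball_finite_distrib)
  then have "eventually (\<lambda>n. n \<ge> 1 \<and> (\<forall>u\<in>T. u z ^ n * u y < 1)) sequentially"
    by (intro eventually_conj eventually_ge_at_top)
  then obtain n where n: "n \<ge> 1" "\<And>u. u \<in> T \<Longrightarrow> u z ^ n * u y < 1"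
    by (auto dest!: eventually_happens)
  have vzn: "v z ^ n > 1" using z(1) n(1) by simp
  show ?case
  proof (cases "w z \<le> 1")
    case True
    have "v (z ^ n * y) > 1" using vzn vy by (simp add: v.v_mult v.v_power less_1_mult)
    moreover have "u (z ^ n * y) < 1" if "u \<in> T" for u
    proof -
      interpret u: place u by (rule placeI) (use that insert in auto)
      show ?thesis using n(2)[OF that] by (simp add: u.v_mult u.v_power)
    qed
    moreover have "w (z ^ n * y) < 1"
    proof -
      have "w z ^ n * w y \<le> 1 * w y" using True by (intro mult_right_mono power_le_one) auto
      then show ?thesis using wy by (simp add: w.v_mult w.v_power)
    qed
    ultimately show ?thesis by blast
  next
    case False
    \<comment> \<open>The factor \<open>z ^ n / (1 + z ^ n)\<close> has value 1 at \<open>v\<close>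
      and \<open>w\<close>, where z has value > 1, and value \<open>u z ^ n\<close> at each u in
      \<open>T\<close>.\<close>
    define x where "x = z ^ n / (1 + z ^ n) * y"
    have z0: "z \<noteq> 0" using z(1) by auto
    have big: "u (1 + z ^ n) = u z ^ n" if "place u" "u z > 1" for u
    proof -
      interpret u: place u by fact
      have "u (z ^ n) > u 1" using that n(1) by (simp add: u.v_power)
      then have "u (z ^ n + 1) = u (z ^ n)" by (rule u.v_add_eq)
      then show ?thesis by (simp add: u.v_power add.commute)
    qed
    have "v x = v y" using big[OF v.place_axioms z(1)] z0 by (simp add: x_def v.v_mult v.v_divide v.v_power)
    moreover have "w z ^ n > 1" using False n(1) by simp
    then have "w x = w y" using big[OF w.place_axioms] False z0
      by (simp add: x_def w.v_mult w.v_divide w.v_power)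
    moreover have "u x < 1" if "u \<in> T" for u
    proof -
      interpret u: place u by (rule placeI) (use that insert in auto)
      have "u (z ^ n) < u 1" using z(2) that n(1) by (simp add: u.v_power power_less_one_iff)
      then have "u (1 + z ^ n) = 1" using u.v_add_eq[of "z ^ n" 1] by simp
      then show ?thesis using n(2)[OF that] by (simp add: x_def u.v_mult u.v_divide u.v_power)
    qed
    ultimately have "v x > 1 \<and> (\<forall>u\<in>insert w T. u x < 1)" using vy wy by simp
    then show ?thesis by (rule exI)
  qed
qed

text \<open>Take \<open>m\<close> from \<open>bounded_rank\<close> for y = 1/x. At \<open>m\<close>
  distinct poles of \<open>x\<close>, weak approximation yields \<open>z j\<close> of value 1 at the
  j-th pole and less than 1 at the others. In a relation over the ring of elements integral at these
  poles, the i-th pole with \<open>a i \<noteq> 0\<close> sees one term of value 1 and only smaller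
  ones besides, so the sum is not 0.\<close>

lemma finite_poles: "finite {v \<in> places. v (x :: 'a) > 1}"
proof (cases "x = 0")
  case True
  have "v x = 0" if "v \<in> places" for v using place.v_0[OF placeI[OF that]] True by simp
  then show ?thesis by (metis (mono_tags, lifting) Collect_empty_eq finite.emptyI not_one_less_zero)
next
  case x0: False
  define y where "y = inverse x"
  have y0: "y \<noteq> 0" using x0 by (simp add: y_def)
  obtain m where m: "\<forall>(z :: nat \<Rightarrow> 'a) R. is_subring R \<longrightarrow> y \<in> R \<longrightarrow>
    (\<exists>a b. (\<forall>j. a j \<in> {-1, 0, 1}) \<and> (\<forall>j. b j \<in> R) \<and> (\<exists>j<m. a j \<noteq> 0) \<and>
      (\<Sum>j<m. (a j + y * b j) * z j) = 0)"
    using bounded_rank[OF y0] by (rule exE)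
  show ?thesis
  proof (rule ccontr)
    assume "infinite {v \<in> places. v x > 1}"
    from infinite_arbitrarily_large[OF this, of m]
    obtain T where T: "T \<subseteq> {v \<in> places. v x > 1}" "finite T" "card T = m" by blast
    obtain f where f: "bij_betw f {..<m} T"
      using ex_bij_betw_nat_finite[OF T(2)] T(3) by (auto simp: atLeast0LessThan)
    have fT: "f j \<in> T" if "j < m" for j using bij_betwE[OF f] that by auto
    have pl: "place (f j)" if "j < m" for j using fT[OF that] T(1) by (intro placeI) auto
    have "\<exists>z. f j z = 1 \<and> (\<forall>i<m. i \<noteq> j \<longrightarrow> f i z < 1)" if j: "j < m" for j
    proof -
      have "\<exists>z. f j z > 1 \<and> (\<forall>w\<in>T - {f j}. w z < 1)"
        using T fT[OF j] by (intro weak_approximation) auto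
      then obtain z where z: "f j z > 1" "\<And>w. w \<in> T - {f j} \<Longrightarrow> w z < 1" by blast
      \<comment> \<open>Passing to \<open>z / (1 + z)\<close> turns the value > 1 at the j-th pole
        into exactly 1 and keeps the values < 1 at the others.\<close>
      have "f j (z / (1 + z)) = 1"
      proof -
        interpret u: place "f j" by (rule pl[OF j])
        have "f j (z + 1) = f j z" using z(1) by (intro u.v_add_eq) simp
        moreover have "f j z \<noteq> 0" using z(1) by linarith
        ultimately show ?thesis by (simp add: u.v_divide add.commute)
      qed
      moreover have "f i (z / (1 + z)) < 1" if i: "i < m" "i \<noteq> j" for i
      proof -
        interpret u: place "f i" by (rule pl[OF i(1)])
        have "f i \<noteq> f j" using f i j by (auto simp: bij_betw_def inj_on_def)
        then have "f i z < 1" using z(2) fT i by blast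
        then have "f i (1 + z) = 1" using u.v_add_eq[of z 1] by simp
        then show ?thesis using \<open>f i z < 1\<close> by (simp add: u.v_divide)
      qed
      ultimately show ?thesis by blast
    qed
    then obtain z where z: "\<And>j. j < m \<Longrightarrow> f j (z j) = 1"
      "\<And>i j. i < m \<Longrightarrow> j < m \<Longrightarrow> i \<noteq> j \<Longrightarrow> f i (z j) < 1" by metis
    define R where "R = {u. \<forall>j<m. f j u \<le> 1}"
    have "is_subring R"
      unfolding is_subring_def
    proof (intro conjI ballI)
      show "1 \<in> R" unfolding R_def using is_subringD(1)[OF place.v_bounded_subring[OF pl]] by auto
      fix u w assume "u \<in> R" "w \<in> R"
      then show "u - w \<in> R" "u * w \<in> R"
        unfolding R_def using is_subringD(3,4)[OF place.v_bounded_subring[OF pl], of _ u w] by auto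
    qed
    moreover have vy: "f j y < 1" if "j < m" for j
    proof -
      interpret u: place "f j" by (rule pl[OF that])
      have "f j x > 1" using fT[OF that] T(1) by auto
      then show ?thesis by (simp add: y_def u.v_inverse inverse_less_1_iff)
    qed
    moreover have "y \<in> R" unfolding R_def using vy by (auto intro: less_imp_le)
    ultimately obtain a b where ab: "\<forall>j. a j \<in> {-1, 0, 1}" "\<forall>j. b j \<in> R" "\<exists>j<m. a j \<noteq> 0"
      "(\<Sum>j<m. (a j + y * b j) * z j) = 0" using m[rule_format, of R z] by blast
    obtain i where i: "i < m" "a i \<noteq> 0" using ab(3) by blast
    interpret u: place "f i" by (rule pl[OF i(1)])
    have a_le: "f i (a j) \<le> 1" for j using ab(1)[rule_format, of j] by auto
    have yb: "f i (y * b j) < 1" for j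
    proof -
      have "f i y * f i (b j) \<le> f i y * 1"
        using ab(2)[rule_format, of j] i(1) by (intro mult_left_mono) (auto simp: R_def)
      then show ?thesis using vy[OF i(1)] by (simp add: u.v_mult)
    qed
    have "f i (a i) = 1" using ab(1)[rule_format, of i] i(2) by auto
    then have "f i (a i + y * b i) = 1" using yb[of i] by (subst u.v_add_eq) auto
    then have top: "f i ((a i + y * b i) * z i) = 1" using z(1)[OF i(1)] by (simp add: u.v_mult)
    have "f i (\<Sum>j\<in>{..<m} - {i}. (a j + y * b j) * z j) < 1"
    proof (rule u.v_sum_less)
      fix j assume j: "j \<in> {..<m} - {i}"
      have "f i (a j + y * b j) \<le> 1" using u.v_add[of "a j" "y * b j"] a_le[of j] yb[of j] by linarith
      then have "f i (a j + y * b j) * f i (z j) \<le> 1 * f i (z j)" by (intro mult_right_mono) auto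
      then show "f i ((a j + y * b j) * z j) < 1" using z(2)[of i j] i j by (simp add: u.v_mult)
    qed simp
    then have "f i (\<Sum>j<m. (a j + y * b j) * z j) = 1"
      using i(1) top u.v_add_eq by (simp add: sum.remove[of "{..<m}" i])
    then show False using ab(4) by simp
  qed
qed

section \<open>Elements without poles\<close>

lemma t_not_root_of_unity: "n > 0 \<Longrightarrow> \<psi> [:0, 1:] ^ n \<noteq> 1"
proof
  assume n: "n > 0" "\<psi> [:0, 1:] ^ n = 1"
  then have "\<psi> ([:0, 1:] ^ n - 1) = 0" by (simp add: psi_hom psi_power)
  then have "[:0, 1 :: 'k:] ^ n = 1" by simp
  then have "degree ([:0, 1 :: 'k:] ^ n) = 0" by simp
  then show False using n by (simp add: degree_power_eq)
qed

lemma ex_place_t_gt_1: "\<exists>v\<in>places. v (\<psi> [:0, 1:]) > 1"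
  by (rule ex_place_gt_1) (use t_not_root_of_unity in auto)

text \<open>Two such elements with the same residue at one place \<open>v\<close> differ by an
  element of value < 1 at \<open>v\<close>. If nonzero, it is a root of unity by
  \<open>ex_place_gt_1\<close>, so its value is 1. Hence the residue at \<open>v\<close> is
  injective on this set.\<close>

lemma finite_constants: "finite {x :: 'a. \<forall>v\<in>places. v x \<le> 1}"
proof -
  let ?L = "{x :: 'a. \<forall>v\<in>places. v x \<le> 1}"
  obtain v :: "'a \<Rightarrow> real" where v: "v \<in> places" using ex_place_t_gt_1 by blast
  interpret v: place v by (rule placeI) fact
  obtain R where R: "finite R" "\<forall>x. v x \<le> 1 \<longrightarrow> (\<exists>r\<in>R. v (x - r) < 1)"
    using v.finite_residues by blast
  have "\<exists>g. \<forall>x. v x \<le> 1 \<longrightarrow> g x \<in> R \<and> v (x - g x) < 1" using R(2) by metis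
  then obtain g where g: "\<And>x. v x \<le> 1 \<Longrightarrow> g x \<in> R" "\<And>x. v x \<le> 1 \<Longrightarrow> v (x - g x) < 1" by blast
  have "inj_on g ?L"
  proof (rule inj_onI)
    fix x y assume xy: "x \<in> ?L" "y \<in> ?L" "g x = g y"
    then have "v x \<le> 1" "v y \<le> 1" using v by auto
    then have "v ((x - g x) - (y - g y)) < 1"
      using v.v_diff[of "x - g x" "y - g y"] g(2)[of x] g(2)[of y] by linarith
    then have less: "v (x - y) < 1" using xy(3) by simp
    have all: "w (x - y) \<le> 1" if "w \<in> places" for w
      using place.v_diff[OF placeI[OF that], of x y] xy(1,2) that by fastforce
    show "x = y"
    proof (rule ccontr)
      assume "x \<noteq> y"
      then have "\<exists>n>0. (x - y) ^ n = 1"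
        using ex_place_gt_1[of "x - y"] all by force
      then obtain n where n: "n > 0" "(x - y) ^ n = 1" by blast
      then have "v (x - y) ^ n = 1" by (simp flip: v.v_power)
      moreover have "v (x - y) ^ n < 1" using less n(1) by (simp add: power_less_one_iff)
      ultimately show False by simp
    qed
  qed
  moreover have "finite (g ` ?L)" by (rule finite_subset[OF _ R(1)]) (use g(1) v in auto)
  ultimately show ?thesis using finite_imageD by blast
qed

end

section \<open>Integral elements, units and Frobenius powers\<close>

context place
begin

lemma v_less_N_powi:
  assumes "v x < real N powi (k + 1)" shows "v x \<le> real N powi k"
proof (cases "x = 0")
  case False
  then obtain l where l: "v x = real N powi l" by (rule obtain_exponent)
  then have "\<not> k + 1 \<le> l" using assms N_powi_le_iff[of "k + 1" l] by linarith
  then show ?thesis using l N_powi_le_iff[of l k] by simp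
qed simp

text \<open>The nonzero summands have pairwise distinct absolute values, as their exponents are distinct
  modulo \<open>p\<close>.\<close>

lemma v_frobenius_sum_ge:
  fixes f :: "nat \<Rightarrow> 'a"
  defines "p \<equiv> CHAR('a)"
  assumes \<pi>: "\<pi> \<noteq> 0" "v \<pi> = inverse (real N)" and i: "i < p"
  shows "v (f i ^ p * \<pi> ^ i) \<le> v (\<Sum>k<p. f k ^ p * \<pi> ^ k)"
proof (cases "f i = 0")
  case False
  have p: "p > 0" using prime_char prime_gt_0_nat p_def by blast
  define g where "g k = f k ^ p * \<pi> ^ k" for k
  have "Max ((\<lambda>k. v (g k)) ` {..<p}) \<in> (\<lambda>k. v (g k)) ` {..<p}" using p by (intro Max_in) auto
  then obtain m where m: "m < p" "v (g m) = Max ((\<lambda>k. v (g k)) ` {..<p})" by auto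
  have le: "v (g k) \<le> v (g m)" if "k < p" for k using that m by simp
  have pos: "v (g m) > 0" using le[OF i] v_pos[of "g i"] False \<pi>(1) by (simp add: g_def)
  then have fm: "f m \<noteq> 0" using p by (auto simp: g_def power_0_left)
  have exponent: "\<exists>a. v (g k) = real N powi (int p * a - int k)" if fk: "f k \<noteq> 0" for k
  proof -
    obtain a where a: "v (f k) = real N powi a" using fk by (rule obtain_exponent)
    have "v (g k) = (real N powi a) ^ p * inverse (real N) ^ k" by (simp add: g_def v_mult v_power a \<pi>(2))
    also have "\<dots> = real N powi (int p * a) / real N powi (int k)"
      by (simp add: power_inverse divide_inverse power_int_mult power_int_inverse mult.commute flip: power_int_of_nat)
    also have "\<dots> = real N powi (int p * a - int k)" using N_gt_1 by (simp add: power_int_diff)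
    finally show ?thesis by blast
  qed
  have less: "v (g k) < v (g m)" if k: "k < p" "k \<noteq> m" for k
  proof (cases "f k = 0")
    case True
    then show ?thesis using pos p by (simp add: g_def power_0_left)
  next
    case fk: False
    obtain a where a: "v (g k) = real N powi (int p * a - int k)" using exponent[OF fk] by blast
    obtain b where b: "v (g m) = real N powi (int p * b - int m)" using exponent[OF fm] by blast
    have "v (g k) \<noteq> v (g m)"
    proof
      assume "v (g k) = v (g m)"
      then have "int p * a - int k = int p * b - int m" using a b N_powi_eq_iff by simp
      then have "int k = int m + int p * (a - b)" by (simp add: algebra_simps)
      then have "int k mod int p = int m mod int p" by simp
      then show False using k m(1) by simp
    qed
    then show ?thesis using le[OF k(1)] by simp
  qed
  have "v (\<Sum>k\<in>{..<p} - {m}. g k) < v (g m)" by (rule v_sum_less) (use less pos in auto)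
  then have "v (\<Sum>k<p. g k) = v (g m)"
    using m(1) v_add_eq by (simp add: sum.remove[of "{..<p}" m])
  then show ?thesis using le[OF i] by (simp add: g_def)
qed (use i in \<open>simp add: power_0_left\<close>)

end

context function_field
begin

text \<open>Finiteness of Riemann-Roch spaces, by induction on \<open>T\<close> and, at the new
  place \<open>v\<close>, on the exponent k in v x <= N^k: elements with the same residue of
  \<pi>^(k+1) x differ by one with exponent k, and there are finitely many residues.\<close>

lemma finite_bounded:
  fixes C :: real
  assumes "finite T" "T \<subseteq> places"
  shows "finite {x :: 'a. (\<forall>v\<in>places - T. v x \<le> 1) \<and> (\<forall>v\<in>T. v x \<le> C)}"
  using assms
proof (induction T)
  case empty
  then show ?case using finite_constants by simp
next
  case (insert v T)
  have v: "v \<in> places" using insert by simp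
  interpret v: place v by (rule placeI) (rule v)
  obtain \<pi> where \<pi>: "\<pi> \<noteq> 0" "v \<pi> = inverse (real v.N)" by (rule v.obtain_uniformizer)
  obtain R where R: "finite R" "\<forall>x. v x \<le> 1 \<longrightarrow> (\<exists>r\<in>R. v (x - r) < 1)"
    using v.finite_residues by blast
  define G where "G k = {x :: 'a. (\<forall>w\<in>places - insert v T. w x \<le> 1) \<and> (\<forall>w\<in>T. w x \<le> C) \<and> v x \<le> real v.N ^ k}" for k
  have "finite (G k)" for k
  proof (induction k)
    case 0
    show ?case
      by (rule finite_subset[OF _ insert.IH]) (use insert.prems in \<open>auto simp: G_def\<close>)
  next
    case (Suc k)
    define P where "P r = {x \<in> G (Suc k). v (\<pi> ^ Suc k * x - r) < 1}" for r
    have "finite (P r)" for r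
    proof (cases "P r = {}")
      case False
      then obtain x0 where x0: "x0 \<in> P r" by blast
      have "P r \<subseteq> (\<lambda>y. x0 + y) ` G k"
      proof
        fix x assume x: "x \<in> P r"
        have "v ((\<pi> ^ Suc k * x - r) - (\<pi> ^ Suc k * x0 - r)) < 1"
          using v.v_diff[of "\<pi> ^ Suc k * x - r" "\<pi> ^ Suc k * x0 - r"] x x0 by (auto simp: P_def)
        also have "(\<pi> ^ Suc k * x - r) - (\<pi> ^ Suc k * x0 - r) = \<pi> ^ Suc k * (x - x0)"
          by (simp add: right_diff_distrib)
        finally have "v (x - x0) < real v.N ^ Suc k"
          using v.N_gt_1 by (simp only: v.v_mult v.v_power \<pi>(2)) (simp add: power_inverse field_simps)
        also have "real v.N ^ Suc k = real v.N powi (int k + 1)"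
          using power_int_of_nat[of "real v.N" "Suc k"] by (simp only: of_nat_Suc add.commute)
        finally have "v (x - x0) \<le> real v.N powi int k" by (rule v.v_less_N_powi)
        moreover have "w (x - x0) \<le> 1" if "w \<in> places - insert v T" for w
          by (rule order_trans[OF place.v_diff[OF placeI]]) (use that x x0 in \<open>auto simp: P_def G_def\<close>)
        moreover have "w (x - x0) \<le> C" if "w \<in> T" for w
          by (rule order_trans[OF place.v_diff[OF placeI]])
            (use that x x0 insert.prems in \<open>auto simp: P_def G_def\<close>)
        ultimately have "x - x0 \<in> G k" by (simp add: G_def)
        then show "x \<in> (\<lambda>y. x0 + y) ` G k" by (rule rev_image_eqI) simp
      qed
      then show ?thesis using Suc finite_subset by blast
    qed simp
    moreover have "G (Suc k) \<subseteq> (\<Union>r\<in>R. P r)"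
    proof
      fix x assume x: "x \<in> G (Suc k)"
      have "v (\<pi> ^ Suc k * x) \<le> 1"
        using x v.N_gt_1 by (simp only: v.v_mult v.v_power \<pi>(2) G_def) (simp add: power_inverse field_simps)
      then show "x \<in> (\<Union>r\<in>R. P r)" using R(2) x by (auto simp: P_def)
    qed
    ultimately show ?case using R(1) by (meson finite_UN finite_subset)
  qed
  moreover obtain k where "C < real v.N ^ k" using real_arch_pow[OF v.N_gt_1] by blast
  then have "{x :: 'a. (\<forall>w\<in>places - insert v T. w x \<le> 1) \<and> (\<forall>w\<in>insert v T. w x \<le> C)} \<subseteq> G k"
    by (auto simp: G_def)
  ultimately show ?case using finite_subset by blast
qed

section \<open>Units outside a finite set of places, modulo powers\<close>

definition S_units :: "('a \<Rightarrow> real) set \<Rightarrow> 'a set" where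
  "S_units T = {u. u \<noteq> 0 \<and> (\<forall>v\<in>places - T. v u = 1)}"

text \<open>The values of the units at the new place \<open>v\<close> form a cyclic group. If it is
  nontrivial, a unit \<open>u1\<close> whose value generates it splits every unit into a power of
  \<open>u1\<close> and a unit for \<open>T\<close>; the exponent of \<open>u1\<close> matters only
  modulo \<open>n\<close>.\<close>

lemma S_units_finite_classes:
  assumes "finite T" "T \<subseteq> places" "n > 0"
  shows "\<exists>E. finite E \<and> 0 \<notin> E \<and> (\<forall>u\<in>S_units T. \<exists>e\<in>E. \<exists>w. u = e * w ^ n)"
  using assms(1,2)
proof (induction T)
  case empty
  have "finite (S_units {})"
    by (rule finite_subset[OF _ finite_constants]) (auto simp: S_units_def)
  moreover have "u = u * 1 ^ n" for u :: 'a by simp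
  moreover have "0 \<notin> S_units {}" by (simp add: S_units_def)
  ultimately show ?case by blast
next
  case (insert v T)
  obtain E where E: "finite E" "0 \<notin> E" "\<And>u. u \<in> S_units T \<Longrightarrow> \<exists>e\<in>E. \<exists>w. u = e * w ^ n"
    using insert by auto
  have v: "v \<in> places" using insert by simp
  interpret v: place v by (rule placeI) (rule v)
  let ?U = "S_units (insert v T)"
  have restrict: "u \<in> S_units T" if "u \<in> ?U" "v u = 1" for u
    using that by (auto simp: S_units_def)
  have closed: "u * w powi k \<in> ?U" if "u \<in> ?U" "w \<in> ?U" for u w k
  proof -
    have "v' (u * w powi k) = 1" if v': "v' \<in> places - insert v T" for v'
    proof -
      interpret v': place v' by (rule placeI) (use v' in simp)
      have "v' u = 1" "v' w = 1" using \<open>u \<in> ?U\<close> \<open>w \<in> ?U\<close> v' by (auto simp: S_units_def)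
      then show ?thesis by (simp add: v'.v_mult v'.v_power_int)
    qed
    then show ?thesis using that by (auto simp: S_units_def)
  qed
  show ?case
  proof (cases "\<forall>u\<in>?U. v u = 1")
    case True
    then show ?thesis by (intro exI[of _ E] conjI ballI E restrict) simp_all
  next
    case False
    then obtain u0 where u0: "u0 \<in> ?U" "v u0 \<noteq> 1" by blast
    then have "u0 \<noteq> 0" by (simp add: S_units_def)
    then obtain k0 where k0: "v u0 = real v.N powi k0" by (rule v.obtain_exponent)
    have one: "1 \<in> ?U" by (simp add: S_units_def place.v_1[OF placeI])
    \<comment> \<open>The positive exponents of values of units; the least one yields the generator
      of the value group.\<close>
    define Q where "Q k \<longleftrightarrow> k > 0 \<and> (\<exists>u\<in>?U. v u = real v.N powi int k)" for k :: nat
    have "k0 \<noteq> 0" using u0(2) k0 by auto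
    have "\<exists>k. Q k"
    proof (cases "k0 > 0")
      case True
      then show ?thesis using u0(1) k0 by (intro exI[of _ "nat k0"]) (auto simp: Q_def)
    next
      case False
      have "1 * u0 powi (-1) \<in> ?U" by (rule closed[OF one u0(1)])
      moreover have "v (1 * u0 powi (-1)) = real v.N powi (int (nat (- k0)))"
        using False by (simp add: v.v_inverse k0 power_int_minus)
      ultimately show ?thesis using False \<open>k0 \<noteq> 0\<close> by (intro exI[of _ "nat (- k0)"]) (auto simp: Q_def)
    qed
    define k where "k = (LEAST k. Q k)"
    have "Q k" unfolding k_def by (rule LeastI_ex[OF \<open>\<exists>k. Q k\<close>])
    then obtain u1 where u1: "u1 \<in> ?U" "v u1 = real v.N powi int k" and k: "k > 0" by (auto simp: Q_def)
    have u1_0: "u1 \<noteq> 0" using u1 by (auto simp: S_units_def)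
    define E' where "E' = (\<lambda>(r, e). u1 ^ r * e) ` ({..<n} \<times> E)"
    have "\<exists>e\<in>E'. \<exists>w. u = e * w ^ n" if u: "u \<in> ?U" for u
    proof -
      have "u \<noteq> 0" using u by (simp add: S_units_def)
      then obtain l where l: "v u = real v.N powi l" by (rule v.obtain_exponent)
      define d where "d = l div int k"
      define u' where "u' = u * u1 powi (- d)"
      have u': "u' \<in> ?U" unfolding u'_def by (rule closed[OF u u1(1)])
      have "real v.N powi (l + int k * (- d)) = real v.N powi l * real v.N powi (int k * (- d))"
        by (rule power_int_add) (use v.N_gt_1 in simp)
      then have "v u' = real v.N powi (l + int k * (- d))"
        by (simp only: u'_def v.v_mult v.v_power_int l u1(2) power_int_mult)
      also have "l + int k * (- d) = l mod int k"
        by (simp add: d_def minus_mult_div_eq_mod)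
      finally have vu': "v u' = real v.N powi (int (nat (l mod int k)))" using k by simp
      \<comment> \<open>The remainder is an exponent attained by the unit \<open>u'\<close> and
        smaller than the least positive one, so it is 0.\<close>
      have "\<not> Q (nat (l mod int k))"
        by (rule not_less_Least) (use k in \<open>simp add: k_def[symmetric] nat_less_iff\<close>)
      then have "nat (l mod int k) = 0" using u' vu' unfolding Q_def by (metis gr0I)
      then have "v u' = 1" using vu' by simp
      then obtain e w where e: "e \<in> E" "u' = e * w ^ n" using E(3)[OF restrict[OF u']] by blast
      define r where "r = nat (d mod int n)"
      have r: "r < n" using assms(3) by (simp add: r_def nat_less_iff)
      have dr: "d = int r + (d div int n) * int n" using assms(3) by (simp add: r_def)
      have "u1 powi d = u1 ^ r * (u1 powi (d div int n)) ^ n"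
        by (subst dr) (use u1_0 in \<open>simp add: power_int_add power_int_mult\<close>)
      moreover have "u = u1 powi d * u'" using u1_0 by (simp add: u'_def power_int_minus)
      ultimately have "u = (u1 ^ r * e) * (u1 powi (d div int n) * w) ^ n"
        using e(2) by (simp add: power_mult_distrib mult_ac)
      moreover have "u1 ^ r * e \<in> E'" unfolding E'_def using r e(1) by (intro image_eqI[of _ _ "(r, e)"]) auto
      ultimately show ?thesis by blast
    qed
    moreover have "finite E'" "0 \<notin> E'" using E(1,2) u1_0 by (auto simp: E'_def)
    ultimately show ?thesis by (intro exI[of _ E'] conjI ballI)
  qed
qed

text \<open>By \<open>frobenius_rank\<close>, \<open>x\<close> and the p powers 1, \<pi>, ...,
  \<pi>^(p-1) are dependent over K^p. The coefficient of \<open>x\<close> is nonzero, since by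
  \<open>v_frobenius_sum_ge\<close> the powers of \<pi> alone admit no nontrivial relation.\<close>

lemma frobenius_expansion:
  fixes x :: 'a
  assumes "v \<in> places" "\<pi> \<noteq> 0" "v \<pi> = inverse (real (residue_card v))"
  shows "\<exists>f. x = (\<Sum>k<CHAR('a). f k ^ CHAR('a) * \<pi> ^ k)"
proof -
  interpret v: place v by (rule placeI) fact
  let ?p = "CHAR('a)"
  have p: "?p > 0" using prime_char prime_gt_0_nat by blast
  obtain w where w: "\<exists>k\<le>?p. w k \<noteq> 0" "(\<Sum>k\<le>?p. w k ^ ?p * (if k < ?p then \<pi> ^ k else x)) = 0"
    using frobenius_rank[of "\<lambda>k. if k < ?p then \<pi> ^ k else x"] by blast
  have "(\<Sum>k\<le>?p. w k ^ ?p * (if k < ?p then \<pi> ^ k else x)) = (\<Sum>k<?p. w k ^ ?p * \<pi> ^ k) + w ?p ^ ?p * x"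
    unfolding lessThan_Suc_atMost[symmetric] sum.lessThan_Suc by simp
  then have eq: "(\<Sum>k<?p. w k ^ ?p * \<pi> ^ k) + w ?p ^ ?p * x = 0" using w(2) by simp
  have "w ?p \<noteq> 0"
  proof
    assume 0: "w ?p = 0"
    then have z: "(\<Sum>k<?p. w k ^ ?p * \<pi> ^ k) = 0" using eq p by (simp add: power_0_left)
    have "w k = 0" if "k < ?p" for k
    proof -
      have "v (w k ^ ?p * \<pi> ^ k) \<le> 0" using v.v_frobenius_sum_ge[OF assms(2,3) that, of w] z by simp
      then have "v (w k ^ ?p * \<pi> ^ k) = 0" using v.v_nonneg order_antisym by blast
      then show ?thesis using assms(2) p by simp
    qed
    then show False using w(1) 0 by (metis le_neq_implies_less)
  qed
  have neg: "(- a :: 'a) ^ ?p = - (a ^ ?p)" for a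
    using frob_diff[of 0 a 1] p by (simp add: power_0_left)
  have "w ?p ^ ?p * x = - (\<Sum>k<?p. w k ^ ?p * \<pi> ^ k)" using eq by (simp add: eq_neg_iff_add_eq_0 add.commute)
  then have "x = - (\<Sum>k<?p. w k ^ ?p * \<pi> ^ k) / w ?p ^ ?p" using \<open>w ?p \<noteq> 0\<close> by (simp add: field_simps)
  also have "\<dots> = (\<Sum>k<?p. (- (w k / w ?p)) ^ ?p * \<pi> ^ k)"
    by (simp add: neg sum_divide_distrib sum_negf power_divide)
  finally show ?thesis by (rule exI[of _ "\<lambda>k. - (w k / w ?p)"])
qed

text \<open>Subtracting a p-th power changes only the term at \<pi>^0 in the expansion of
  \<open>c\<close>; if \<open>c\<close> is not a p-th power, another term is nonzero and bounds the
  distance from below. If c = d^p, taking p-th roots reduces the claim to d and the previous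
  \<open>m\<close>.\<close>

lemma frobenius_image_closed:
  fixes c :: 'a
  assumes "v \<in> places" "c \<notin> range (\<lambda>w. w ^ (CHAR('a) ^ m))"
  shows "\<exists>\<epsilon>>0. \<forall>w. v (c - w ^ (CHAR('a) ^ m)) \<ge> \<epsilon>"
  using assms(2)
proof (induction m arbitrary: c)
  case 0
  then show ?case by simp
next
  case (Suc m)
  interpret v: place v by (rule placeI) fact
  let ?p = "CHAR('a)"
  have p: "?p > 0" using prime_char prime_gt_0_nat by blast
  have pw: "w ^ ?p ^ Suc m = (w ^ ?p ^ m) ^ ?p" for w :: 'a by (simp add: mult.commute flip: power_mult)
  show ?case
  proof (cases "\<exists>d. c = d ^ ?p")
    case True
    then obtain d where d: "c = d ^ ?p" by blast
    have "d \<notin> range (\<lambda>w. w ^ ?p ^ m)" using Suc.prems unfolding d pw by auto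
    then obtain \<epsilon> where \<epsilon>: "\<epsilon> > 0" "\<And>w. v (d - w ^ ?p ^ m) \<ge> \<epsilon>" using Suc.IH by blast
    have "v (c - w ^ ?p ^ Suc m) \<ge> \<epsilon> ^ ?p" for w
    proof -
      have "c - w ^ ?p ^ Suc m = (d - w ^ ?p ^ m) ^ ?p"
        unfolding d pw using frob_diff[of d _ 1] by simp
      then show ?thesis using \<epsilon> by (simp add: v.v_power power_mono)
    qed
    then show ?thesis using \<epsilon>(1) by (intro exI[of _ "\<epsilon> ^ ?p"]) auto
  next
    case False
    obtain \<pi> where \<pi>: "\<pi> \<noteq> 0" "v \<pi> = inverse (real v.N)" by (rule v.obtain_uniformizer)
    obtain f where f: "c = (\<Sum>k<?p. f k ^ ?p * \<pi> ^ k)" using frobenius_expansion[OF assms(1) \<pi>] by blast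
    have split: "(\<Sum>k<?p. g k ^ ?p * \<pi> ^ k) = g 0 ^ ?p + (\<Sum>k\<in>{..<?p} - {0}. g k ^ ?p * \<pi> ^ k)" for g
      using p by (subst sum.remove[of _ 0]) auto
    have "\<exists>i<?p. i \<noteq> 0 \<and> f i \<noteq> 0"
    proof (rule ccontr)
      assume "\<not> ?thesis"
      then have "(\<Sum>k\<in>{..<?p} - {0}. f k ^ ?p * \<pi> ^ k) = 0"
        using p by (intro sum.neutral) (auto simp: power_0_left)
      then have "c = f 0 ^ ?p" unfolding f split by simp
      then show False using False by blast
    qed
    then obtain i where i: "i < ?p" "i \<noteq> 0" "f i \<noteq> 0" by blast
    have "v (c - w ^ ?p ^ Suc m) \<ge> v (f i ^ ?p * \<pi> ^ i)" for w
    proof -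
      let ?g = "f(0 := f 0 - w ^ ?p ^ m)"
      have "(f 0 - w ^ ?p ^ m) ^ ?p = f 0 ^ ?p - w ^ ?p ^ Suc m"
        unfolding pw using frob_diff[of "f 0" _ 1] by simp
      then have "c - w ^ ?p ^ Suc m = (\<Sum>k<?p. ?g k ^ ?p * \<pi> ^ k)"
        unfolding f split by simp
      then show ?thesis using v.v_frobenius_sum_ge[OF \<pi> i(1), of ?g] i(2) by simp
    qed
    then show ?thesis using i(3) \<pi>(1) by (intro exI[of _ "v (f i ^ ?p * \<pi> ^ i)"]) (auto intro: v.v_pos)
  qed
qed

end

section \<open>Additive polynomials with values in a class of Frobenius powers\<close>

lemma coeff_twisted_mult:
  assumes "q > 0"
  shows "coeff (twisted_mult q f g) i = (\<Sum>l\<le>i. coeff f l * coeff g (i - l) ^ (q ^ l))"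
proof -
  have inner: "(\<Sum>j\<le>degree g. coeff (monom (coeff f l * coeff g j ^ (q ^ l)) (l + j)) i) =
      (if l \<le> i then coeff f l * coeff g (i - l) ^ (q ^ l) else 0)" for l
  proof -
    have "(\<Sum>j\<le>degree g. coeff (monom (coeff f l * coeff g j ^ (q ^ l)) (l + j)) i) =
        (\<Sum>j\<le>degree g. if j = i - l then (if l \<le> i then coeff f l * coeff g (i - l) ^ (q ^ l) else 0) else 0)"
      by (rule sum.cong) auto
    also have "\<dots> = (if l \<le> i then coeff f l * coeff g (i - l) ^ (q ^ l) else 0)"
      using assms by (auto simp: coeff_eq_0 power_0_left)
    finally show ?thesis .
  qed
  have "coeff (twisted_mult q f g) i =
      (\<Sum>l\<le>degree f. if l \<le> i then coeff f l * coeff g (i - l) ^ (q ^ l) else 0)"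
    by (simp only: twisted_mult_def coeff_sum inner)
  also have "\<dots> = (\<Sum>l\<le>max i (degree f). if l \<le> i then coeff f l * coeff g (i - l) ^ (q ^ l) else 0)"
    by (rule sum.mono_neutral_left) (auto simp: coeff_eq_0)
  also have "\<dots> = (\<Sum>l\<le>i. coeff f l * coeff g (i - l) ^ (q ^ l))"
    by (rule sum.mono_neutral_cong_right) auto
  finally show ?thesis .
qed

lemma (in place) v_twisted_eval_le_1:
  assumes "\<And>i. i \<le> degree f \<Longrightarrow> v (coeff f i) \<le> 1" "v x \<le> 1"
  shows "v (twisted_eval q f x) \<le> 1"
  unfolding twisted_eval_def
  by (rule v_sum_le) (auto simp: v_mult v_power assms intro!: mult_le_one power_le_one)

definition coeffs_in :: "'a::field set \<Rightarrow> 'a poly \<Rightarrow> bool" where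
  "coeffs_in R f \<longleftrightarrow> (\<forall>i. coeff f i \<in> R)"

lemma coeffs_in_mult:
  assumes "is_subring R" "coeffs_in R f" "coeffs_in R g" shows "coeffs_in R (f * g)"
  unfolding coeffs_in_def coeff_mult
  using assms(2,3) by (auto simp: coeffs_in_def intro!: is_subring_sum[OF assms(1)] is_subringD(4)[OF assms(1)])

lemma coeffs_in_prod:
  assumes "is_subring R" "\<And>s. s \<in> A \<Longrightarrow> coeffs_in R (f s)" shows "coeffs_in R (prod f A)"
  using assms(2)
proof (induction A rule: infinite_finite_induct)
  case (insert a A)
  then show ?case by (simp add: coeffs_in_mult[OF assms(1)])
qed (use is_subringD(1,2)[OF assms(1)] in \<open>auto simp: coeffs_in_def\<close>)

section \<open>The q-power Frobenius and its images\<close>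

locale frobenius_field = function_field \<iota>
  for \<iota> :: "'k::finite_field poly fract \<Rightarrow> 'a::field" +
  fixes q :: nat
  assumes q_power: "\<exists>n\<ge>1. q = CHAR('a) ^ n"
begin

abbreviation \<theta> :: 'a where "\<theta> \<equiv> \<psi> [:0, 1:]"

lemma q_gt_1: "q > 1"
proof -
  obtain n where n: "n \<ge> 1" "q = CHAR('a) ^ n" using q_power by blast
  have "CHAR('a) > 1" using prime_char prime_gt_1_nat by blast
  then show ?thesis unfolding n(2) by (rule one_less_power) (use n(1) in simp)
qed

lemma q_power_char: "\<exists>n. q ^ j = CHAR('a) ^ n"
  using q_power by (metis power_mult)

lemma frobenius_diff: "(x - y :: 'a) ^ (q ^ j) = x ^ (q ^ j) - y ^ (q ^ j)"
  using q_power_char[of j] frob_diff by metis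

lemma frobenius_image_subring: "is_subring (range (\<lambda>w :: 'a. w ^ (q ^ j)))"
  unfolding is_subring_def
proof (intro conjI ballI)
  show "1 \<in> range (\<lambda>w :: 'a. w ^ (q ^ j))" by (rule range_eqI[of _ _ 1]) simp
  fix x y :: 'a assume "x \<in> range (\<lambda>w. w ^ (q ^ j))" "y \<in> range (\<lambda>w. w ^ (q ^ j))"
  then obtain u w where "x = u ^ (q ^ j)" "y = w ^ (q ^ j)" by blast
  then have "x - y = (u - w) ^ (q ^ j)" "x * y = (u * w) ^ (q ^ j)"
    by (simp_all add: frobenius_diff power_mult_distrib)
  then show "x - y \<in> range (\<lambda>w. w ^ (q ^ j))" "x * y \<in> range (\<lambda>w. w ^ (q ^ j))" by blast+
qed

lemma theta_nonzero: "\<theta> \<noteq> 0"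
  by simp

lemma theta_power_inj: "\<theta> ^ i = \<theta> ^ j \<Longrightarrow> i = j"
proof -
  have *: "i \<ge> j" if "\<theta> ^ i = \<theta> ^ j" for i j
  proof (rule ccontr)
    assume "\<not> i \<ge> j"
    then have "\<theta> ^ (j - i + i) = \<theta> ^ i" using that by simp
    then have "\<theta> ^ (j - i) = 1" using theta_nonzero by (simp only: power_add) simp
    then show False using t_not_root_of_unity[of "j - i"] \<open>\<not> i \<ge> j\<close> by simp
  qed
  show "\<theta> ^ i = \<theta> ^ j \<Longrightarrow> i = j" using *[of i j] *[of j i] by simp
qed

text \<open>Let R be the expression without its term in \<open>c J\<close>, and let W^(q^J) be the
  value of the whole. For v y >= 1, v R is at most B v(y)^(q^(J-1)). But R = - y^(q^J) (c_J -
  (W/y)^(q^J)), and \<open>c J\<close> has distance at least \<epsilon> from K^(q^J), so v R is at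
  least \<epsilon> v(y)^(q^J).\<close>

lemma bounded_solutions:
  assumes v: "v \<in> places" and J: "J \<ge> 1"
    and cJ: "c J \<notin> range (\<lambda>w :: 'a. w ^ (q ^ J))"
    and Y: "\<And>y. y \<in> Y \<Longrightarrow> (\<Sum>i<J. c i * y ^ (q ^ i)) + \<delta> + c J * y ^ (q ^ J) \<in> range (\<lambda>w. w ^ (q ^ J))"
  shows "\<exists>C\<ge>0. \<forall>y\<in>Y. v y \<le> C"
proof -
  interpret v: place v by (rule placeI) fact
  obtain \<epsilon> where \<epsilon>: "\<epsilon> > 0" "\<And>w. v (c J - w ^ (q ^ J)) \<ge> \<epsilon>"
    using q_power_char[of J] frobenius_image_closed[OF v] cJ by metis
  define B where "B = (\<Sum>i<J. v (c i)) + v \<delta>"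
  have B0: "B \<ge> 0" unfolding B_def by (intro add_nonneg_nonneg sum_nonneg) auto
  have cB: "v (c i) \<le> B" if "i < J" for i
    using member_le_sum[of i "{..<J}" "\<lambda>i. v (c i)"] that v.v_nonneg[of \<delta>] by (simp add: B_def add_increasing2)
  have "v y \<le> max 1 (B / \<epsilon>)" if y: "y \<in> Y" for y
  proof (cases "v y \<ge> 1")
    case True
    then have y0: "y \<noteq> 0" by auto
    let ?Q = "q ^ J" and ?Q' = "q ^ (J - 1)"
    define R where "R = (\<Sum>i<J. c i * y ^ (q ^ i)) + \<delta>"
    obtain W where W: "R + c J * y ^ ?Q = W ^ ?Q" using Y[OF y] unfolding R_def by blast
    have "v (c i * y ^ (q ^ i)) \<le> B * v y ^ ?Q'" if "i < J" for i
      unfolding v.v_mult v.v_power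
      using True that q_gt_1 cB[OF that] B0 by (intro mult_mono power_increasing) auto
    moreover have "v \<delta> \<le> B * v y ^ ?Q'"
    proof -
      have "v \<delta> * 1 \<le> B * v y ^ ?Q'"
        using True B0 by (intro mult_mono) (auto simp: B_def intro: sum_nonneg)
      then show ?thesis by simp
    qed
    ultimately have R_le: "v R \<le> B * v y ^ ?Q'"
      unfolding R_def using B0 by (intro order_trans[OF v.v_add] max.boundedI v.v_sum_le) auto
    have "R = W ^ ?Q - c J * y ^ ?Q" using W by (simp add: eq_diff_eq)
    also have "\<dots> = - (y ^ ?Q * (c J - (W / y) ^ ?Q))"
      using y0 by (simp add: right_diff_distrib power_divide mult.commute)
    finally have "v R = v y ^ ?Q * v (c J - (W / y) ^ ?Q)" by (simp add: v.v_mult v.v_power)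
    also have "\<dots> \<ge> v y ^ ?Q * \<epsilon>" by (intro mult_left_mono \<epsilon>) auto
    finally have 1: "v y ^ ?Q * \<epsilon> \<le> B * v y ^ ?Q'" using R_le by linarith
    \<comment> \<open>As q >= 2, the two bounds differ by at least one factor \<open>v y\<close>,
      which gives \<open>v y \<le> B / \<epsilon>\<close>.\<close>
    have "Suc ?Q' \<le> ?Q"
    proof -
      have "?Q = q * ?Q'" using J by (cases J) auto
      moreover have "2 * ?Q' \<le> q * ?Q'" using q_gt_1 by (intro mult_right_mono) auto
      moreover have "?Q' \<ge> 1" using q_gt_1 by simp
      ultimately show ?thesis by linarith
    qed
    then have "v y ^ Suc ?Q' \<le> v y ^ ?Q" using True by (rule power_increasing)
    then have "v y ^ Suc ?Q' * \<epsilon> \<le> B * v y ^ ?Q'"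
      using 1 \<epsilon>(1) by (meson mult_right_mono less_imp_le order_trans)
    then have "(v y * \<epsilon>) * v y ^ ?Q' \<le> B * v y ^ ?Q'" by (simp add: mult_ac)
    then have "v y * \<epsilon> \<le> B" using v.v_pos[OF y0] by (simp only: mult_le_cancel_right zero_less_power)
    then have "v y \<le> B / \<epsilon>" using \<epsilon>(1) by (simp add: field_simps)
    then show ?thesis by simp
  qed simp
  then show ?thesis by (intro exI[of _ "max 1 (B / \<epsilon>)"]) auto
qed

lemma coefficient_class:
  fixes f :: "'a poly" and Y :: "'a set"
  assumes T: "finite T" "T \<subseteq> places"
    and Y: "infinite Y" "\<And>y v. y \<in> Y \<Longrightarrow> v \<in> places - T \<Longrightarrow> v y \<le> 1"
    and e: "e \<noteq> 0" and m: "degree f \<le> m"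
    and eq: "\<And>y. y \<in> Y \<Longrightarrow> \<exists>w. \<delta> + twisted_eval q f y = e * w ^ (q ^ m)"
    and j: "j \<ge> 1"
  shows "\<exists>w. coeff f j = e * w ^ (q ^ j)"
proof (rule ccontr)
  assume neg: "\<not> ?thesis"
  define P where "P i \<longleftrightarrow> i \<ge> 1 \<and> \<not> (\<exists>w. coeff f i = e * w ^ (q ^ i))" for i
  have Pm: "i \<le> m" if "P i" for i
  proof (rule ccontr)
    assume "\<not> i \<le> m"
    then have "coeff f i = e * 0 ^ (q ^ i)" using m q_gt_1 by (simp add: coeff_eq_0 power_0_left)
    then show False using that by (auto simp: P_def)
  qed
  \<comment> \<open>Beyond \<open>m\<close> the coefficients are 0, which is
    \<open>e * 0 ^ (q ^ i)\<close>, so the failing indices are bounded and a largest one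
    exists.\<close>
  define J where "J = (GREATEST i. P i)"
  have "P j" using neg j by (simp add: P_def)
  then have PJ: "P J" unfolding J_def using Pm by (rule GreatestI_nat)
  have gt: "i \<le> J" if "P i" for i unfolding J_def using that Pm by (rule Greatest_le_nat)
  have J: "J \<ge> 1" "J \<le> m" using PJ Pm by (auto simp: P_def)
  define c where "c i = coeff f i / e" for i
  have "\<forall>i>J. \<exists>w. c i = w ^ (q ^ i)"
  proof (intro allI impI)
    fix i assume i: "i > J"
    then have "\<not> P i" using gt[of i] by auto
    then obtain w where "coeff f i = e * w ^ (q ^ i)" using i by (auto simp: P_def)
    then show "\<exists>w. c i = w ^ (q ^ i)" using e by (auto simp: c_def)
  qed
  then obtain u where u: "\<And>i. i > J \<Longrightarrow> c i = u i ^ (q ^ i)" by metis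
  have cJ: "c J \<notin> range (\<lambda>w. w ^ (q ^ J))"
  proof
    assume "c J \<in> range (\<lambda>w. w ^ (q ^ J))"
    then obtain w where "c J = w ^ (q ^ J)" by blast
    then have "coeff f J = e * w ^ (q ^ J)" using e by (simp add: c_def field_simps)
    then show False using PJ by (auto simp: P_def)
  qed
  let ?K = "range (\<lambda>w :: 'a. w ^ (q ^ J))"
  have higher: "x ^ (q ^ i) \<in> ?K" if "i \<ge> J" for x :: 'a and i
  proof (rule range_eqI)
    have "q ^ i = q ^ (i - J) * q ^ J" using that by (simp flip: power_add)
    then show "x ^ (q ^ i) = (x ^ (q ^ (i - J))) ^ (q ^ J)" by (simp add: power_mult)
  qed
  \<comment> \<open>After division by \<open>e\<close>, the terms of index above \<open>J\<close>
    lie in K^(q^J), and so does \<open>w ^ (q ^ m)\<close> because \<open>J \<le> m\<close>.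
    Collecting them on one side leaves the form required by
    \<open>bounded_solutions\<close>.\<close>
  have key: "(\<Sum>i<J. c i * y ^ (q ^ i)) + \<delta> / e + c J * y ^ (q ^ J) \<in> ?K" if y: "y \<in> Y" for y
  proof -
    obtain w where w: "\<delta> + twisted_eval q f y = e * w ^ (q ^ m)" using eq[OF y] by blast
    have "twisted_eval q f y = (\<Sum>i\<le>m. coeff f i * y ^ (q ^ i))" by (rule twisted_eval_bound) fact
    also have "\<dots> = e * (\<Sum>i\<le>m. c i * y ^ (q ^ i))" using e by (simp add: sum_distrib_left c_def)
    also have "(\<Sum>i\<le>m. c i * y ^ (q ^ i)) = (\<Sum>i\<in>{..<J} \<union> {J} \<union> {J<..m}. c i * y ^ (q ^ i))"
      by (rule sum.cong) (use J in auto)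
    also have "\<dots> = (\<Sum>i<J. c i * y ^ (q ^ i)) + c J * y ^ (q ^ J) + (\<Sum>i\<in>{J<..m}. c i * y ^ (q ^ i))"
      by (subst sum.union_disjoint; (subst sum.union_disjoint)?) auto
    finally have eq1: "(\<Sum>i<J. c i * y ^ (q ^ i)) + \<delta> / e + c J * y ^ (q ^ J) =
        w ^ (q ^ m) - (\<Sum>i\<in>{J<..m}. c i * y ^ (q ^ i))"
      using w e by (simp add: field_simps)
    have "c i * y ^ (q ^ i) \<in> ?K" if "i \<in> {J<..m}" for i
    proof -
      have "c i * y ^ (q ^ i) = (u i * y) ^ (q ^ i)" using u that by (simp add: power_mult_distrib)
      then show ?thesis using higher[of i "u i * y"] that by simp
    qed
    then have "(\<Sum>i\<in>{J<..m}. c i * y ^ (q ^ i)) \<in> ?K"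
      by (intro is_subring_sum[OF frobenius_image_subring])
    then show ?thesis
      unfolding eq1 by (intro is_subringD(3)[OF frobenius_image_subring] higher J)
  qed
  have "\<exists>C\<ge>0. \<forall>y\<in>Y. v y \<le> C" if "v \<in> places" for v
    by (rule bounded_solutions[OF that J(1) cJ key])
  then obtain C where C: "\<And>v. v \<in> places \<Longrightarrow> C v \<ge> 0" "\<And>v y. v \<in> places \<Longrightarrow> y \<in> Y \<Longrightarrow> v y \<le> C v"
    by metis
  have "v y \<le> (\<Sum>v\<in>T. C v)" if "v \<in> T" "y \<in> Y" for v y
  proof -
    have "C v \<le> (\<Sum>v\<in>T. C v)" using that T C(1) by (intro member_le_sum) auto
    then show ?thesis using C(2)[of v y] that T by force
  qed
  then have "Y \<subseteq> {x. (\<forall>v\<in>places - T. v x \<le> 1) \<and> (\<forall>v\<in>T. v x \<le> (\<Sum>v\<in>T. C v))}"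
    using Y(2) by blast
  then show False using finite_bounded[OF T] Y(1) finite_subset by blast
qed

end

section \<open>Coefficients of a Drinfeld module\<close>

locale drinfeld = frobenius_field \<iota> q
  for \<iota> :: "'k::finite_field poly fract \<Rightarrow> 'a::field" and q :: nat +
  fixes \<Phi> :: "'k poly \<Rightarrow> 'a poly"
  assumes drin: "drinfeld_module q \<iota> \<Phi>"
    and module_action: "module (drinfeld_action q \<Phi>)"
begin

sublocale M: module "drinfeld_action q \<Phi>"
  by (rule module_action)

abbreviation X :: "'k poly" where "X \<equiv> [:0, 1:]"

lemma coeff_Phi_mult:
  "coeff (\<Phi> (a * b)) i = (\<Sum>l\<le>i. coeff (\<Phi> a) l * coeff (\<Phi> b) (i - l) ^ (q ^ l))"
  using drin q_gt_1 coeff_twisted_mult[of q "\<Phi> a" "\<Phi> b" i] by (simp add: drinfeld_module_def)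

lemma coeff_Phi_0: "coeff (\<Phi> a) 0 = \<psi> a"
  using drin by (simp add: drinfeld_module_def)

text \<open>If \<open>\<Phi> X\<close> were constant, comparing the coefficients of \<tau>^i, i > 0,
  in \<open>\<Phi> (a * X)\<close> and \<open>\<Phi> (X * a)\<close> would give c (\<theta>^(q^i) -
  \<theta>) = 0 for the i-th coefficient c of \<open>\<Phi> a\<close>. As \<theta> is no root of
  unity, every \<open>\<Phi> a\<close> would be constant.\<close>

lemma degree_Phi_X: "degree (\<Phi> X) > 0"
proof (rule ccontr)
  assume "\<not> degree (\<Phi> X) > 0"
  then have zero: "coeff (\<Phi> X) i = 0" if "i > 0" for i using that by (simp add: coeff_eq_0)
  have "\<Phi> a = [:\<psi> a:]" for a
  proof (rule poly_eqI)
    fix i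
    show "coeff (\<Phi> a) i = coeff [:\<psi> a:] i"
    proof (cases "i = 0")
      case False
      have "coeff (\<Phi> (a * X)) i = (\<Sum>l\<le>i. if l = i then coeff (\<Phi> a) i * \<theta> ^ (q ^ i) else 0)"
        unfolding coeff_Phi_mult
        by (rule sum.cong) (use zero q_gt_1 in \<open>auto simp: coeff_Phi_0 power_0_left\<close>)
      then have 1: "coeff (\<Phi> (a * X)) i = coeff (\<Phi> a) i * \<theta> ^ (q ^ i)" by simp
      have "coeff (\<Phi> (X * a)) i = (\<Sum>l\<le>i. if l = 0 then \<theta> * coeff (\<Phi> a) i else 0)"
        unfolding coeff_Phi_mult
        by (rule sum.cong) (use zero in \<open>auto simp: coeff_Phi_0\<close>)
      then have 2: "coeff (\<Phi> (X * a)) i = \<theta> * coeff (\<Phi> a) i" by simp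
      have "\<theta> ^ (q ^ i) \<noteq> \<theta> ^ 1"
      proof
        assume "\<theta> ^ (q ^ i) = \<theta> ^ 1"
        then have "q ^ i = 1" by (rule theta_power_inj)
        then show False using False q_gt_1 by simp
      qed
      moreover have "coeff (\<Phi> a) i * (\<theta> ^ (q ^ i) - \<theta> ^ 1) = 0"
        using 1 2 by (simp only: mult.commute[of a X]) (auto simp: algebra_simps)
      ultimately have "coeff (\<Phi> a) i = 0" by simp
      then show ?thesis using False by (simp add: coeff_pCons split: nat.splits)
    qed (simp add: coeff_Phi_0)
  qed
  then show False using drin by (simp add: drinfeld_module_def)
qed

text \<open>The coefficients of the logarithm of \<open>\<Phi>\<close>, i.e. of the solution \<open>L = \<Sum>\<^sub>i l\<^sub>i \<tau>\<^sup>i\<close> of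
  \<open>L \<Phi>\<^sub>t = t L\<close> with \<open>l\<^sub>0 = 1\<close>.\<close>

fun log_coeff :: "nat \<Rightarrow> 'a" where
  "log_coeff i = (if i = 0 then 1 else
     (\<Sum>s<i. log_coeff s * coeff (\<Phi> X) (i - s) ^ (q ^ s)) / (\<theta> - \<theta> ^ (q ^ i)))"

declare log_coeff.simps [simp del]

lemma theta_powers_distinct: "i \<noteq> j \<Longrightarrow> \<theta> ^ (q ^ i) \<noteq> \<theta> ^ (q ^ j)"
  using theta_power_inj[of "q ^ i" "q ^ j"] q_gt_1 by auto

lemma log_coeff_rec:
  "i > 0 \<Longrightarrow> log_coeff i * (\<theta> - \<theta> ^ (q ^ i)) = (\<Sum>s<i. log_coeff s * coeff (\<Phi> X) (i - s) ^ (q ^ s))"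
  using theta_powers_distinct[of 0 i] by (simp add: log_coeff.simps[of i])

text \<open>The logarithm is not a polynomial: if I were the last nonzero index and r the degree of
  \<open>\<Phi> X\<close>, the recursion at I + r would retain only the term s = I, with a power of
  the leading coefficient of \<open>\<Phi> X\<close>, and that term is nonzero.\<close>

lemma log_coeff_frequently_nonzero: "\<exists>i\<ge>n. log_coeff i \<noteq> 0"
proof (rule ccontr)
  assume "\<not> ?thesis"
  then have zero: "log_coeff i = 0" if "i \<ge> n" for i using that by blast
  define I where "I = (GREATEST i. log_coeff i \<noteq> 0)"
  have bound: "i \<le> n" if "log_coeff i \<noteq> 0" for i using zero[of i] that by (meson nat_le_linear)
  have "log_coeff 0 \<noteq> 0" by (simp add: log_coeff.simps)
  then have I: "log_coeff I \<noteq> 0" unfolding I_def by (rule GreatestI_nat) (rule bound)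
  have above: "log_coeff i = 0" if "i > I" for i
  proof (rule ccontr)
    assume "log_coeff i \<noteq> 0"
    then have "i \<le> I" unfolding I_def by (rule Greatest_le_nat) (rule bound)
    then show False using that by simp
  qed
  let ?r = "degree (\<Phi> X)"
  have "(\<Sum>s<I + ?r. log_coeff s * coeff (\<Phi> X) (I + ?r - s) ^ (q ^ s)) =
      (\<Sum>s<I + ?r. if s = I then log_coeff I * coeff (\<Phi> X) ?r ^ (q ^ I) else 0)"
  proof (rule sum.cong[OF refl])
    fix s
    have "s > I \<or> s = I \<or> I + ?r - s > ?r" by linarith
    then show "log_coeff s * coeff (\<Phi> X) (I + ?r - s) ^ (q ^ s) =
        (if s = I then log_coeff I * coeff (\<Phi> X) ?r ^ (q ^ I) else 0)"
      using above[of s] coeff_eq_0[of "\<Phi> X" "I + ?r - s"] q_gt_1 by (auto simp: power_0_left)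
  qed
  also have "\<dots> = log_coeff I * coeff (\<Phi> X) ?r ^ (q ^ I)" using degree_Phi_X by simp
  also have "\<dots> \<noteq> 0" using I degree_Phi_X by (auto simp: leading_coeff_0_iff)
  finally have "log_coeff (I + ?r) \<noteq> 0"
    using log_coeff_rec[of "I + ?r"] degree_Phi_X by auto
  then show False using above[of "I + ?r"] degree_Phi_X by simp
qed

text \<open>The K-linear functional on K[x] that sends x^k to the coefficient of \<tau>^i in
  \<open>\<Phi> (X ^ k)\<close>.\<close>

definition pairing :: "'a poly \<Rightarrow> nat \<Rightarrow> 'a" where
  "pairing P i = (\<Sum>k\<le>degree P. coeff P k * coeff (\<Phi> (X ^ k)) i)"

lemma pairing_bound: "degree P \<le> n \<Longrightarrow> pairing P i = (\<Sum>k\<le>n. coeff P k * coeff (\<Phi> (X ^ k)) i)"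
  unfolding pairing_def by (rule sum.mono_neutral_left) (auto simp: coeff_eq_0)

lemma pairing_shift: "pairing (pCons 0 P) i = (\<Sum>l\<le>i. pairing P l * coeff (\<Phi> X) (i - l) ^ (q ^ l))"
proof -
  have "pairing (pCons 0 P) i = (\<Sum>k\<le>Suc (degree P). coeff (pCons 0 P) k * coeff (\<Phi> (X ^ k)) i)"
    by (rule pairing_bound) (rule degree_pCons_le)
  also have "\<dots> = (\<Sum>k\<le>degree P. coeff P k * coeff (\<Phi> (X ^ k * X)) i)"
    by (simp add: sum.atMost_Suc_shift mult.commute del: sum.atMost_Suc)
  also have "\<dots> = (\<Sum>k\<le>degree P. \<Sum>l\<le>i. coeff P k * coeff (\<Phi> (X ^ k)) l * coeff (\<Phi> X) (i - l) ^ (q ^ l))"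
    unfolding coeff_Phi_mult by (simp only: sum_distrib_left mult.assoc)
  also have "\<dots> = (\<Sum>l\<le>i. pairing P l * coeff (\<Phi> X) (i - l) ^ (q ^ l))"
    unfolding pairing_def by (subst sum.swap) (simp only: sum_distrib_right)
  finally show ?thesis .
qed

text \<open>In \<open>pairing_shift\<close> the term \<open>l = i\<close> is
  \<open>pairing P i * \<theta> ^ (q ^ i)\<close>. The linear factor cancels it and leaves lower
  indices only, in the pattern of \<open>log_coeff_rec\<close>.\<close>

lemma pairing_linear_factor:
  "pairing ([:- (\<theta> ^ (q ^ i)), 1:] * P) i = (\<Sum>l<i. pairing P l * coeff (\<Phi> X) (i - l) ^ (q ^ l))"
proof -
  let ?a = "\<theta> ^ (q ^ i)" and ?n = "Suc (degree P)"
  have deg: "degree ([:- ?a, 1:] * P) \<le> ?n" by (rule order_trans[OF degree_mult_le]) simp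
  have "coeff ([:- ?a, 1:] * P) k = coeff (pCons 0 P) k - ?a * coeff P k" for k
    by simp
  then have "pairing ([:- ?a, 1:] * P) i = pairing (pCons 0 P) i - ?a * pairing P i"
    unfolding pairing_bound[OF deg] pairing_bound[OF degree_pCons_le[of 0 P]]
      pairing_bound[of P ?n, OF le_SucI[OF order.refl]]
    by (simp only: left_diff_distrib sum_subtractf sum_distrib_left mult.assoc)
  also have "\<dots> = (\<Sum>l<i. pairing P l * coeff (\<Phi> X) (i - l) ^ (q ^ l))"
    unfolding pairing_shift lessThan_Suc_atMost[symmetric] by (simp add: coeff_Phi_0 mult.commute)
  finally show ?thesis .
qed

text \<open>The coefficient of \<open>\<tau>\<^sup>i\<close> in \<open>\<Phi>\<^sub>a = L\<^sup>-\<^sup>1 a L\<close> is a combination of \<open>a\<close>, \<open>a\<^sup>q\<close>, \dots with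
  coefficient \<open>l\<^sub>i\<close> at \<open>a\<close>; a polynomial vanishing at the higher conjugates of \<open>t\<close> isolates it.\<close>

lemma pairing_eq:
  assumes "\<And>s. 1 \<le> s \<Longrightarrow> s \<le> i \<Longrightarrow> poly P (\<theta> ^ (q ^ s)) = 0"
  shows "pairing P i = log_coeff i * poly P \<theta>"
  using assms
proof (induction i arbitrary: P rule: less_induct)
  case (less i)
  show ?case
  proof (cases "i = 0")
    case True
    have "pairing P 0 = poly P \<theta>"
      by (simp add: pairing_def coeff_Phi_0 psi_power poly_altdef)
    then show ?thesis using True by (simp add: log_coeff.simps)
  next
    case False
    then have "poly P (\<theta> ^ (q ^ i)) = 0" using less.prems by simp
    then obtain R where R: "P = [:- (\<theta> ^ (q ^ i)), 1:] * R" by (auto simp: poly_eq_0_iff_dvd)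
    \<comment> \<open>The cofactor inherits the zeros with \<open>s < i\<close>, where the linear
      factor is nonzero, so the induction hypothesis applies to it at every
      \<open>l < i\<close>.\<close>
    have R0: "poly R (\<theta> ^ (q ^ s)) = 0" if "1 \<le> s" "s < i" for s
    proof -
      have "poly P (\<theta> ^ (q ^ s)) = (\<theta> ^ (q ^ s) - \<theta> ^ (q ^ i)) * poly R (\<theta> ^ (q ^ s))"
        by (simp add: R algebra_simps)
      then show ?thesis using less.prems[of s] theta_powers_distinct[of s i] that by auto
    qed
    have "pairing P i = (\<Sum>l<i. log_coeff l * poly R \<theta> * coeff (\<Phi> X) (i - l) ^ (q ^ l))"
      unfolding R pairing_linear_factor
      by (intro sum.cong refl arg_cong2[where f = times] less.IH R0) auto
    also have "\<dots> = poly R \<theta> * (log_coeff i * (\<theta> - \<theta> ^ (q ^ i)))"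
      using False by (simp add: log_coeff_rec sum_distrib_left mult_ac)
    also have "\<dots> = log_coeff i * poly P \<theta>" by (simp add: R algebra_simps)
    finally show ?thesis .
  qed
qed

text \<open>Let P have coefficients in K^(q^i) and vanish at \<theta>^(q^s) for 1 <= s <= i, but not
  at \<theta>. Pairing with P and with xP puts l_i P(\<theta>) / e and l_i \<theta> P(\<theta>) / e
  into K^(q^i), and \<theta> is the quotient.\<close>

lemma theta_is_frobenius_power:
  assumes i: "i \<ge> 1" "log_coeff i \<noteq> 0"
    and classes: "\<And>m. \<exists>e\<noteq>0. \<forall>k\<le>m. \<exists>w. coeff (\<Phi> (X ^ k)) i = e * w ^ (q ^ i)"
  shows "\<theta> \<in> range (\<lambda>w. w ^ (q ^ i))"
proof -
  let ?K = "range (\<lambda>w :: 'a. w ^ (q ^ i))"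
  note K = frobenius_image_subring[of i]
  \<comment> \<open>This exponent makes \<open>\<theta> ^ (q ^ s * m)\<close> a q^i-th power for
    every s >= 1, so all factors of \<open>P\<close> have coefficients in \<open>?K\<close>, and
    none of them vanishes at \<theta>.\<close>
  define m where "m = q ^ (i - 1)"
  have m0: "m > 0" using q_gt_1 by (simp add: m_def)
  define P where "P = (\<Prod>s=1..i. monom 1 m - [:\<theta> ^ (q ^ s * m):])"
  have poly_P: "poly P x = (\<Prod>s=1..i. x ^ m - \<theta> ^ (q ^ s * m))" for x
    by (simp add: P_def poly_prod poly_monom)
  have "poly P (\<theta> ^ (q ^ s)) = 0" if "1 \<le> s" "s \<le> i" for s
    unfolding poly_P using that by (intro prod_zero) (auto simp: power_mult)
  then have vanish: "poly P (\<theta> ^ (q ^ s)) = 0" "poly (pCons 0 P) (\<theta> ^ (q ^ s)) = 0" if "1 \<le> s" "s \<le> i" for s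
    using that by auto
  have P\<theta>: "poly P \<theta> \<noteq> 0"
  proof -
    have "\<theta> ^ m \<noteq> \<theta> ^ (q ^ s * m)" if "1 \<le> s" for s
    proof
      assume "\<theta> ^ m = \<theta> ^ (q ^ s * m)"
      then have "m = q ^ s * m" by (rule theta_power_inj)
      then have "q ^ s = 1" using m0 by simp
      then show False using that q_gt_1 by simp
    qed
    then show ?thesis unfolding poly_P by simp
  qed
  have "coeffs_in ?K (monom 1 m - [:\<theta> ^ (q ^ s * m):])" if "s \<in> {1..i}" for s
  proof -
    have "q ^ s * m = q ^ (s - 1 + i)" using that by (simp add: m_def flip: power_add)
    then have "q ^ s * m = q ^ (s - 1) * q ^ i" by (simp only: power_add)
    then have "\<theta> ^ (q ^ s * m) = (\<theta> ^ (q ^ (s - 1))) ^ (q ^ i)" by (simp only: power_mult)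
    then have "\<theta> ^ (q ^ s * m) \<in> ?K" by blast
    then show ?thesis
      using is_subringD[OF K] by (auto simp: coeffs_in_def coeff_pCons split: nat.splits)
  qed
  then have PK: "coeffs_in ?K P" unfolding P_def by (rule coeffs_in_prod[OF K])
  then have PK': "coeffs_in ?K (pCons 0 P)"
    using is_subringD(2)[OF K] by (auto simp: coeffs_in_def coeff_pCons split: nat.splits)
  obtain e where e: "e \<noteq> 0" "\<And>k. k \<le> Suc (degree P) \<Longrightarrow> \<exists>w. coeff (\<Phi> (X ^ k)) i = e * w ^ (q ^ i)"
    using classes by meson
  have pair_K: "pairing R i / e \<in> ?K" if R: "coeffs_in ?K R" "degree R \<le> Suc (degree P)" for R
  proof -
    have "pairing R i / e = (\<Sum>k\<le>Suc (degree P). coeff R k * (coeff (\<Phi> (X ^ k)) i / e))"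
      unfolding pairing_bound[OF R(2)] by (simp only: sum_divide_distrib times_divide_eq_right)
    also have "\<dots> \<in> ?K"
    proof (intro is_subring_sum[OF K] is_subringD(4)[OF K])
      show "coeff R k \<in> ?K" for k using R(1) by (simp add: coeffs_in_def)
      fix k assume "k \<in> {..Suc (degree P)}"
      then obtain w where "coeff (\<Phi> (X ^ k)) i = e * w ^ (q ^ i)" using e(2) by blast
      then show "coeff (\<Phi> (X ^ k)) i / e \<in> ?K" using e(1) by simp
    qed
    finally show ?thesis .
  qed
  have "log_coeff i * poly P \<theta> / e \<in> ?K" "log_coeff i * (\<theta> * poly P \<theta>) / e \<in> ?K"
    using pair_K[OF PK] pair_K[OF PK' degree_pCons_le] pairing_eq[OF vanish(1)] pairing_eq[OF vanish(2)]
    by auto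
  then obtain u w where "log_coeff i * poly P \<theta> / e = u ^ (q ^ i)"
    "log_coeff i * (\<theta> * poly P \<theta>) / e = w ^ (q ^ i)" by blast
  then have "\<theta> = (w / u) ^ (q ^ i)"
    using i(2) P\<theta> e(1) by (simp add: power_divide flip: \<open>log_coeff i * poly P \<theta> / e = u ^ (q ^ i)\<close>
        \<open>log_coeff i * (\<theta> * poly P \<theta>) / e = w ^ (q ^ i)\<close>)
  then show ?thesis by blast
qed

text \<open>At a pole of \<theta>, a q^i-th root of \<theta> also has value > 1, hence at least N
  because the values are discrete. So the value of \<theta> would be at least N^(q^i), which fails
  for large i.\<close>

lemma not_all_frobenius_powers:
  obtains n where "\<And>i. i \<ge> n \<Longrightarrow> \<theta> \<notin> range (\<lambda>w. w ^ (q ^ i))"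
proof -
  obtain v where v: "v \<in> places" "v \<theta> > 1" using ex_place_t_gt_1 by blast
  interpret v: place v by (rule placeI) (rule v)
  obtain n where n: "v \<theta> < real v.N ^ n" using real_arch_pow[OF v.N_gt_1] by blast
  have "\<theta> \<notin> range (\<lambda>w. w ^ (q ^ i))" if i: "i \<ge> n" for i
  proof
    assume "\<theta> \<in> range (\<lambda>w. w ^ (q ^ i))"
    then obtain w where w: "\<theta> = w ^ (q ^ i)" by blast
    have w0: "w \<noteq> 0" using w theta_nonzero q_gt_1 by (auto simp: power_0_left)
    have "v w > 1"
    proof (rule ccontr)
      assume "\<not> v w > 1"
      then have "v w ^ (q ^ i) \<le> 1" by (intro power_le_one) auto
      then show False using v(2) by (simp add: w v.v_power)
    qed
    obtain k where k: "v w = real v.N powi k" using w0 by (rule v.obtain_exponent)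
    have "\<not> k \<le> 0" using \<open>v w > 1\<close> v.N_powi_le_iff[of k 0] by (simp add: k)
    then have "real v.N \<le> v w" using v.N_powi_le_iff[of 1 k] by (simp add: k)
    then have "real v.N ^ (q ^ i) \<le> v \<theta>" unfolding w v.v_power by (intro power_mono) auto
    moreover have "real v.N ^ n \<le> real v.N ^ (q ^ i)"
    proof (rule power_increasing)
      have "i \<le> q ^ i" using q_gt_1 by (intro self_le_ge2_pow) auto
      then show "n \<le> q ^ i" using i by simp
    qed (use v.N_gt_1 in simp)
    ultimately show False using n by linarith
  qed
  then show ?thesis using that by blast
qed

text \<open>Finiteness of \<Gamma> modulo the image of \<open>b\<close>: the coefficients of the
  generators are divided by \<open>b\<close> in F_q[t], and the remainders have bounded
  degree.\<close>

lemma division_with_remainder: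
  assumes G: "finite G" and \<Gamma>: "\<Gamma> = M.span G" and b: "b \<noteq> 0"
  obtains B where "finite B"
    "\<And>\<gamma>. \<gamma> \<in> \<Gamma> \<Longrightarrow> \<exists>\<beta>\<in>B. \<exists>y\<in>\<Gamma>. \<gamma> = \<beta> + drinfeld_action q \<Phi> b y"
proof
  define B where "B = (\<lambda>r. \<Sum>g\<in>G. drinfeld_action q \<Phi> (r g) g) ` (G \<rightarrow>\<^sub>E polys_below (Suc (degree b)))"
  show "finite B" unfolding B_def by (intro finite_imageI finite_PiE G card_polys_below)
  fix \<gamma> assume "\<gamma> \<in> \<Gamma>"
  then obtain u where u: "\<gamma> = (\<Sum>g\<in>G. drinfeld_action q \<Phi> (u g) g)"
    unfolding \<Gamma> M.span_finite[OF G] by blast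
  define y where "y = (\<Sum>g\<in>G. drinfeld_action q \<Phi> (u g div b) g)"
  define \<beta> where "\<beta> = (\<Sum>g\<in>G. drinfeld_action q \<Phi> (u g mod b) g)"
  have "y \<in> \<Gamma>" unfolding y_def \<Gamma> by (intro M.span_sum M.span_scale M.span_base)
  moreover have "\<beta> \<in> B"
    unfolding B_def
  proof (rule image_eqI[of _ _ "restrict (\<lambda>g. u g mod b) G"])
    have "u g mod b \<in> polys_below (Suc (degree b))" for g
      using degree_mod_less[OF b, of "u g"] by (auto simp: polys_below_def coeff_eq_0)
    then show "restrict (\<lambda>g. u g mod b) G \<in> G \<rightarrow>\<^sub>E polys_below (Suc (degree b))" by auto
  qed (simp add: \<beta>_def)
  moreover have "\<gamma> = \<beta> + drinfeld_action q \<Phi> b y"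
  proof -
    have "drinfeld_action q \<Phi> (u g) g =
        drinfeld_action q \<Phi> (u g mod b) g + drinfeld_action q \<Phi> b (drinfeld_action q \<Phi> (u g div b) g)" for g
      by (simp flip: M.scale_left_distrib)
    then show ?thesis unfolding u \<beta>_def y_def M.scale_sum_right by (simp add: sum.distrib)
  qed
  ultimately show "\<exists>\<beta>\<in>B. \<exists>y\<in>\<Gamma>. \<gamma> = \<beta> + drinfeld_action q \<Phi> b y" by blast
qed

end

section \<open>Integral points\<close>

context drinfeld
begin

text \<open>The order of the choices gives one \<open>e\<close> for all \<open>k \<le> m\<close>:
  \<open>N\<close> bounds all the degrees in \<tau>, a first pigeonhole over the classes of units
  modulo q^N-th powers fixes \<open>e\<close>, and only then a second one, for each
  \<open>k\<close>, runs over the remainders modulo the image of \<open>X ^ k\<close>.\<close>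

lemma coefficient_classes:
  assumes T: "finite T" "T \<subseteq> places"
    and G: "finite G" and \<Gamma>: "\<Gamma> = M.span G"
    and integral: "\<And>\<gamma> v. \<gamma> \<in> \<Gamma> \<Longrightarrow> v \<in> places - T \<Longrightarrow> v \<gamma> \<le> 1"
    and Z: "infinite Z" "Z \<subseteq> \<Gamma>" "\<And>\<gamma>. \<gamma> \<in> Z \<Longrightarrow> \<gamma> - \<alpha> \<in> S_units T"
    and i: "i \<ge> 1"
  shows "\<exists>e\<noteq>0. \<forall>k\<le>m. \<exists>w. coeff (\<Phi> (X ^ k)) i = e * w ^ (q ^ i)"
proof -
  define N where "N = (\<Sum>k\<le>m. degree (\<Phi> (X ^ k)))"
  have deg: "degree (\<Phi> (X ^ k)) \<le> N" if "k \<le> m" for k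
    unfolding N_def using that by (intro member_le_sum) auto
  have "q ^ N > 0" using q_gt_1 by simp
  then obtain E where E: "finite E" "0 \<notin> E" "\<And>u. u \<in> S_units T \<Longrightarrow> \<exists>e\<in>E. \<exists>w. u = e * w ^ (q ^ N)"
    using S_units_finite_classes[OF T, of "q ^ N"] by blast
  define Ze where "Ze e = {\<gamma> \<in> Z. \<exists>w. \<gamma> - \<alpha> = e * w ^ (q ^ N)}" for e
  have "Z \<subseteq> (\<Union>e\<in>E. Ze e)"
  proof
    fix \<gamma> assume "\<gamma> \<in> Z"
    then show "\<gamma> \<in> (\<Union>e\<in>E. Ze e)" using E(3)[OF Z(3)] by (auto simp: Ze_def)
  qed
  then have "infinite (\<Union>e\<in>E. Ze e)" using Z(1) finite_subset by blast
  then obtain e where e: "e \<in> E" "infinite (Ze e)" using E(1) by blast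
  have e0: "e \<noteq> 0" using e(1) E(2) by blast
  have "\<exists>w. coeff (\<Phi> (X ^ k)) i = e * w ^ (q ^ i)" if k: "k \<le> m" for k
  proof -
    let ?act = "drinfeld_action q \<Phi> (X ^ k)"
    have "X ^ k \<noteq> (0 :: 'k poly)" by simp
    then obtain B where B: "finite B" "\<And>\<gamma>. \<gamma> \<in> \<Gamma> \<Longrightarrow> \<exists>\<beta>\<in>B. \<exists>y\<in>\<Gamma>. \<gamma> = \<beta> + ?act y"
      using division_with_remainder[OF G \<Gamma>, of "X ^ k"] by metis
    \<comment> \<open>The solutions y over a fixed remainder \<beta>; finitely many of their images
      cover the infinite set \<open>Ze e\<close>, so one of these sets is infinite.\<close>
    define Y where "Y \<beta> = {y \<in> \<Gamma>. \<beta> + ?act y \<in> Ze e}" for \<beta>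
    have "Ze e \<subseteq> (\<Union>\<beta>\<in>B. (\<lambda>y. \<beta> + ?act y) ` Y \<beta>)"
    proof
      fix \<gamma> assume \<gamma>: "\<gamma> \<in> Ze e"
      then have "\<gamma> \<in> \<Gamma>" using Z(2) by (auto simp: Ze_def)
      then obtain \<beta> y where "\<beta> \<in> B" "y \<in> \<Gamma>" "\<gamma> = \<beta> + ?act y" using B(2) by blast
      then show "\<gamma> \<in> (\<Union>\<beta>\<in>B. (\<lambda>y. \<beta> + ?act y) ` Y \<beta>)" using \<gamma> by (auto simp: Y_def)
    qed
    then have "infinite (\<Union>\<beta>\<in>B. (\<lambda>y. \<beta> + ?act y) ` Y \<beta>)" using e(2) finite_subset by blast
    then obtain \<beta> where \<beta>: "\<beta> \<in> B" "infinite (Y \<beta>)" using B(1) by blast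
    show ?thesis
    proof (rule coefficient_class[OF T \<beta>(2) _ e0 deg[OF k] _ i])
      show "v y \<le> 1" if "y \<in> Y \<beta>" "v \<in> places - T" for y v
        using integral[OF _ that(2)] that(1) by (simp add: Y_def)
      show "\<exists>w. \<beta> - \<alpha> + twisted_eval q (\<Phi> (X ^ k)) y = e * w ^ (q ^ N)" if y: "y \<in> Y \<beta>" for y
      proof -
        have "\<beta> + ?act y \<in> Ze e" using y by (simp add: Y_def)
        then obtain w where "\<beta> + ?act y - \<alpha> = e * w ^ (q ^ N)" unfolding Ze_def by blast
        then show ?thesis by (intro exI[of _ w]) (simp add: drinfeld_action_def algebra_simps)
      qed
    qed
  qed
  then show ?thesis using e0 by blast
qed

lemma finitely_many_translates_of_S_units:
  assumes T: "finite T" "T \<subseteq> places"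
    and G: "finite G" and \<Gamma>: "\<Gamma> = M.span G"
    and integral: "\<And>\<gamma> v. \<gamma> \<in> \<Gamma> \<Longrightarrow> v \<in> places - T \<Longrightarrow> v \<gamma> \<le> 1"
  shows "finite {\<gamma> \<in> \<Gamma>. \<gamma> - \<alpha> \<in> S_units T}"
proof (rule ccontr)
  assume inf: "infinite {\<gamma> \<in> \<Gamma>. \<gamma> - \<alpha> \<in> S_units T}"
  obtain n where n: "\<And>i. i \<ge> n \<Longrightarrow> \<theta> \<notin> range (\<lambda>w. w ^ (q ^ i))"
    using not_all_frobenius_powers by blast
  \<comment> \<open>The index must be beyond \<open>n\<close>, so that \<theta> is no q^i-th power,
    and have a nonzero logarithm coefficient; starting at \<open>Suc n\<close> also ensures
    \<open>i \<ge> 1\<close>.\<close>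
  obtain i where i: "i \<ge> Suc n" "log_coeff i \<noteq> 0" using log_coeff_frequently_nonzero by blast
  have "\<theta> \<in> range (\<lambda>w. w ^ (q ^ i))"
  proof (rule theta_is_frobenius_power[OF _ i(2)])
    show "\<exists>e\<noteq>0. \<forall>k\<le>m. \<exists>w. coeff (\<Phi> (X ^ k)) i = e * w ^ (q ^ i)" for m
    proof (rule coefficient_classes[OF T G \<Gamma> _ inf])
      show "v \<gamma> \<le> 1" if "\<gamma> \<in> \<Gamma>" "v \<in> places - T" for \<gamma> v by (rule integral[OF that])
    qed (use i in auto)
  qed (use i in simp)
  then show False using n[of i] i by simp
qed

text \<open>Horner's scheme a = c + t a' reduces all \<open>a\<close> to t and the constants, so
  integrality is governed by finitely many coefficients.\<close>

lemma action_preserves_integrality: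
  assumes v: "v \<in> places"
    and X: "\<And>i. i \<le> degree (\<Phi> X) \<Longrightarrow> v (coeff (\<Phi> X) i) \<le> 1"
    and const: "\<And>c i. i \<le> degree (\<Phi> [:c:]) \<Longrightarrow> v (coeff (\<Phi> [:c:]) i) \<le> 1"
    and x: "v x \<le> 1"
  shows "v (drinfeld_action q \<Phi> a x) \<le> 1"
proof -
  interpret v: place v by (rule placeI) fact
  show ?thesis
  proof (induction a rule: pCons_induct)
    case 0
    then show ?case by simp
  next
    case (pCons c a)
    have "pCons c a = [:c:] + X * a" by simp
    then have "drinfeld_action q \<Phi> (pCons c a) x =
        drinfeld_action q \<Phi> [:c:] x + drinfeld_action q \<Phi> X (drinfeld_action q \<Phi> a x)"
      by (simp only: M.scale_left_distrib M.scale_scale)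
    also have "v \<dots> \<le> 1"
    proof (intro order_trans[OF v.v_add] max.boundedI)
      show "v (drinfeld_action q \<Phi> [:c:] x) \<le> 1"
        unfolding drinfeld_action_def by (intro v.v_twisted_eval_le_1 const x)
      show "v (drinfeld_action q \<Phi> X (drinfeld_action q \<Phi> a x)) \<le> 1"
        unfolding drinfeld_action_def[of q \<Phi> X] by (intro v.v_twisted_eval_le_1 X pCons.IH)
    qed
    finally show ?case .
  qed
qed

lemma finite_S_integral:
  assumes G: "finite G" and \<Gamma>: "\<Gamma> = M.span G" and S: "finite S" "S \<subseteq> places"
  shows "finite {\<gamma> \<in> \<Gamma>. S_integral S \<alpha> \<gamma>}"
proof -
  \<comment> \<open>The elements whose poles are added to \<open>S\<close>. The set is finite
    because there are finitely many constants \<open>c\<close>.\<close>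
  define D where "D = insert \<alpha> (G \<union> coeff (\<Phi> X) ` {..degree (\<Phi> X)} \<union>
    (\<Union>c. coeff (\<Phi> [:c:]) ` {..degree (\<Phi> [:c:])}))"
  have "finite D" using G by (simp add: D_def)
  define T where "T = S \<union> (\<Union>d\<in>D. {v \<in> places. v d > 1})"
  have T: "finite T" "T \<subseteq> places"
    unfolding T_def by (intro finite_UnI S finite_UN_I \<open>finite D\<close> finite_poles) (use S in blast)
  have D_le: "v d \<le> 1" if "v \<in> places - T" "d \<in> D" for v d
  proof (rule ccontr)
    assume "\<not> v d \<le> 1"
    then have "v \<in> T" unfolding T_def using that by (intro UnI2 UN_I[of d]) auto
    then show False using that by blast
  qed
  have integral: "v \<gamma> \<le> 1" if \<gamma>: "\<gamma> \<in> \<Gamma>" and v: "v \<in> places - T" for \<gamma> v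
  proof -
    interpret v: place v by (rule placeI) (use v in simp)
    obtain u where u: "\<gamma> = (\<Sum>g\<in>G. drinfeld_action q \<Phi> (u g) g)"
      using \<gamma> unfolding \<Gamma> M.span_finite[OF G] by blast
    show ?thesis
      unfolding u
    proof (rule v.v_sum_le)
      fix g assume g: "g \<in> G"
      show "v (drinfeld_action q \<Phi> (u g) g) \<le> 1"
      proof (rule action_preserves_integrality)
        show "v (coeff (\<Phi> X) i) \<le> 1" if "i \<le> degree (\<Phi> X)" for i
          by (rule D_le[OF v]) (use that in \<open>simp add: D_def\<close>)
        show "v (coeff (\<Phi> [:c:]) i) \<le> 1" if "i \<le> degree (\<Phi> [:c:])" for c i
          by (rule D_le[OF v]) (use that in \<open>force simp: D_def\<close>)
        show "v g \<le> 1" by (rule D_le[OF v]) (use g in \<open>simp add: D_def\<close>)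
      qed (use v in simp)
    qed simp
  qed
  have "\<gamma> - \<alpha> \<in> S_units T" if \<gamma>: "\<gamma> \<in> \<Gamma>" "S_integral S \<alpha> \<gamma>" "\<gamma> \<noteq> \<alpha>" for \<gamma>
  proof -
    have "v (\<gamma> - \<alpha>) = 1" if v: "v \<in> places - T" for v
    proof -
      interpret v: place v by (rule placeI) (use v in simp)
      \<comment> \<open>Since \<alpha> is integral at \<open>v\<close>, S-integrality gives
        \<open>v (\<alpha> - \<gamma>) \<ge> 1\<close>; integrality of both elements gives the
        opposite inequality.\<close>
      have "v \<alpha> \<le> 1" using D_le[OF v] by (simp add: D_def)
      moreover have "v \<in> places - S" using v by (auto simp: T_def)
      ultimately have "v (\<alpha> - \<gamma>) \<ge> 1" using \<gamma>(2) by (auto simp: S_integral_def)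
      moreover have "v (\<gamma> - \<alpha>) \<le> 1"
        using v.v_diff[of \<gamma> \<alpha>] integral[OF \<gamma>(1) v] \<open>v \<alpha> \<le> 1\<close> by linarith
      ultimately show ?thesis using v.v_minus[of "\<alpha> - \<gamma>"] by simp
    qed
    then show ?thesis using \<gamma>(3) by (simp add: S_units_def)
  qed
  \<comment> \<open>The point \<alpha> is listed separately, as the difference is then 0 and not a
    unit.\<close>
  then have "{\<gamma> \<in> \<Gamma>. S_integral S \<alpha> \<gamma>} \<subseteq> insert \<alpha> {\<gamma> \<in> \<Gamma>. \<gamma> - \<alpha> \<in> S_units T}" by blast
  moreover have "finite {\<gamma> \<in> \<Gamma>. \<gamma> - \<alpha> \<in> S_units T}"
    by (rule finitely_many_translates_of_S_units[OF T G \<Gamma>]) (rule integral)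
  ultimately show ?thesis by (meson finite_insert finite_subset)
qed

end

text \<open>Translation by 1 permutes the field, so summing x + 1 over all x shows that the number
  of elements is 0 in the field.\<close>

lemma CHAR_eq_if_card:
  assumes "prime p" "card (UNIV :: 'k::finite_field set) = p ^ n"
  shows "CHAR('k) = p"
proof -
  have "(\<Sum>x\<in>(UNIV :: 'k set). x + 1) = (\<Sum>x\<in>UNIV. x)"
    by (rule sum.reindex_bij_witness[of _ "\<lambda>x. x - 1" "\<lambda>x. x + 1"]) auto
  then have "(of_nat (card (UNIV :: 'k set)) :: 'k) = 0"
    by (simp add: sum.distrib)
  then have "CHAR('k) dvd p ^ n"
    using assms(2) by (metis of_nat_eq_0_iff_char_dvd)
  then show ?thesis
    using assms(1) CHAR_prime[where 'a = 'k] prime_dvd_power primes_dvd_imp_eq by blast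
qed

theorem theorem1p1:
  fixes p q :: nat
    and \<iota> :: "'k::finite_field poly fract \<Rightarrow> 'a::field"
    and \<Phi> :: "'k poly \<Rightarrow> 'a poly"
    and \<Gamma> :: "'a set" and \<alpha> :: 'a
    and S :: "('a \<Rightarrow> real) set"
  assumes "prime p" and "\<exists>n\<ge>1. q = p ^ n" and "card (UNIV :: 'k set) = q"
    and "finite_field_extension \<iota>"
    and "drinfeld_module q \<iota> \<Phi>"
    and "drinfeld_submodule q \<Phi> \<Gamma>" and "drinfeld_finitely_generated q \<Phi> \<Gamma>"
    and "S \<subseteq> places" and "finite S"
  shows "finite {\<gamma> \<in> \<Gamma>. S_integral S \<alpha> \<gamma>}"
proof -
  obtain n where n: "n \<ge> 1" "q = p ^ n" using assms(2) by blast
  have "CHAR('k) = p" by (rule CHAR_eq_if_card[where n = n]) (use assms(1,3) n in auto)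
  then have char: "CHAR('a) = p" using CHAR_finite_field_extension[OF assms(4)] by simp
  interpret drinfeld \<iota> q \<Phi>
  proof (intro drinfeld.intro drinfeld_axioms.intro frobenius_field.intro
      frobenius_field_axioms.intro function_field.intro)
    show "\<exists>n\<ge>1. q = CHAR('a) ^ n" using n char by blast
    show "module (drinfeld_action q \<Phi>)"
      by (rule module_drinfeld_action[OF assms(1) n(2) assms(3-5)])
  qed (rule assms)+
  obtain G where G: "finite G" "M.span G = \<Gamma>"
    using assms(7) by (auto simp: drinfeld_finitely_generated_def)
  show ?thesis by (rule finite_S_integral[OF G(1) G(2)[symmetric] assms(9,8)])
qed

end
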